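(* Let $n\ge1$ be a fixed integer and let $0<\varepsilon<n^{-1}$. For every $N$ let $A=A(N)$ be a random Hermitian matrix of size $N$ with eigenvalues $\lambda_1(A)\le\dots\le\lambda_N(A)$. Assume that for every finite $r\in\mathbb{N}$ one has $$\lim_{N\to\infty}N^{n\varepsilon}\left(\frac1N\log\mathbb{E}\left[HC(x_1,\dots,x_r,0^{N-r};\lambda_1(A),\dots,\lambda_N(A))\right]-\sum_{j=0}^{n-1}\sum_{i=1}^r\frac{1}{N^{j\varepsilon}}\Psi_j(x_i)\right)=\sum_{i=1}^r\Psi_n(x_i),$$ where $\Psi_0,\dots,\Psi_n$ are smooth functions in a complex neighborhood of $0$ and the convergence is uniform in a complex neighborhood of $0^r$. Then for every $k\in\mathbb{N}$ the $1/N^{n\varepsilon}$ correction of the average empirical distribution of $N^{-1}A$ is given by $$\lim_{N\to\infty}N^{n\varepsilon}\left(\frac{1}{N^{k+1}}\mathbb{E}[\operatorname{Tr}(A^k)]-\sum_{j=0}^{n-1}\frac{1}{N^{j\varepsilon}}\boldsymbol{\mu}^{(j)}_k\right)=\boldsymbol{\mu}^{(n)}_k,$$ where for every $j\in\{0,\dots,n\}$ $$\boldsymbol{\mu}^{(j)}_k=\sum_{b_1+2b_2+\dots+jb_j=j}\ \sum_{m=0}^{k-b_1-\dots-b_j}\frac{k!}{m!\,(m+1)!\,(k-m-b_1-\dots-b_j)!\,b_1!\cdots b_j!}\left.\frac{d^m}{dx^m}\left((\Psi_0'(x))^{k-m-b_1-\dots-b_j}(\Psi_1'(x))^{b_1}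\cdots(\Psi_j'(x))^{b_j}\right)\right|_{x=0}.$$
   Context: $\mathbb{N}=\{1,2,\dots\}$; $0^m$ denotes $m$ zeros $(0,\dots,0)$. In the definition of $\boldsymbol{\mu}^{(j)}_k$ the outer sum is over non-negative integers $b_1,\dots,b_j$ with the stated constraint (for $j=0$ there are no $b$'s and only the sum over $m$ from $0$ to $k$ remains), and an inner sum with negative upper limit is zero. For $x_1,\dots,x_N\in\mathbb{C}$ and $\lambda_1,\dots,\lambda_N\in\mathbb{R}$ the Harish-Chandra integral is $$HC(x_1,\dots,x_N;\lambda_1,\dots,\lambda_N)=\int_{U(N)}\exp\left(\operatorname{Tr}(D_\lambda U D_x U^* )\right)\mathbf{m}_N(dU),$$ where $D_\lambda=\operatorname{diag}(\lambda_1,\dots,\lambda_N)$, $D_x=\operatorname{diag}(x_1,\dots,x_N)$ and $\mathbf{m}_N$ is the Haar probability measure on the unitary group $U(N)$. The expectation $\mathbb{E}$ is over the random eigenvalues of $A$. The hypothesis implicitly includes that the expectations are finite and that the logarithm (the branch equal to $0$ at $x=0$) is well defined near the origin. "Smooth in a complex neighborhood" means complex differentiable (holomorphic). *)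

theory Defs
  imports
    "HOL-Probability.Probability"
    "Jordan_Normal_Form.Char_Poly"
    "Jordan_Normal_Form.Schur_Decomposition"
begin

(* Matrices of varying size N are elements of the type complex mat, with indices 0, ..., N - 1;
   N-tuples x_1, ..., x_N are functions x on nat, with x_(i+1) rendered as x i. *)

definition mat_trace :: "'a :: comm_monoid_add mat \<Rightarrow> 'a" where
  "mat_trace A = (\<Sum>i<dim_row A. A $$ (i, i))"

definition hermitian_mat :: "nat \<Rightarrow> complex mat \<Rightarrow> bool" where
  "hermitian_mat N A \<longleftrightarrow> A \<in> carrier_mat N N \<and> mat_adjoint A = A"

(* For Hermitian A this is the unique increasing list of its eigenvalues, repeated according to
   multiplicity. *)
definition eigenvalue_list :: "complex mat \<Rightarrow> real list" where
  "eigenvalue_list A =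
     (THE ls. sorted ls \<and> char_poly A = (\<Prod>l\<leftarrow>ls. [:- complex_of_real l, 1:]))"

definition random_hermitian :: "nat \<Rightarrow> 'a measure \<Rightarrow> ('a \<Rightarrow> complex mat) \<Rightarrow> bool" where
  "random_hermitian N P A \<longleftrightarrow>
     prob_space P \<and>
     (\<forall>\<omega>\<in>space P. hermitian_mat N (A \<omega>)) \<and>
     (\<forall>i<N. \<forall>j<N. (\<lambda>\<omega>. A \<omega> $$ (i, j)) \<in> borel_measurable P)"

definition unitary_group :: "nat \<Rightarrow> complex mat set" where
  "unitary_group N =
     {U \<in> carrier_mat N N. U * mat_adjoint U = 1\<^sub>m N \<and> mat_adjoint U * U = 1\<^sub>m N}"

(* The type complex mat carries no topology. The Borel sets of U(N) are those induced by the
   embedding of U(N) into the space of N^2 complex matrix entries. *)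
definition unitary_borel :: "nat \<Rightarrow> complex mat measure" where
  "unitary_borel N =
     vimage_algebra (unitary_group N) (\<lambda>U. \<lambda>p\<in>{..<N} \<times> {..<N}. U $$ p)
       (PiM ({..<N} \<times> {..<N}) (\<lambda>_. borel))"

definition haar_prob_measure :: "nat \<Rightarrow> complex mat measure \<Rightarrow> bool" where
  "haar_prob_measure N H \<longleftrightarrow>
     prob_space H \<and> space H = unitary_group N \<and> sets H = sets (unitary_borel N) \<and>
     (\<forall>V\<in>unitary_group N. distr H H (\<lambda>U. V * U) = H \<and> distr H H (\<lambda>U. U * V) = H)"

(* The first argument is the Haar probability measure on U(N). *)
definition HC ::
  "complex mat measure \<Rightarrow> nat \<Rightarrow> (nat \<Rightarrow> complex) \<Rightarrow> (nat \<Rightarrow> real) \<Rightarrow> complex" where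
  "HC H N x l =
     (\<integral>U. exp (mat_trace (mat_diag N (\<lambda>i. complex_of_real (l i)) * U * mat_diag N x * mat_adjoint U)) \<partial>H)"

(* The random variable HC(x_1, ..., x_N; eigenvalues of A). *)
definition HC_mat ::
  "complex mat measure \<Rightarrow> nat \<Rightarrow> (nat \<Rightarrow> complex) \<Rightarrow> complex mat \<Rightarrow> complex" where
  "HC_mat H N x A = HC H N x (\<lambda>i. eigenvalue_list A ! i)"

(* Points (x_1, ..., x_r) of a polydisc around 0^r, extended by zeros: for N \<ge> r, the restriction
   of such an x to indices below N is (x_1, ..., x_r, 0^(N-r)). *)
definition polydisc :: "nat \<Rightarrow> real \<Rightarrow> (nat \<Rightarrow> complex) set" where
  "polydisc r \<delta> = {x. (\<forall>i<r. norm (x i) < \<delta>) \<and> (\<forall>i\<ge>r. x i = 0)}"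

(* g is the branch of log f that vanishes at the origin; on a polydisc it is unique. *)
definition log_branch_on ::
  "(nat \<Rightarrow> complex) set \<Rightarrow> ((nat \<Rightarrow> complex) \<Rightarrow> complex) \<Rightarrow> ((nat \<Rightarrow> complex) \<Rightarrow> complex) \<Rightarrow> bool" where
  "log_branch_on D f g \<longleftrightarrow>
     continuous_on D g \<and> g (\<lambda>_. 0) = 0 \<and> (\<forall>x\<in>D. exp (g x) = f x)"

definition weighted_tuples :: "nat \<Rightarrow> (nat \<Rightarrow> nat) set" where
  "weighted_tuples j = {b \<in> {1..j} \<rightarrow>\<^sub>E UNIV. (\<Sum>i=1..j. i * b i) = j}"

lemma finite_weighted_tuples: "finite (weighted_tuples j)"
proof (rule finite_subset)
  show "weighted_tuples j \<subseteq> {1..j} \<rightarrow>\<^sub>E {..j}"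
  proof
    fix b assume "b \<in> weighted_tuples j"
    then have b: "b \<in> {1..j} \<rightarrow>\<^sub>E UNIV" and s: "(\<Sum>i=1..j. i * b i) = j"
      by (auto simp: weighted_tuples_def)
    have "b i \<le> j" if i: "i \<in> {1..j}" for i
    proof -
      have "b i \<le> i * b i" using i by simp
      also have "\<dots> \<le> (\<Sum>i=1..j. i * b i)" by (rule member_le_sum) (use i in auto)
      finally show ?thesis using s by simp
    qed
    then show "b \<in> {1..j} \<rightarrow>\<^sub>E {..j}" using b by (auto simp: PiE_iff)
  qed
qed (auto intro: finite_PiE)

(* The index set of the inner sum is empty if b_1 + ... + b_j > k. *)
definition correction_moment :: "(nat \<Rightarrow> complex \<Rightarrow> complex) \<Rightarrow> nat \<Rightarrow> nat \<Rightarrow> complex" where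
  "correction_moment \<Psi> j k =
     (\<Sum>b\<in>weighted_tuples j. \<Sum>m | m + (\<Sum>i=1..j. b i) \<le> k.
        fact k / (fact m * fact (m + 1) * fact (k - m - (\<Sum>i=1..j. b i)) * (\<Prod>i=1..j. fact (b i))) *
        (deriv ^^ m)
          (\<lambda>x. deriv (\<Psi> 0) x ^ (k - m - (\<Sum>i=1..j. b i)) * (\<Prod>i=1..j. deriv (\<Psi> i) x ^ b i)) 0)"

end

theory Submission
  imports Defs "HOL-Complex_Analysis.Complex_Analysis"
begin

text \<open>
Let \<open>B = U\<^sup>* D U\<close>, where \<open>D\<close> is the diagonal matrix of the eigenvalues of \<open>A\<close> and \<open>U\<close> is Haar distributed.
The exponent in the Harish-Chandra integral is \<open>\<Sum>q. x q * B q q\<close>, so its expectation is the joint moment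
generating function of the diagonal entries of a unitarily invariant matrix. The proof follows the
functions
\<open>g k i x = E [(B\<^sup>k) i i * exp (\<Sum>q. x q * B q q)]\<close>,
which interpolate between the expected Harish-Chandra integral (\<open>k = 0\<close>) and the moments wanted
(\<open>N * g k 0 0 = E [Tr A\<^sup>k]\<close>).

Invariance of the law of \<open>B\<close> under a rotation in the coordinates \<open>i\<close> and \<open>j\<close>, differentiated at angle
zero, expresses \<open>E [B i j * (B\<^sup>k) j i * exp \<dots>]\<close> by \<open>g k i\<close> and \<open>g k j\<close>, and summing over \<open>j\<close> gives
\<open>g (k+1) i = \<partial>\<^sub>i (g k i) + (\<Sum>j \<noteq> i. (g k i - g k j) / (x i - x j))\<close>
(\<open>dunkl_hc_recursion\<close>). At a point with only \<open>r\<close> nonzero coordinates the \<open>N - r\<close> vanishing coordinates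
contribute equal terms, by symmetry, and these involve a single further coordinate. Hence the
\<open>k\<close>-th moment depends only on the expected integral in boundedly many variables, whatever \<open>N\<close> is.

With \<open>t = N\<^sup>-\<^sup>\<epsilon>\<close>, the logarithm of the expected integral is
\<open>N * (\<Sum>i. \<Sum>j\<le>n. t\<^sup>j * \<Psi> j (x i))\<close> up to \<open>N * o(t\<^sup>n)\<close>. After division by \<open>N\<^sup>k\<close> and by the expected
integral itself, the recursion is therefore close to
\<open>f (k+1) x = u x * f k x + (f k x - f k 0) / x\<close> with \<open>u = (\<Sum>j\<le>n. t\<^sup>j * \<Psi>' j)\<close>
in the single variable \<open>x = x i\<close>: the quotient comes from the vanishing coordinates, and all other
terms are of order \<open>1 / N\<close>, which is \<open>o(t\<^sup>n)\<close> because \<open>n * \<epsilon> < 1\<close>. Derivatives and divided differences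
are bounded on a smaller polydisc by Cauchy's estimate, so the error stays \<open>o(t\<^sup>n)\<close> at every step
(\<open>dunkl_step_approximation\<close>, \<open>normalized_mean_approximation\<close>). The same estimates, applied for a fixed
spectrum, show that the expectations exist (\<open>dominated_of_integrable\<close>).

It remains to evaluate \<open>f k 0\<close>. On power series the limiting recursion iterates the backward shift plus
multiplication by \<open>u\<close>; an induction in the spirit of Lagrange inversion gives
\<open>f k 0 = (\<Sum>m\<le>k. (k choose m) / (m + 1) * [x\<^sup>m] u\<^sup>k\<^sup>-\<^sup>m)\<close> (\<open>fps_shift_iteration_one\<close>). Expanding \<open>u\<^sup>k\<^sup>-\<^sup>m\<close> by the
multinomial theorem and collecting powers of \<open>t\<close> produces the correction moments
(\<open>moment_polynomial_truncation\<close>).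
\<close>

section \<open>Cauchy estimates on polydiscs\<close>

text \<open>Discs of radius \<open>\<delta> / 4\<close> around points of the half-size disc stay inside the large one.\<close>

lemma cauchy_deriv_bound:
  assumes hol: "f holomorphic_on ball 0 \<delta>" and bnd: "\<And>z. z \<in> ball 0 \<delta> \<Longrightarrow> norm (f z) \<le> M"
    and d: "\<delta> > 0" and z: "z \<in> ball 0 (\<delta> / 2)"
  shows "norm (deriv f z) \<le> 4 * M / \<delta>"
proof -
  have sub: "cball z (\<delta> / 4) \<subseteq> ball 0 \<delta>"
  proof
    fix w assume "w \<in> cball z (\<delta> / 4)"
    then have "norm (w - z) \<le> \<delta> / 4" by (simp add: dist_norm norm_minus_commute)
    moreover have "norm w \<le> norm (w - z) + norm z" using norm_triangle_ineq [of "w - z" z] by simp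
    ultimately show "w \<in> ball 0 \<delta>" using z d by simp
  qed
  have "norm ((deriv ^^ 1) f z) \<le> fact 1 * M / (\<delta> / 4) ^ 1"
  proof (rule Cauchy_inequality)
    show "f holomorphic_on ball z (\<delta> / 4)"
      using hol sub ball_subset_cball by (meson holomorphic_on_subset subset_trans)
    show "continuous_on (cball z (\<delta> / 4)) f"
      using holomorphic_on_imp_continuous_on [OF hol] sub by (rule continuous_on_subset)
    show "norm (f w) \<le> M" if "norm (z - w) = \<delta> / 4" for w
      using sub that by (intro bnd) (auto simp: dist_norm)
  qed (use d in auto)
  then show ?thesis by (simp add: mult.commute)
qed

lemma cauchy_lipschitz:
  assumes hol: "f holomorphic_on ball 0 \<delta>" and bnd: "\<And>z. z \<in> ball 0 \<delta> \<Longrightarrow> norm (f z) \<le> M"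
    and d: "\<delta> > 0" and a: "a \<in> ball 0 (\<delta> / 2)" and b: "b \<in> ball 0 (\<delta> / 2)"
  shows "norm (f a - f b) \<le> 4 * M / \<delta> * norm (a - b)"
proof (rule field_differentiable_bound [of "ball 0 (\<delta> / 2)" f "deriv f"])
  show "(f has_field_derivative deriv f z) (at z within ball 0 (\<delta> / 2))" if "z \<in> ball 0 (\<delta> / 2)" for z
    by (rule has_field_derivative_at_within, rule holomorphic_derivI [OF hol]) (use that d in auto)
  show "norm (deriv f z) \<le> 4 * M / \<delta>" if "z \<in> ball 0 (\<delta> / 2)" for z
    by (rule cauchy_deriv_bound [OF hol bnd d that])
qed (use a b in auto)

text \<open>The recursion for \<open>g\<close> is available only where \<open>x i\<close> differs from all other coordinates. This lemma carries
bounds over to the excluded points; only the coordinate \<open>x i\<close> has to be moved for that.\<close>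

lemma norm_le_off_finite:
  fixes f :: "complex \<Rightarrow> complex"
  assumes cont: "continuous_on (ball 0 \<delta>) f" and fin: "finite S"
    and bnd: "\<And>z. z \<in> ball 0 \<delta> - S \<Longrightarrow> norm (f z) \<le> M" and z: "z \<in> ball 0 \<delta>"
  shows "norm (f z) \<le> M"
proof -
  have "isCont f z"
    using cont z by (simp add: continuous_on_eq_continuous_at)
  then have lim: "((\<lambda>w. norm (f w)) \<longlongrightarrow> norm (f z)) (at z)"
    by (intro tendsto_norm) (simp add: isCont_def)
  have "eventually (\<lambda>w. w \<in> ball 0 \<delta>) (at z)"
    using z by (intro eventually_at_in_open') auto
  moreover have "eventually (\<lambda>w. w \<in> - (S - {z})) (at z)"
  proof (rule eventually_at_in_open')
    show "open (- (S - {z}))" using fin by (intro open_Compl finite_imp_closed) auto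
  qed auto
  moreover have "eventually (\<lambda>w. w \<noteq> z) (at z)" by (rule eventually_neq_at_within)
  ultimately have "eventually (\<lambda>w. norm (f w) \<le> M) (at z)"
    by eventually_elim (auto intro: bnd)
  then show ?thesis
    by (rule tendsto_upperbound [OF lim]) simp
qed

lemma polydisc_upd: "x \<in> polydisc r \<delta> \<Longrightarrow> i < r \<Longrightarrow> norm z < \<delta> \<Longrightarrow> x(i := z) \<in> polydisc r \<delta>"
  by (auto simp: polydisc_def)

lemma polydisc_mono: "x \<in> polydisc r \<delta> \<Longrightarrow> r \<le> r' \<Longrightarrow> \<delta> \<le> \<delta>' \<Longrightarrow> 0 < \<delta>' \<Longrightarrow> x \<in> polydisc r' \<delta>'"
proof -
  assume a: "x \<in> polydisc r \<delta>" "r \<le> r'" "\<delta> \<le> \<delta>'" "0 < \<delta>'"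
  have "norm (x i) < \<delta>'" for i
    using a by (cases "i < r") (auto simp: polydisc_def intro: less_le_trans)
  then show ?thesis using a by (auto simp: polydisc_def)
qed

lemma polydisc_norm: "x \<in> polydisc r \<delta> \<Longrightarrow> 0 < \<delta> \<Longrightarrow> norm (x i) < \<delta>"
  by (cases "i < r") (auto simp: polydisc_def)

text \<open>Exchanging two coordinates of \<open>x\<close> amounts to moving first one and then the other, so two one-variable
Cauchy estimates bound the divided difference. All indices \<open>j \<ge> r\<close> behave like the index \<open>r\<close> because their
coordinates vanish; this is why bounds on the polydisc in \<open>r + 1\<close> variables suffice for every \<open>N\<close>.\<close>

lemma symmetric_family_lipschitz:
  fixes \<phi> :: "nat \<Rightarrow> (nat \<Rightarrow> complex) \<Rightarrow> complex"
  assumes sym: "\<And>x i j. i < N \<Longrightarrow> j < N \<Longrightarrow> \<phi> j x = \<phi> i (x(i := x j, j := x i))"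
    and hol: "\<And>x i l. x \<in> polydisc (r + 1) \<delta> \<Longrightarrow> i \<le> r \<Longrightarrow> l \<le> r \<Longrightarrow>
                 (\<lambda>z. \<phi> i (x(l := z))) holomorphic_on ball 0 \<delta>"
    and bnd: "\<And>x i. x \<in> polydisc (r + 1) \<delta> \<Longrightarrow> i \<le> r \<Longrightarrow> norm (\<phi> i x) \<le> M"
    and rN: "r < N" and d: "\<delta> > 0" and x: "x \<in> polydisc r (\<delta> / 2)" and i: "i < r" and j: "j < N"
  shows "norm (\<phi> i x - \<phi> j x) \<le> 8 * M / \<delta> * norm (x i - x j)"
proof -
  define j' where "j' = min j r"
  have j': "j' \<le> r" "j' < N" using rN j by (auto simp: j'_def)
  have xj: "x j' = x j" using x by (auto simp: j'_def polydisc_def min_def)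
  have "\<phi> j x = \<phi> j' x"
  proof (cases "j \<le> r")
    case False
    then have "x(j' := x j, j := x j') = x" using x xj by (auto simp: fun_eq_iff)
    then show ?thesis using sym [of j' j x] j j' by simp
  qed (simp add: j'_def)
  show ?thesis
  proof (cases "i = j'")
    case True
    then show ?thesis using \<open>\<phi> j x = \<phi> j' x\<close> xj by simp
  next
    case False
    have iN: "i < N" using i rN by simp
    have M: "norm (x i) < \<delta> / 2" "norm (x j') < \<delta> / 2"
      using polydisc_norm [OF x] d by auto
    have x': "x \<in> polydisc (r + 1) \<delta>"
      using x d by (rule_tac polydisc_mono) auto
    have up: "x(i := a, j' := b) \<in> polydisc (r + 1) \<delta>" if "norm a < \<delta>" "norm b < \<delta>" for a b
      using that x' i j' by (intro polydisc_upd) auto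
    have 1: "norm (\<phi> i (x(j' := x j', i := x i)) - \<phi> i (x(j' := x j', i := x j'))) \<le> 4 * M / \<delta> * norm (x i - x j')"
      using M d i by (intro cauchy_lipschitz [of "\<lambda>z. \<phi> i (x(j' := x j', i := z))"] hol bnd polydisc_upd x') (use j' in auto)
    have 2: "norm (\<phi> i (x(i := x j', j' := x j')) - \<phi> i (x(i := x j', j' := x i))) \<le> 4 * M / \<delta> * norm (x j' - x i)"
      using M d i j' by (intro cauchy_lipschitz [of "\<lambda>z. \<phi> i (x(i := x j', j' := z))"] hol bnd polydisc_upd x') auto
    have "\<phi> j' x = \<phi> i (x(i := x j', j' := x i))" by (rule sym [OF iN j'(2)])
    moreover have "x(j' := x j', i := x j') = x(i := x j', j' := x j')" by auto
    ultimately have "\<phi> i x - \<phi> j' x =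
       (\<phi> i (x(j' := x j', i := x i)) - \<phi> i (x(j' := x j', i := x j'))) +
       (\<phi> i (x(i := x j', j' := x j')) - \<phi> i (x(i := x j', j' := x i)))" by simp
    also have "norm \<dots> \<le> 4 * M / \<delta> * norm (x i - x j') + 4 * M / \<delta> * norm (x j' - x i)"
      using 1 2 by (rule norm_triangle_mono)
    also have "\<dots> = 8 * M / \<delta> * norm (x i - x j)"
      by (simp add: norm_minus_commute xj)
    finally show ?thesis by (simp add: \<open>\<phi> j x = \<phi> j' x\<close>)
  qed
qed

text \<open>One step of the recursion costs a factor independent of the function, at the price of one variable and
half of the radius. The linear growth in \<open>N\<close> is harmless: the bound serves integrability for fixed \<open>N\<close>.\<close>

lemma dunkl_step_bound:
  fixes \<phi> \<psi> :: "nat \<Rightarrow> (nat \<Rightarrow> complex) \<Rightarrow> complex"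
  assumes sym: "\<And>x i j. i < N \<Longrightarrow> j < N \<Longrightarrow> \<phi> j x = \<phi> i (x(i := x j, j := x i))"
    and hol: "\<And>x i l. x \<in> polydisc (r + 1) \<delta> \<Longrightarrow> i \<le> r \<Longrightarrow> l \<le> r \<Longrightarrow>
                 (\<lambda>z. \<phi> i (x(l := z))) holomorphic_on ball 0 \<delta>"
    and bnd: "\<And>x i. x \<in> polydisc (r + 1) \<delta> \<Longrightarrow> i \<le> r \<Longrightarrow> norm (\<phi> i x) \<le> M"
    and rN: "r < N" and d: "\<delta> > 0"
    and rec: "\<And>x. x \<in> polydisc r (\<delta> / 2) \<Longrightarrow> (\<And>j. j < N \<Longrightarrow> j \<noteq> i \<Longrightarrow> x j \<noteq> x i) \<Longrightarrow>
       \<psi> i x = deriv (\<lambda>z. \<phi> i (x(i := z))) (x i) +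
                 (\<Sum>j\<in>{..<N} - {i}. (\<phi> i x - \<phi> j x) / (x i - x j))"
    and cont: "continuous_on (ball 0 (\<delta> / 2)) (\<lambda>z. \<psi> i (x(i := z)))"
    and x: "x \<in> polydisc r (\<delta> / 2)" and i: "i < r"
  shows "norm (\<psi> i x) \<le> 8 * real N * M / \<delta>"
proof -
  have M0: "0 \<le> M"
    using bnd [of "\<lambda>_. 0" 0] d by (intro order.trans [OF norm_ge_zero]) (auto simp: polydisc_def)
  have "norm (\<psi> i (x(i := x i))) \<le> 8 * real N * M / \<delta>"
  proof (rule norm_le_off_finite [OF cont, of "x ` {..<N}"])
    fix z assume z: "z \<in> ball 0 (\<delta> / 2) - x ` {..<N}"
    define y where "y = x(i := z)"
    have y: "y \<in> polydisc r (\<delta> / 2)" using x z i unfolding y_def by (intro polydisc_upd) auto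
    have y': "y \<in> polydisc (r + 1) \<delta>" using y d by (rule_tac polydisc_mono) auto
    have yi: "y i = z" by (simp add: y_def)
    have dist: "y j \<noteq> y i" if "j < N" "j \<noteq> i" for j
      using z that by (auto simp: y_def)
    have lip: "norm ((\<phi> i y - \<phi> j y) / (y i - y j)) \<le> 8 * M / \<delta>" if "j < N" "j \<noteq> i" for j
    proof -
      have "norm (\<phi> i y - \<phi> j y) \<le> 8 * M / \<delta> * norm (y i - y j)"
          by (rule symmetric_family_lipschitz [where \<phi> = \<phi>, OF sym hol bnd rN d y i that(1)])
      moreover have "norm (y i - y j) > 0" using dist [OF that] by auto
      ultimately show ?thesis by (simp add: norm_divide divide_le_eq)
    qed
    have der: "norm (deriv (\<lambda>z. \<phi> i (y(i := z))) (y i)) \<le> 4 * M / \<delta>"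
      using i y y' z yi d by (intro cauchy_deriv_bound hol bnd polydisc_upd) auto
    have "norm (\<psi> i y) \<le> norm (deriv (\<lambda>z. \<phi> i (y(i := z))) (y i)) +
                 norm (\<Sum>j\<in>{..<N} - {i}. (\<phi> i y - \<phi> j y) / (y i - y j))"
      using rec [OF y] dist by (simp add: norm_triangle_ineq)
    also have "\<dots> \<le> 4 * M / \<delta> + (\<Sum>j\<in>{..<N} - {i}. 8 * M / \<delta>)"
      by (intro add_mono der order.trans [OF norm_sum] sum_mono lip) auto
    also have "\<dots> = 4 * M / \<delta> + (real N - 1) * (8 * M / \<delta>)"
      using i rN by (simp add: of_nat_diff)
    also have "\<dots> \<le> 8 * real N * M / \<delta>"
      using M0 d by (simp add: field_simps)
    finally show "norm (\<psi> i (x(i := z))) \<le> 8 * real N * M / \<delta>" by (simp add: y_def)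
  next
    show "x i \<in> ball 0 (\<delta> / 2)" using polydisc_norm [OF x, of i] d by simp
  qed auto
  then show ?thesis by simp
qed

text \<open>Domination of the functions alone suffices to differentiate under the integral: Cauchy's estimate turns
it into a domination of the difference quotients.\<close>

lemma integral_holomorphic:
  fixes f :: "complex \<Rightarrow> 'a \<Rightarrow> complex"
  assumes hol: "\<And>u. u \<in> space M \<Longrightarrow> (\<lambda>z. f z u) holomorphic_on ball 0 \<delta>"
    and meas: "\<And>z. z \<in> ball 0 \<delta> \<Longrightarrow> f z \<in> borel_measurable M"
    and dom: "\<And>z u. z \<in> ball 0 \<delta> \<Longrightarrow> u \<in> space M \<Longrightarrow> norm (f z u) \<le> W u"
    and W: "integrable M W" and z: "z \<in> ball 0 \<delta>"
  shows "((\<lambda>z. \<integral>u. f z u \<partial>M) has_field_derivative (\<integral>u. deriv (\<lambda>z. f z u) z \<partial>M)) (at z)"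
    and "integrable M (\<lambda>u. deriv (\<lambda>z. f z u) z)"
proof -
  define e where "e = (\<delta> - norm z) / 4"
  have e: "e > 0" using z by (simp add: e_def)
  have sub: "z + w \<in> ball 0 \<delta>" if "norm w < 4 * e" for w
    using norm_triangle_ineq [of z w] that by (simp add: e_def)
  have hol': "(\<lambda>w. f (z + w) u) holomorphic_on ball 0 (4 * e)" if "u \<in> space M" for u
  proof -
    have "(\<lambda>w. f w u) \<circ> (\<lambda>w. z + w) holomorphic_on ball 0 (4 * e)"
    proof (rule holomorphic_on_compose_gen [OF _ hol [OF that]])
      show "(\<lambda>w. z + w) ` ball 0 (4 * e) \<subseteq> ball 0 \<delta>"
      proof (rule image_subsetI)
        fix w :: complex assume "w \<in> ball 0 (4 * e)"
        then show "z + w \<in> ball 0 \<delta>" by (intro sub) simp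
      qed
    qed (auto intro!: holomorphic_intros)
    then show ?thesis by (simp add: o_def)
  qed
  have der: "((\<lambda>z. f z u) has_field_derivative deriv (\<lambda>z. f z u) z) (at z)" if "u \<in> space M" for u
    using hol [OF that] z by (intro holomorphic_derivI) auto
  have lim: "((\<lambda>h. (f (z + h) u - f z u) / h) \<longlongrightarrow> deriv (\<lambda>z. f z u) z) (at 0)" if "u \<in> space M" for u
    using der [OF that] by (simp add: DERIV_def)
  have bound: "norm ((f (z + h) u - f z u) / h) \<le> W u / e"
    if "u \<in> space M" "h \<in> ball 0 (2 * e)" "h \<noteq> 0" for u h
  proof -
    have "norm (f (z + h) u - f (z + 0) u) \<le> 4 * W u / (4 * e) * norm (h - 0)"
    proof (rule cauchy_lipschitz [OF hol' [OF that(1)]])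
      show "norm (f (z + w) u) \<le> W u" if "w \<in> ball 0 (4 * e)" for w
        using that sub \<open>u \<in> space M\<close> by (intro dom) auto
    qed (use that e in auto)
    then show ?thesis using that e by (simp add: norm_divide field_simps)
  qed
  have key: "integrable M (\<lambda>u. deriv (\<lambda>z. f z u) z) \<and>
    (\<lambda>n. ((\<integral>u. f (z + X n) u \<partial>M) - (\<integral>u. f z u \<partial>M)) / X n) \<longlonglongrightarrow> (\<integral>u. deriv (\<lambda>z. f z u) z \<partial>M)"
    if X: "\<And>n. X n \<in> ball 0 (2 * e)" "\<And>n. X n \<noteq> 0" "X \<longlonglongrightarrow> 0" for X :: "nat \<Rightarrow> complex"
  proof -
    have Xin: "z + X n \<in> ball 0 \<delta>" for n
      using X(1) [of n] e by (intro sub) simp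
    have int: "integrable M (f w)" if "w \<in> ball 0 \<delta>" for w
    proof (rule Bochner_Integration.integrable_bound [OF W meas [OF that]], rule AE_I2)
      fix u assume "u \<in> space M"
      from dom [OF that this] show "norm (f w u) \<le> norm (W u)" by simp
    qed
    have mX: "(\<lambda>u. (f (z + X n) u - f z u) / X n) \<in> borel_measurable M" for n
      by (intro borel_measurable_divide borel_measurable_diff meas Xin z borel_measurable_const)
    have limX: "(\<lambda>n. (f (z + X n) u - f z u) / X n) \<longlonglongrightarrow> deriv (\<lambda>z. f z u) z" if "u \<in> space M" for u
      using tendsto_at_iff_sequentially [THEN iffD1, OF lim [OF that], rule_format, of X] X
      by (simp add: o_def)
    have mD: "(\<lambda>u. deriv (\<lambda>z. f z u) z) \<in> borel_measurable M"
      by (rule borel_measurable_LIMSEQ_metric [OF mX limX])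
    have WE: "integrable M (\<lambda>u. W u / e)" using W by simp
    have AE1: "AE u in M. (\<lambda>n. (f (z + X n) u - f z u) / X n) \<longlonglongrightarrow> deriv (\<lambda>z. f z u) z"
      by (rule AE_I2) (rule limX)
    have AE2: "AE u in M. norm ((f (z + X n) u - f z u) / X n) \<le> W u / e" for n
      by (rule AE_I2) (rule bound [OF _ X(1) X(2)])
    have 1: "integrable M (\<lambda>u. deriv (\<lambda>z. f z u) z)"
      by (rule integrable_dominated_convergence [OF mD mX WE AE1 AE2])
    have 2: "(\<lambda>n. \<integral>u. (f (z + X n) u - f z u) / X n \<partial>M) \<longlonglongrightarrow> (\<integral>u. deriv (\<lambda>z. f z u) z \<partial>M)"
      by (rule integral_dominated_convergence [OF mD mX WE AE1 AE2])
    have "(\<integral>u. (f (z + X n) u - f z u) / X n \<partial>M) =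
      ((\<integral>u. f (z + X n) u \<partial>M) - (\<integral>u. f z u \<partial>M)) / X n" for n
      using Bochner_Integration.integral_diff [OF int [OF Xin] int [OF z]]
      by (simp only: integral_divide_zero)
    with 1 2 show ?thesis by (simp only:)
  qed
  have "(\<lambda>n. complex_of_real (e / real (Suc n))) \<longlonglongrightarrow> 0"
    using tendsto_of_real [OF LIMSEQ_Suc [OF lim_const_over_n [of e]]]
    by (simp del: of_nat_Suc of_real_divide)
  moreover have "complex_of_real (e / real (Suc n)) \<in> ball 0 (2 * e)" for n
  proof -
    have "e / real (Suc n) \<le> e / 1" using e by (intro divide_left_mono) auto
    then show ?thesis using e by (simp del: of_nat_Suc of_real_divide)
  qed
  moreover have "complex_of_real (e / real (Suc n)) \<noteq> 0" for n
    using e by (simp del: of_nat_Suc)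
  ultimately show "integrable M (\<lambda>u. deriv (\<lambda>z. f z u) z)"
    using key [of "\<lambda>n. complex_of_real (e / real (Suc n))"] by blast
  show "((\<lambda>z. \<integral>u. f z u \<partial>M) has_field_derivative (\<integral>u. deriv (\<lambda>z. f z u) z \<partial>M)) (at z)"
    unfolding DERIV_def tendsto_at_iff_sequentially
  proof (intro allI impI)
    fix X :: "nat \<Rightarrow> complex" assume X: "\<forall>i. X i \<in> UNIV - {0}" "X \<longlonglongrightarrow> 0"
    have "eventually (\<lambda>n. X n \<in> ball 0 (2 * e)) sequentially"
      using X(2) e by (intro topological_tendstoD) auto
    then obtain m where m: "\<And>n. n \<ge> m \<Longrightarrow> X n \<in> ball 0 (2 * e)"
      by (auto simp: eventually_sequentially)
    have "(\<lambda>n. ((\<integral>u. f (z + X (n + m)) u \<partial>M) - (\<integral>u. f z u \<partial>M)) / X (n + m)) \<longlonglongrightarrow>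
            (\<integral>u. deriv (\<lambda>z. f z u) z \<partial>M)"
      using key [of "\<lambda>n. X (n + m)"] X m LIMSEQ_ignore_initial_segment [OF X(2), of m] by auto
    then show "((\<lambda>h. ((\<integral>u. f (z + h) u \<partial>M) - (\<integral>u. f z u \<partial>M)) / h) \<circ> X) \<longlonglongrightarrow>
            (\<integral>u. deriv (\<lambda>z. f z u) z \<partial>M)"
      unfolding o_def by (rule LIMSEQ_offset)
  qed
qed

text \<open>Locally \<open>g\<close> differs from a branch of the logarithm of a holomorphic function by a constant.\<close>

lemma holomorphic_exp_lift:
  assumes cont: "continuous_on (ball 0 \<delta>) g" and hol: "(\<lambda>z. exp (g z)) holomorphic_on ball 0 \<delta>"
  shows "g holomorphic_on ball 0 (\<delta> :: real)"
proof -
  have "g field_differentiable at z" if z: "z \<in> ball 0 \<delta>" for z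
  proof -
    have "isCont g z" using cont z by (simp add: continuous_on_eq_continuous_at)
    then have "eventually (\<lambda>w. g w \<in> ball (g z) 1) (nhds z)"
      by (intro topological_tendstoD) (auto simp: isCont_def tendsto_at_iff_tendsto_nhds)
    then have near: "eventually (\<lambda>w. Ln (exp (g w) / exp (g z)) + g z = g w) (nhds z)"
    proof eventually_elim
      case (elim w)
      then have "\<bar>Im (g w - g z)\<bar> < 1"
        using abs_Im_le_cmod [of "g w - g z"] by (simp add: dist_norm norm_minus_commute)
      then have "Ln (exp (g w - g z)) = g w - g z"
        using pi_gt3 by (intro Ln_exp) auto
      then show ?case by (simp add: exp_diff)
    qed
    have "(\<lambda>w. exp (g w)) field_differentiable at z"
      using hol z by (intro holomorphic_on_imp_differentiable_at [OF hol]) auto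
    then obtain D where D: "((\<lambda>w. exp (g w)) has_field_derivative D) (at z)"
      by (auto simp: field_differentiable_def)
    have "((\<lambda>w. exp (g w) / exp (g z)) has_field_derivative D / exp (g z)) (at z)"
      by (rule DERIV_cdivide [OF D])
    moreover have "(Ln has_field_derivative 1) (at (exp (g z) / exp (g z)))"
      using has_field_derivative_Ln [of 1] by simp
    ultimately have "((\<lambda>w. Ln (exp (g w) / exp (g z))) has_field_derivative 1 * (D / exp (g z))) (at z)"
      by (rule DERIV_chain2 [rotated])
    from DERIV_add [OF this DERIV_const [of "g z"]]
    have "((\<lambda>w. Ln (exp (g w) / exp (g z)) + g z) has_field_derivative D / exp (g z)) (at z)"
      by simp
    then have "(g has_field_derivative D / exp (g z)) (at z)"
      using DERIV_cong_ev [OF refl near refl] by blast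
    then show ?thesis by (auto simp: field_differentiable_def)
  qed
  then show ?thesis by (auto simp: holomorphic_on_def intro: field_differentiable_at_within)
qed

section \<open>Unitary matrices and Haar measure\<close>

lemma mat_adjoint_index:
  fixes A :: "complex mat"
  assumes "i < dim_col A" "j < dim_row A"
  shows "mat_adjoint A $$ (i, j) = cnj (A $$ (j, i))"
  using assms unfolding mat_adjoint_def
  by (subst mat_of_rows_index) (auto simp: conjugate_complex_def)

lemma mat_adjoint_carrier: "A \<in> carrier_mat n m \<Longrightarrow> mat_adjoint A \<in> carrier_mat m n"
  unfolding mat_adjoint_def by (auto simp: mat_of_rows_def)

lemma mult_adjoint_index:
  fixes U :: "complex mat"
  assumes "U \<in> carrier_mat N N" "i < N" "j < N"
  shows "(U * mat_adjoint U) $$ (i, j) = (\<Sum>q<N. U $$ (i, q) * cnj (U $$ (j, q)))"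
    and "(mat_adjoint U * U) $$ (i, j) = (\<Sum>p<N. cnj (U $$ (p, i)) * U $$ (p, j))"
  using assms mat_adjoint_carrier [OF assms(1)]
  by (auto simp: scalar_prod_def mat_adjoint_index lessThan_atLeast0 intro!: sum.cong)

lemma unitary_group_carrier: "U \<in> unitary_group N \<Longrightarrow> U \<in> carrier_mat N N"
  by (simp add: unitary_group_def)

lemma unitary_rows:
  assumes "U \<in> unitary_group N" "i < N" "j < N"
  shows "(\<Sum>q<N. U $$ (i, q) * cnj (U $$ (j, q))) = (if i = j then 1 else 0)"
  using mult_adjoint_index(1) [of U N i j] assms by (simp add: unitary_group_def)

lemma unitary_columns:
  assumes "U \<in> unitary_group N" "i < N" "j < N"
  shows "(\<Sum>p<N. cnj (U $$ (p, i)) * U $$ (p, j)) = (if i = j then 1 else 0)"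
  using mult_adjoint_index(2) [of U N i j] assms by (simp add: unitary_group_def)

text \<open>Orthonormal rows are enough, since a one-sided inverse of a square matrix is two-sided.\<close>

lemma unitary_groupI:
  assumes U: "U \<in> carrier_mat N N"
    and rows: "\<And>i j. i < N \<Longrightarrow> j < N \<Longrightarrow> (\<Sum>q<N. U $$ (i, q) * cnj (U $$ (j, q))) = (if i = j then 1 else 0)"
  shows "U \<in> unitary_group N"
proof -
  have 1: "U * mat_adjoint U = 1\<^sub>m N"
    using U mat_adjoint_carrier [OF U] by (intro eq_matI) (auto simp: mult_adjoint_index(1) rows simp del: index_mult_mat(1))
  then have "mat_adjoint U * U = 1\<^sub>m N"
    by (rule mat_mult_left_right_inverse [OF U mat_adjoint_carrier [OF U]])
  with 1 U show ?thesis by (simp add: unitary_group_def)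
qed

lemma norm_unitary_entry:
  assumes "U \<in> unitary_group N" "p < N" "q < N"
  shows "norm (U $$ (p, q)) \<le> 1"
proof -
  have "(norm (U $$ (p, q)))\<^sup>2 \<le> (\<Sum>s<N. (norm (U $$ (p, s)))\<^sup>2)"
    by (rule member_le_sum) (use assms in auto)
  also have "complex_of_real \<dots> = 1"
    using unitary_rows [OF assms(1) assms(2) assms(2)]
    by (simp add: complex_norm_square del: of_real_power)
  then have "(\<Sum>s<N. (norm (U $$ (p, s)))\<^sup>2) = 1"
    by (metis of_real_eq_1_iff)
  finally show ?thesis
    by (simp add: power_le_one_iff abs_square_le_1)
qed

text \<open>Right multiplication by this matrix replaces columns \<open>i\<close> and \<open>j\<close> by the combinations with coefficients
\<open>(a, c)\<close> and \<open>(b, d)\<close>. Transpositions, phases and plane rotations are the instances used below.\<close>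

definition column_mix :: "nat \<Rightarrow> nat \<Rightarrow> nat \<Rightarrow> complex \<Rightarrow> complex \<Rightarrow> complex \<Rightarrow> complex \<Rightarrow> complex mat" where
  "column_mix N i j a b c d = Matrix.mat N N (\<lambda>(p, q).
     if q = i then (if p = i then a else if p = j then c else 0)
     else if q = j then (if p = i then b else if p = j then d else 0)
     else if p = q then 1 else 0)"

lemma mult_column_mix_index:
  assumes U: "U \<in> carrier_mat N N" and i: "i < N" and j: "j < N" and ij: "i \<noteq> j" and p: "p < N" and q: "q < N"
  shows "(U * column_mix N i j a b c d) $$ (p, q) =
     (if q = i then U $$ (p, i) * a + U $$ (p, j) * c
      else if q = j then U $$ (p, i) * b + U $$ (p, j) * d else U $$ (p, q))"
proof -
  have "(U * column_mix N i j a b c d) $$ (p, q) = (\<Sum>s<N. U $$ (p, s) * column_mix N i j a b c d $$ (s, q))"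
    using U p q by (auto simp: column_mix_def scalar_prod_def lessThan_atLeast0)
  also have "\<dots> = (\<Sum>s<N. (if s = i then U $$ (p, i) * (if q = i then a else if q = j then b else 0) else 0) +
        (if s = j then U $$ (p, j) * (if q = i then c else if q = j then d else 0) else 0) +
        (if s = q then U $$ (p, q) * (if q = i \<or> q = j then 0 else 1) else 0))"
    using ij q by (intro sum.cong) (auto simp: column_mix_def)
  also have "\<dots> = (if q = i then U $$ (p, i) * a + U $$ (p, j) * c
      else if q = j then U $$ (p, i) * b + U $$ (p, j) * d else U $$ (p, q))"
    using i j ij q by (simp add: sum.distrib)
  finally show ?thesis .
qed

lemma column_mix_unitary:
  assumes i: "i < N" and j: "j < N" and ij: "i \<noteq> j"
    and "a * cnj a + b * cnj b = 1" "c * cnj c + d * cnj d = 1" "a * cnj c + b * cnj d = 0"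
  shows "column_mix N i j a b c d \<in> unitary_group N"
proof (rule unitary_groupI)
  show "column_mix N i j a b c d \<in> carrier_mat N N" by (simp add: column_mix_def)
next
  fix p q assume pq: "p < N" "q < N"
  have ca: "c * cnj a + d * cnj b = 0"
    using arg_cong [OF assms(6), of cnj] by (simp add: mult.commute)
  have "(\<Sum>s<N. column_mix N i j a b c d $$ (p, s) * cnj (column_mix N i j a b c d $$ (q, s))) =
        (\<Sum>s<N. (if s = i then (if p = i then a else if p = j then c else 0) * cnj (if q = i then a else if q = j then c else 0) else 0) +
           (if s = j then (if p = i then b else if p = j then d else 0) * cnj (if q = i then b else if q = j then d else 0) else 0) +
           (if s = p then (if p = q \<and> p \<noteq> i \<and> p \<noteq> j then 1 else 0) else 0))"
    using pq ij by (intro sum.cong) (auto simp: column_mix_def)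
  also have "\<dots> = (if p = q then 1 else 0)"
    using i j ij pq assms(4-6) ca by (auto simp: sum.distrib)
  finally show "(\<Sum>s<N. column_mix N i j a b c d $$ (p, s) * cnj (column_mix N i j a b c d $$ (q, s))) =
        (if p = q then 1 else 0)" .
qed

lemma unitary_group_mult:
  assumes U: "U \<in> unitary_group N" and V: "V \<in> unitary_group N"
  shows "U * V \<in> unitary_group N"
proof (rule unitary_groupI)
  show "U * V \<in> carrier_mat N N" using U V by (auto simp: unitary_group_def)
next
  fix i j assume ij: "i < N" "j < N"
  have ix: "(U * V) $$ (i, q) = (\<Sum>s<N. U $$ (i, s) * V $$ (s, q))" if "i < N" "q < N" for i q
    using that U V by (auto simp: unitary_group_def scalar_prod_def lessThan_atLeast0)
  have "(\<Sum>q<N. (U * V) $$ (i, q) * cnj ((U * V) $$ (j, q))) =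
        (\<Sum>q<N. \<Sum>s<N. \<Sum>t<N. U $$ (i, s) * cnj (U $$ (j, t)) * (V $$ (s, q) * cnj (V $$ (t, q))))"
    using ij by (intro sum.cong refl) (simp add: ix sum_product mult_ac)
  also have "\<dots> = (\<Sum>s<N. \<Sum>q<N. \<Sum>t<N. U $$ (i, s) * cnj (U $$ (j, t)) * (V $$ (s, q) * cnj (V $$ (t, q))))"
    by (rule sum.swap)
  also have "\<dots> = (\<Sum>s<N. \<Sum>t<N. \<Sum>q<N. U $$ (i, s) * cnj (U $$ (j, t)) * (V $$ (s, q) * cnj (V $$ (t, q))))"
    by (intro sum.cong refl sum.swap)
  also have "\<dots> = (\<Sum>s<N. \<Sum>t<N. U $$ (i, s) * cnj (U $$ (j, t)) * (if s = t then 1 else 0))"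
    by (intro sum.cong refl) (simp add: sum_distrib_left [symmetric] unitary_rows [OF V])
  also have "\<dots> = (\<Sum>s<N. U $$ (i, s) * cnj (U $$ (j, s)))"
    by (intro sum.cong refl) (simp add: if_distrib [of "\<lambda>z. _ * z"] cong: if_cong)
  also have "\<dots> = (if i = j then 1 else 0)" by (rule unitary_rows [OF U ij])
  finally show "(\<Sum>q<N. (U * V) $$ (i, q) * cnj ((U * V) $$ (j, q))) = (if i = j then 1 else 0)" .
qed

lemma haar_entry_measurable:
  assumes H: "haar_prob_measure N H" and pq: "p < N" "q < N"
  shows "(\<lambda>U. U $$ (p, q)) \<in> borel_measurable H"
proof -
  define emb where "emb = (\<lambda>U :: complex mat. \<lambda>p\<in>{..<N} \<times> {..<N}. U $$ p)"
  define Pi where "Pi = PiM ({..<N} \<times> {..<N}) (\<lambda>_. borel :: complex measure)"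
  have sH: "sets H = sets (vimage_algebra (unitary_group N) emb Pi)"
    using H by (simp add: haar_prob_measure_def unitary_borel_def emb_def Pi_def)
  have "emb \<in> measurable (vimage_algebra (unitary_group N) emb Pi) Pi"
    by (rule measurable_vimage_algebra1) (auto simp: emb_def Pi_def space_PiM)
  moreover have "(\<lambda>f. f (p, q)) \<in> borel_measurable Pi"
    unfolding Pi_def using pq by (intro measurable_component_singleton) auto
  ultimately have "(\<lambda>U. emb U (p, q)) \<in> borel_measurable (vimage_algebra (unitary_group N) emb Pi)"
    by (rule measurable_compose)
  then have "(\<lambda>U. U $$ (p, q)) \<in> borel_measurable (vimage_algebra (unitary_group N) emb Pi)"
    using pq by (simp add: emb_def)
  then show ?thesis by (simp only: measurable_cong_sets [OF sH refl])
qed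

lemma haar_space: "haar_prob_measure N H \<Longrightarrow> space H = unitary_group N"
  by (simp add: haar_prob_measure_def)

lemma haar_right_mult_measurable:
  assumes H: "haar_prob_measure N H" and V: "V \<in> unitary_group N"
  shows "(\<lambda>U. U * V) \<in> measurable H H"
proof -
  define emb where "emb = (\<lambda>U :: complex mat. \<lambda>p\<in>{..<N} \<times> {..<N}. U $$ p)"
  define Pi where "Pi = PiM ({..<N} \<times> {..<N}) (\<lambda>_. borel :: complex measure)"
  have sH: "sets H = sets (vimage_algebra (unitary_group N) emb Pi)"
    using H by (simp add: haar_prob_measure_def unitary_borel_def emb_def Pi_def)
  have "(\<lambda>U. U * V) \<in> measurable H (vimage_algebra (unitary_group N) emb Pi)"
  proof (rule measurable_vimage_algebra2)
    show "(\<lambda>U. U * V) \<in> space H \<rightarrow> unitary_group N"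
      using V by (auto simp: haar_space [OF H] intro: unitary_group_mult)
    show "(\<lambda>U. emb (U * V)) \<in> measurable H Pi"
      unfolding emb_def Pi_def
    proof (rule measurable_restrict)
      fix z assume z: "z \<in> {..<N} \<times> {..<N}"
      then obtain p q where pq: "z = (p, q)" "p < N" "q < N" by auto
      have "(\<lambda>U. \<Sum>s<N. U $$ (p, s) * V $$ (s, q)) \<in> borel_measurable H"
        using pq by (intro borel_measurable_sum borel_measurable_times haar_entry_measurable [OF H]
             borel_measurable_const) auto
      moreover have "(U * V) $$ z = (\<Sum>s<N. U $$ (p, s) * V $$ (s, q))" if "U \<in> space H" for U
        using that pq V by (auto simp: haar_space [OF H] unitary_group_def scalar_prod_def lessThan_atLeast0)
      ultimately show "(\<lambda>U. (U * V) $$ z) \<in> borel_measurable H"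
        by (simp cong: measurable_cong)
    qed
  qed
  then show ?thesis by (simp cong: measurable_cong_sets [OF refl sH])
qed

lemma haar_integral_right_mult:
  fixes f :: "complex mat \<Rightarrow> complex"
  assumes H: "haar_prob_measure N H" and V: "V \<in> unitary_group N" and f: "f \<in> borel_measurable H"
  shows "(\<integral>U. f (U * V) \<partial>H) = (\<integral>U. f U \<partial>H)"
proof -
  have "(\<integral>U. f U \<partial>H) = (\<integral>U. f U \<partial>(distr H H (\<lambda>U. U * V)))"
    using H V by (simp add: haar_prob_measure_def)
  also have "\<dots> = (\<integral>U. f (U * V) \<partial>H)"
    by (rule integral_distr [OF haar_right_mult_measurable [OF H V] f])
  finally show ?thesis by simp
qed

section \<open>Matrix entries of a unitarily invariant matrix\<close>

text \<open>The entry \<open>(i, j)\<close> of \<open>B\<^sup>k\<close>, where \<open>B = U\<^sup>* D U\<close> with \<open>D\<close> the diagonal matrix of \<open>l\<close>.\<close>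

definition conj_entry :: "nat \<Rightarrow> (nat \<Rightarrow> real) \<Rightarrow> nat \<Rightarrow> nat \<Rightarrow> nat \<Rightarrow> complex mat \<Rightarrow> complex" where
  "conj_entry N l k i j U = (\<Sum>p<N. of_real (l p) ^ k * cnj (U $$ (p, i)) * U $$ (p, j))"

text \<open>The integrand of the Harish-Chandra integral, written through the diagonal entries of \<open>B\<close>.\<close>

definition diag_exp :: "nat \<Rightarrow> (nat \<Rightarrow> real) \<Rightarrow> (nat \<Rightarrow> complex) \<Rightarrow> complex mat \<Rightarrow> complex" where
  "diag_exp N l x U = exp (\<Sum>q<N. x q * conj_entry N l 1 q q U)"

text \<open>The function \<open>g k i x\<close> of the introduction for a fixed spectrum \<open>l\<close>.\<close>

definition dunkl_hc :: "complex mat measure \<Rightarrow> nat \<Rightarrow> (nat \<Rightarrow> real) \<Rightarrow> nat \<Rightarrow> nat \<Rightarrow> (nat \<Rightarrow> complex) \<Rightarrow> complex" where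
  "dunkl_hc H N l k i x = (\<integral>U. conj_entry N l k i i U * diag_exp N l x U \<partial>H)"

lemma conj_entry_0:
  "U \<in> unitary_group N \<Longrightarrow> i < N \<Longrightarrow> j < N \<Longrightarrow> conj_entry N l 0 i j U = (if i = j then 1 else 0)"
  by (simp add: conj_entry_def unitary_columns)

text \<open>This is \<open>B\<^sup>k\<^sup>+\<^sup>1 = B * B\<^sup>k\<close>; the inner sum collapses by unitarity of \<open>U\<close>.\<close>

lemma conj_entry_Suc:
  assumes U: "U \<in> unitary_group N" and i: "i < N" and j: "j < N"
  shows "conj_entry N l (Suc k) i j U = (\<Sum>m<N. conj_entry N l 1 i m U * conj_entry N l k m j U)"
proof -
  have "(\<Sum>m<N. conj_entry N l 1 i m U * conj_entry N l k m j U) =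
    (\<Sum>m<N. \<Sum>p<N. \<Sum>q<N. of_real (l p) * of_real (l q) ^ k * cnj (U $$ (p, i)) * U $$ (q, j) *
              (U $$ (p, m) * cnj (U $$ (q, m))))"
    by (simp add: conj_entry_def sum_product mult_ac)
  also have "\<dots> = (\<Sum>p<N. \<Sum>m<N. \<Sum>q<N. of_real (l p) * of_real (l q) ^ k * cnj (U $$ (p, i)) * U $$ (q, j) *
              (U $$ (p, m) * cnj (U $$ (q, m))))"
    by (rule sum.swap)
  also have "\<dots> = (\<Sum>p<N. \<Sum>q<N. \<Sum>m<N. of_real (l p) * of_real (l q) ^ k * cnj (U $$ (p, i)) * U $$ (q, j) *
              (U $$ (p, m) * cnj (U $$ (q, m))))"
    by (intro sum.cong refl sum.swap)
  also have "\<dots> = (\<Sum>p<N. \<Sum>q<N. of_real (l p) * of_real (l q) ^ k * cnj (U $$ (p, i)) * U $$ (q, j) *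
              (if p = q then 1 else 0))"
    by (intro sum.cong refl) (simp add: sum_distrib_left [symmetric] unitary_rows [OF U])
  also have "\<dots> = conj_entry N l (Suc k) i j U"
    unfolding conj_entry_def by (intro sum.cong refl) (simp add: if_distrib [of "\<lambda>z. _ * z"] cong: if_cong)
  finally show ?thesis by simp
qed

lemma sum_conj_entry_diag:
  assumes U: "U \<in> unitary_group N"
  shows "(\<Sum>i<N. conj_entry N l k i i U) = (\<Sum>p<N. of_real (l p) ^ k)"
proof -
  have "(\<Sum>i<N. conj_entry N l k i i U) = (\<Sum>p<N. \<Sum>i<N. of_real (l p) ^ k * (U $$ (p, i) * cnj (U $$ (p, i))))"
    unfolding conj_entry_def by (subst sum.swap) (simp add: mult_ac)
  also have "\<dots> = (\<Sum>p<N. of_real (l p) ^ k)"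
    by (intro sum.cong refl) (simp add: sum_distrib_left [symmetric] unitary_rows [OF U])
  finally show ?thesis .
qed

lemma norm_conj_entry:
  assumes U: "U \<in> unitary_group N" and i: "i < N" and j: "j < N"
  shows "norm (conj_entry N l k i j U) \<le> (\<Sum>p<N. \<bar>l p\<bar> ^ k)"
proof -
  have "norm (of_real (l p) ^ k * cnj (U $$ (p, i)) * U $$ (p, j)) \<le> \<bar>l p\<bar> ^ k * 1 * 1" if "p < N" for p
    unfolding norm_mult using norm_unitary_entry [OF U that i] norm_unitary_entry [OF U that j]
    by (intro mult_mono) (auto simp: norm_power)
  then show ?thesis
    unfolding conj_entry_def by (intro order.trans [OF norm_sum] sum_mono) auto
qed

lemma conj_entry_real: "conj_entry N l k i i U \<in> \<real>"
proof -
  have "of_real (l p) ^ k * cnj (U $$ (p, i)) * U $$ (p, i) = of_real (l p ^ k * (norm (U $$ (p, i)))\<^sup>2)" for p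
    unfolding of_real_mult of_real_power [of "l p"] complex_norm_square by (simp add: mult_ac)
  then show ?thesis unfolding conj_entry_def by (intro sum_in_Reals) (metis Reals_of_real)
qed

lemma HC_eq_integral:
  assumes H: "haar_prob_measure N H"
  shows "HC H N x l = (\<integral>U. diag_exp N l x U \<partial>H)"
  unfolding HC_def
proof (rule Bochner_Integration.integral_cong [OF refl])
  fix U assume "U \<in> space H"
  then have U: "U \<in> carrier_mat N N" by (simp add: haar_space [OF H] unitary_group_def)
  define D where "D = mat_diag N (\<lambda>i. complex_of_real (l i)) * U * mat_diag N x"
  have D: "D = Matrix.mat N N (\<lambda>(p, q). of_real (l p) * U $$ (p, q) * x q)"
    unfolding D_def using U
    by (subst mat_diag_mult_left [OF U], subst mat_diag_mult_right [of _ N]) auto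
  have "mat_trace (D * mat_adjoint U) = (\<Sum>p<N. \<Sum>q<N. of_real (l p) * U $$ (p, q) * x q * cnj (U $$ (p, q)))"
    unfolding mat_trace_def using U mat_adjoint_carrier [OF U]
    by (auto simp: D scalar_prod_def mat_adjoint_index lessThan_atLeast0 intro!: sum.cong)
  also have "\<dots> = (\<Sum>q<N. \<Sum>p<N. of_real (l p) * U $$ (p, q) * x q * cnj (U $$ (p, q)))"
    by (rule sum.swap)
  also have "\<dots> = (\<Sum>q<N. x q * conj_entry N l 1 q q U)"
    by (simp add: conj_entry_def sum_distrib_left mult_ac)
  finally show "exp (mat_trace (mat_diag N (\<lambda>i. complex_of_real (l i)) * U * mat_diag N x * mat_adjoint U)) =
      diag_exp N l x U"
    by (simp add: D_def diag_exp_def)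
qed

lemma HC_eq_dunkl_hc:
  assumes H: "haar_prob_measure N H" and i: "i < N"
  shows "HC H N x l = dunkl_hc H N l 0 i x"
  unfolding HC_eq_integral [OF H] dunkl_hc_def
  using i by (intro Bochner_Integration.integral_cong refl) (auto simp: haar_space [OF H] conj_entry_0)

lemma conj_entry_measurable:
  assumes H: "haar_prob_measure N H" and "i < N" "j < N"
  shows "conj_entry N l k i j \<in> borel_measurable H"
proof -
  have "(\<lambda>U. \<Sum>p<N. of_real (l p) ^ k * cnj (U $$ (p, i)) * U $$ (p, j)) \<in> borel_measurable H"
  proof (intro borel_measurable_sum borel_measurable_times borel_measurable_const haar_entry_measurable [OF H])
    fix p assume "p \<in> {..<N}"
    then have "(\<lambda>U. U $$ (p, i)) \<in> borel_measurable H"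
      using assms by (intro haar_entry_measurable [OF H]) auto
    then show "(\<lambda>U. cnj (U $$ (p, i))) \<in> borel_measurable H"
      by (rule measurable_compose [OF _ borel_measurable_continuous_onI]) (intro continuous_intros)
  qed (use assms in auto)
  then show ?thesis by (simp add: conj_entry_def [abs_def])
qed

lemma diag_exp_measurable:
  assumes H: "haar_prob_measure N H"
  shows "diag_exp N l x \<in> borel_measurable H"
proof -
  have "(\<lambda>U. \<Sum>q<N. x q * conj_entry N l 1 q q U) \<in> borel_measurable H"
    by (intro borel_measurable_sum borel_measurable_times borel_measurable_const conj_entry_measurable [OF H]) auto
  then have "(\<lambda>U. exp (\<Sum>q<N. x q * conj_entry N l 1 q q U)) \<in> borel_measurable H"
    by (rule measurable_compose [OF _ borel_measurable_continuous_onI]) (intro continuous_intros)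
  then show ?thesis by (simp add: diag_exp_def [abs_def])
qed

lemma norm_diag_exp:
  assumes U: "U \<in> unitary_group N" and x: "\<And>q. q < N \<Longrightarrow> norm (x q) \<le> R"
  shows "norm (diag_exp N l x U) \<le> exp (real N * R * (\<Sum>p<N. \<bar>l p\<bar>))"
proof -
  have "Re (\<Sum>q<N. x q * conj_entry N l 1 q q U) \<le> norm (\<Sum>q<N. x q * conj_entry N l 1 q q U)"
    by (rule complex_Re_le_cmod)
  also have "\<dots> \<le> (\<Sum>q<N. R * (\<Sum>p<N. \<bar>l p\<bar>))"
  proof (intro order.trans [OF norm_sum] sum_mono)
    fix q assume "q \<in> {..<N}"
    then show "norm (x q * conj_entry N l 1 q q U) \<le> R * (\<Sum>p<N. \<bar>l p\<bar>)"
      unfolding norm_mult using x [of q] norm_conj_entry [OF U, of q q l 1]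
      by (intro mult_mono) (auto intro: order.trans [OF norm_ge_zero [of "x q"]])
  qed
  finally show ?thesis by (simp add: diag_exp_def mult_ac)
qed

lemma haar_integrable_bounded:
  fixes f :: "complex mat \<Rightarrow> complex"
  assumes H: "haar_prob_measure N H" and f: "f \<in> borel_measurable H"
    and b: "\<And>U. U \<in> unitary_group N \<Longrightarrow> norm (f U) \<le> B"
  shows "integrable H f"
proof -
  interpret prob_space H using H by (simp add: haar_prob_measure_def)
  show ?thesis
    by (rule integrable_const_bound [of _ B]) (use f b in \<open>auto simp: haar_space [OF H]\<close>)
qed

lemma haar_integrable_conj_entries:
  assumes H: "haar_prob_measure N H" and "i < N" "j < N" "i' < N" "j' < N"
  shows "integrable H (\<lambda>U. conj_entry N l k i j U * conj_entry N l k' i' j' U * diag_exp N l x U)"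
proof (rule haar_integrable_bounded [OF H])
  show "(\<lambda>U. conj_entry N l k i j U * conj_entry N l k' i' j' U * diag_exp N l x U) \<in> borel_measurable H"
    by (intro borel_measurable_times conj_entry_measurable [OF H] diag_exp_measurable [OF H] assms)
  fix U assume U: "U \<in> unitary_group N"
  have "norm (x q) \<le> (\<Sum>q<N. norm (x q))" if "q < N" for q
    by (rule member_le_sum) (use that in auto)
  from norm_diag_exp [OF U this]
  show "norm (conj_entry N l k i j U * conj_entry N l k' i' j' U * diag_exp N l x U) \<le>
     (\<Sum>p<N. \<bar>l p\<bar> ^ k) * (\<Sum>p<N. \<bar>l p\<bar> ^ k') * exp (real N * (\<Sum>q<N. norm (x q)) * (\<Sum>p<N. \<bar>l p\<bar>))"
    unfolding norm_mult
    by (intro mult_mono norm_conj_entry U assms mult_nonneg_nonneg sum_nonneg) auto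
qed

lemma haar_integrable_conj_entry:
  assumes H: "haar_prob_measure N H" and "i < N" "j < N"
  shows "integrable H (\<lambda>U. conj_entry N l k i j U * diag_exp N l x U)"
proof -
  have "integrable H (\<lambda>U. conj_entry N l k i j U * conj_entry N l 0 i i U * diag_exp N l x U)"
    by (intro haar_integrable_conj_entries assms)
  also have "?this \<longleftrightarrow> ?thesis"
    using assms by (intro Bochner_Integration.integrable_cong) (auto simp: haar_space [OF H] conj_entry_0)
  finally show ?thesis .
qed

section \<open>The loop equation\<close>

lemma conj_entry_bilinear:
  assumes "\<And>p. p < N \<Longrightarrow> W $$ (p, \<alpha>) = U $$ (p, i) * a + U $$ (p, j) * c"
    and "\<And>p. p < N \<Longrightarrow> W $$ (p, \<beta>) = U $$ (p, i) * b + U $$ (p, j) * d"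
  shows "conj_entry N l k \<alpha> \<beta> W = cnj a * b * conj_entry N l k i i U + cnj a * d * conj_entry N l k i j U +
           cnj c * b * conj_entry N l k j i U + cnj c * d * conj_entry N l k j j U"
  unfolding conj_entry_def sum_distrib_left sum.distrib [symmetric]
  by (intro sum.cong refl) (simp add: assms algebra_simps)

lemma conj_entry_mult_column_mix:
  fixes a b c d :: complex
  assumes U: "U \<in> unitary_group N" and i: "i < N" and j: "j < N" and ij: "i \<noteq> j"
  defines "W \<equiv> U * column_mix N i j a b c d"
  shows "conj_entry N l k i i W = cnj a * a * conj_entry N l k i i U + cnj a * c * conj_entry N l k i j U +
           cnj c * a * conj_entry N l k j i U + cnj c * c * conj_entry N l k j j U" (is ?ii)
    and "conj_entry N l k i j W = cnj a * b * conj_entry N l k i i U + cnj a * d * conj_entry N l k i j U +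
           cnj c * b * conj_entry N l k j i U + cnj c * d * conj_entry N l k j j U" (is ?ij)
    and "conj_entry N l k j j W = cnj b * b * conj_entry N l k i i U + cnj b * d * conj_entry N l k i j U +
           cnj d * b * conj_entry N l k j i U + cnj d * d * conj_entry N l k j j U" (is ?jj)
    and "\<And>q. q < N \<Longrightarrow> q \<noteq> i \<Longrightarrow> q \<noteq> j \<Longrightarrow> conj_entry N l k q q W = conj_entry N l k q q U"
proof -
  note index = mult_column_mix_index [OF unitary_group_carrier [OF U] i j ij]
  have Wi: "W $$ (p, i) = U $$ (p, i) * a + U $$ (p, j) * c" if "p < N" for p
    using that i by (simp add: W_def index)
  have Wj: "W $$ (p, j) = U $$ (p, i) * b + U $$ (p, j) * d" if "p < N" for p
    using that j ij by (simp add: W_def index)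
  note bilinear = conj_entry_bilinear [OF Wi Wi] conj_entry_bilinear [OF Wi Wj] conj_entry_bilinear [OF Wj Wj]
  show ?ii ?ij ?jj
    by (rule bilinear; assumption)+
  show "conj_entry N l k q q W = conj_entry N l k q q U" if "q < N" "q \<noteq> i" "q \<noteq> j" for q
    unfolding conj_entry_def using that by (intro sum.cong refl) (simp add: W_def index)
qed

lemma sum_split_two:
  fixes f :: "nat \<Rightarrow> complex"
  assumes "i < N" "j < N" "i \<noteq> j"
  shows "(\<Sum>q<N. f q) = f i + f j + (\<Sum>q\<in>{..<N} - {i, j}. f q)"
proof -
  have "{..<N} - {i, j} = ({..<N} - {i}) - {j}" by auto
  then show ?thesis using assms
    by (simp add: sum.remove [of "{..<N}" i] sum.remove [of "{..<N} - {i}" j])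
qed

text \<open>Permuting two columns of \<open>U\<close> preserves Haar measure.\<close>

lemma dunkl_hc_swap:
  assumes H: "haar_prob_measure N H" and i: "i < N" and j: "j < N"
  shows "dunkl_hc H N l k j x = dunkl_hc H N l k i (x(i := x j, j := x i))"
proof (cases "i = j")
  case False
  define V where "V = column_mix N i j 0 1 1 0"
  define x' where "x' = x(i := x j, j := x i)"
  have V: "V \<in> unitary_group N"
    unfolding V_def by (rule column_mix_unitary [OF i j False]) auto
  have "dunkl_hc H N l k j x = (\<integral>U. conj_entry N l k j j (U * V) * diag_exp N l x (U * V) \<partial>H)"
    unfolding dunkl_hc_def
    by (rule haar_integral_right_mult [OF H V, symmetric])
       (intro borel_measurable_times conj_entry_measurable [OF H j j] diag_exp_measurable [OF H])
  also have "\<dots> = (\<integral>U. conj_entry N l k i i U * diag_exp N l x' U \<partial>H)"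
  proof (rule Bochner_Integration.integral_cong [OF refl])
    fix U assume "U \<in> space H"
    then have U: "U \<in> unitary_group N" by (simp add: haar_space [OF H])
    have "(\<Sum>q\<in>{..<N} - {i, j}. x q * conj_entry N l 1 q q (U * V)) =
          (\<Sum>q\<in>{..<N} - {i, j}. x' q * conj_entry N l 1 q q U)"
      by (intro sum.cong refl) (auto simp: x'_def V_def conj_entry_mult_column_mix(4) [OF U i j False])
    then have "(\<Sum>q<N. x q * conj_entry N l 1 q q (U * V)) = (\<Sum>q<N. x' q * conj_entry N l 1 q q U)"
      unfolding sum_split_two [OF i j False]
      using False by (simp add: x'_def V_def conj_entry_mult_column_mix(1,3) [OF U i j False])
    then show "conj_entry N l k j j (U * V) * diag_exp N l x (U * V) = conj_entry N l k i i U * diag_exp N l x' U"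
      by (simp add: diag_exp_def V_def conj_entry_mult_column_mix(3) [OF U i j False])
  qed
  finally show ?thesis by (simp add: dunkl_hc_def x'_def)
qed simp

text \<open>Multiplying column \<open>i\<close> of \<open>U\<close> by the imaginary unit changes the sign of the product of the two
\<open>(i, j)\<close> entries and leaves all diagonal entries alone.\<close>

lemma integral_same_offdiag_zero:
  assumes H: "haar_prob_measure N H" and i: "i < N" and j: "j < N" and ij: "i \<noteq> j"
  shows "(\<integral>U. conj_entry N l k i j U * conj_entry N l k' i j U * diag_exp N l x U \<partial>H) = 0"
proof -
  define V where "V = column_mix N i j \<i> 0 0 1"
  define f where "f = (\<lambda>U. conj_entry N l k i j U * conj_entry N l k' i j U * diag_exp N l x U)"
  have V: "V \<in> unitary_group N"
    unfolding V_def by (rule column_mix_unitary [OF i j ij]) auto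
  have "(\<integral>U. f U \<partial>H) = (\<integral>U. f (U * V) \<partial>H)"
    unfolding f_def
    by (rule haar_integral_right_mult [OF H V, symmetric])
       (intro borel_measurable_times conj_entry_measurable [OF H i j] diag_exp_measurable [OF H])
  also have "\<dots> = (\<integral>U. - f U \<partial>H)"
  proof (rule Bochner_Integration.integral_cong [OF refl])
    fix U assume "U \<in> space H"
    then have U: "U \<in> unitary_group N" by (simp add: haar_space [OF H])
    have "conj_entry N l 1 q q (U * V) = conj_entry N l 1 q q U" if "q < N" for q
      using that ij by (cases "q = i"; cases "q = j")
        (simp_all add: V_def conj_entry_mult_column_mix [OF U i j ij])
    then have "diag_exp N l x (U * V) = diag_exp N l x U"
      by (simp add: diag_exp_def)
    then show "f (U * V) = - f U"
      by (simp add: f_def V_def conj_entry_mult_column_mix(2) [OF U i j ij] mult_ac)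
  qed
  finally show ?thesis by (simp add: f_def)
qed

text \<open>The loop equation. Rotating columns \<open>j\<close> and \<open>i\<close> of \<open>U\<close> by the angle \<open>\<theta>\<close> turns the integral of
\<open>(B\<^sup>k) j i * exp (\<Sum>q. x q * B q q)\<close> into that of an entire function of \<open>\<theta>\<close>, whose value does not depend on
real \<open>\<theta>\<close>. Its derivative at \<open>0\<close> thus vanishes; there the entry \<open>(B\<^sup>k) j i\<close> contributes
\<open>(B\<^sup>k) i i - (B\<^sup>k) j j\<close>, and the exponent contributes \<open>(x j - x i) * (B i j + B j i)\<close>, of which one part
integrates to zero by the phase symmetry.\<close>

lemma offdiag_product_integral:
  assumes H: "haar_prob_measure N H" and i: "i < N" and j: "j < N" and ij: "i \<noteq> j"
  shows "(x i - x j) * (\<integral>U. conj_entry N l 1 i j U * conj_entry N l k j i U * diag_exp N l x U \<partial>H) =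
         dunkl_hc H N l k i x - dunkl_hc H N l k j x"
proof -
  define M where "M = (\<lambda>p q U. conj_entry N l k p q U)"
  define B where "B = (\<lambda>p q U. conj_entry N l 1 p q U)"
  define E where "E = diag_exp N l x"
  define y where "y = x j - x i"
  \<comment> \<open>the integrand after rotation by \<open>\<theta>\<close>; the formula makes sense for complex \<open>\<theta>\<close>, where no unitary
    matrix corresponds to it\<close>
  define f where "f = (\<lambda>\<theta> U.
     (cos \<theta> ^ 2 * M j i U - sin \<theta> ^ 2 * M i j U + sin \<theta> * cos \<theta> * (M i i U - M j j U)) *
     exp (y * (sin \<theta> ^ 2 * (B i i U - B j j U) + cos \<theta> * sin \<theta> * (B i j U + B j i U))) * E U)"
  have rot: "(\<integral>U. f (of_real t) U \<partial>H) = (\<integral>U. M j i U * E U \<partial>H)" for t :: real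
  proof -
    define V where "V = column_mix N j i (of_real (cos t)) (of_real (- sin t)) (of_real (sin t)) (of_real (cos t))"
    have sc: "complex_of_real (sin t) * of_real (sin t) + of_real (cos t) * of_real (cos t) = 1"
      unfolding of_real_mult [symmetric] of_real_add [symmetric]
      using sin_cos_squared_add [of t] by (simp add: power2_eq_square)
    have V: "V \<in> unitary_group N"
      unfolding V_def by (rule column_mix_unitary [OF j i]) (use ij sc in \<open>auto simp: algebra_simps\<close>)
    have "(\<integral>U. M j i U * E U \<partial>H) = (\<integral>U. M j i (U * V) * E (U * V) \<partial>H)"
      unfolding M_def E_def
      by (rule haar_integral_right_mult [OF H V, symmetric])
         (intro borel_measurable_times conj_entry_measurable [OF H j i] diag_exp_measurable [OF H])
    also have "\<dots> = (\<integral>U. f (of_real t) U \<partial>H)"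
    proof (rule Bochner_Integration.integral_cong [OF refl])
      fix U assume "U \<in> space H"
      then have U: "U \<in> unitary_group N" by (simp add: haar_space [OF H])
      define s c where "s = sin (complex_of_real t)" and "c = cos (complex_of_real t)"
      have cs: "c ^ 2 = 1 - s ^ 2"
        unfolding s_def c_def using sin_cos_squared_add [of "complex_of_real t"] by (simp add: algebra_simps)
      have cV: "of_real (cos t) = c" "of_real (sin t) = s" "cnj c = c" "cnj s = s"
        by (simp_all add: s_def c_def cos_of_real sin_of_real)
      note col = conj_entry_mult_column_mix [OF U j i ij [symmetric], where a = "of_real (cos t)" and b = "of_real (- sin t)"
          and c = "of_real (sin t)" and d = "of_real (cos t)" and l = l, folded V_def, unfolded of_real_minus cV complex_cnj_minus]
      have MW: "M j i (U * V) = c ^ 2 * M j i U - s ^ 2 * M i j U + s * c * (M i i U - M j j U)"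
        unfolding M_def col(2) by (simp add: power2_eq_square algebra_simps)
      have "(\<Sum>q<N. x q * B q q (U * V)) = (\<Sum>q<N. x q * B q q U) +
          y * (s ^ 2 * (B i i U - B j j U) + c * s * (B i j U + B j i U))"
      proof -
        have "(\<Sum>q\<in>{..<N} - {j, i}. x q * B q q (U * V)) = (\<Sum>q\<in>{..<N} - {j, i}. x q * B q q U)"
          by (intro sum.cong refl) (auto simp: B_def col(4))
        moreover have "x j * B j j (U * V) + x i * B i i (U * V) = x j * B j j U + x i * B i i U +
            y * (s ^ 2 * (B i i U - B j j U) + c * s * (B i j U + B j i U)) +
            (c ^ 2 - (1 - s ^ 2)) * (x j * B j j U + x i * B i i U)"
          unfolding B_def col(1,3) y_def by (simp add: power2_eq_square algebra_simps)
        ultimately show ?thesis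
          unfolding sum_split_two [OF j i ij [symmetric]] cs by (simp add: algebra_simps)
      qed
      then have "E (U * V) = exp (y * (s ^ 2 * (B i i U - B j j U) + c * s * (B i j U + B j i U))) * E U"
        by (simp add: E_def diag_exp_def B_def exp_add mult.commute)
      then show "M j i (U * V) * E (U * V) = f (of_real t) U"
        unfolding f_def s_def [symmetric] c_def [symmetric] by (simp add: MW)
    qed
    finally show ?thesis by simp
  qed
  define m where "m = (\<Sum>p<N. \<bar>l p\<bar> ^ k)"
  define b where "b = (\<Sum>p<N. \<bar>l p\<bar>)"
  define e where "e = exp (real N * (\<Sum>q<N. norm (x q)) * b)"
  have mb: "0 \<le> m" "0 \<le> b" by (auto simp: m_def b_def sum_nonneg)
  have M: "norm (M p q U) \<le> m" if "U \<in> unitary_group N" "p < N" "q < N" for p q U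
    unfolding M_def m_def using that by (rule norm_conj_entry)
  have B: "norm (B p q U) \<le> b" if "U \<in> unitary_group N" "p < N" "q < N" for p q U
    unfolding B_def b_def using norm_conj_entry [OF that, of l 1] by simp
  have E: "norm (E U) \<le> e" if "U \<in> unitary_group N" for U
    unfolding E_def e_def b_def by (rule norm_diag_exp [OF that]) (auto intro: member_le_sum)
  have trig: "norm (sin \<theta>) \<le> exp 1" "norm (cos \<theta>) \<le> exp 1" if "\<theta> \<in> ball 0 1" for \<theta> :: complex
    using cmod_sin_le_exp [of 1 \<theta>] cmod_cos_le_exp [of 1 \<theta>] abs_Im_le_cmod [of \<theta>] that
    by (auto intro: order.trans)
  define K where "K = exp 1 * exp (1 :: real)"
  have K: "norm (u * v) \<le> K" if "norm u \<le> exp 1" "norm v \<le> exp 1" for u v :: complex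
    unfolding K_def norm_mult using that by (intro mult_mono) auto
  have K0: "0 \<le> K" by (simp add: K_def)
  have dom: "norm (f \<theta> U) \<le> (K * m + K * m + K * (2 * m)) * exp (norm y * (K * (2 * b) + K * (2 * b))) * e"
    if \<theta>: "\<theta> \<in> ball 0 1" and U: "U \<in> space H" for \<theta> U
  proof -
    have U': "U \<in> unitary_group N" using U by (simp add: haar_space [OF H])
    define c s where "c = cos \<theta>" and "s = sin \<theta>"
    note [simp] = power2_eq_square
    have cs: "norm c \<le> exp 1" "norm s \<le> exp 1" using trig [OF \<theta>] by (simp_all add: c_def s_def)
    have 1: "norm (c ^ 2 * M j i U - s ^ 2 * M i j U + s * c * (M i i U - M j j U)) \<le> K * m + K * m + K * (2 * m)"
    proof -
      have "norm (M i i U - M j j U) \<le> 2 * m"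
        using norm_triangle_ineq4 [of "M i i U" "M j j U"] M [OF U' i i] M [OF U' j j] by linarith
      then have "norm (s * c * (M i i U - M j j U)) \<le> K * (2 * m)"
        unfolding norm_mult [of "s * c"] using cs K0 by (intro mult_mono K) auto
      moreover have "norm (c ^ 2 * M j i U) \<le> K * m"
        unfolding norm_mult [of "c ^ 2"] using cs K0 M [OF U' j i] by (intro mult_mono) (auto intro: K)
      moreover have "norm (s ^ 2 * M i j U) \<le> K * m"
        unfolding norm_mult [of "s ^ 2"] using cs K0 M [OF U' i j] by (intro mult_mono) (auto intro: K)
      moreover note norm_triangle_ineq [of "c ^ 2 * M j i U - s ^ 2 * M i j U" "s * c * (M i i U - M j j U)"]
          norm_triangle_ineq4 [of "c ^ 2 * M j i U" "s ^ 2 * M i j U"]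
      ultimately show ?thesis by linarith
    qed
    define X where "X = s ^ 2 * (B i i U - B j j U) + c * s * (B i j U + B j i U)"
    have "norm X \<le> K * (2 * b) + K * (2 * b)"
      unfolding X_def
    proof (rule norm_triangle_mono)
      have "norm (B i i U - B j j U) \<le> 2 * b"
        using norm_triangle_ineq4 [of "B i i U" "B j j U"] B [OF U' i i] B [OF U' j j] by linarith
      then show "norm (s ^ 2 * (B i i U - B j j U)) \<le> K * (2 * b)"
        unfolding norm_mult [of "s ^ 2"] using cs K0 by (intro mult_mono) (auto intro: K)
      have "norm (B i j U + B j i U) \<le> 2 * b"
        using norm_triangle_ineq [of "B i j U" "B j i U"] B [OF U' i j] B [OF U' j i] by linarith
      then show "norm (c * s * (B i j U + B j i U)) \<le> K * (2 * b)"
        unfolding norm_mult [of "c * s"] using cs K0 by (intro mult_mono K) auto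
    qed
    then have "norm (y * X) \<le> norm y * (K * (2 * b) + K * (2 * b))"
      unfolding norm_mult by (intro mult_left_mono) auto
    then have 2: "norm (exp (y * X)) \<le> exp (norm y * (K * (2 * b) + K * (2 * b)))"
      using norm_exp order.trans exp_le_cancel_iff by blast
    show ?thesis
      unfolding f_def c_def [symmetric] s_def [symmetric] X_def [symmetric]
        norm_mult [of "_ * exp _"] norm_mult [of _ "exp _"]
      by (intro mult_mono 1 2 E U') (use mb K0 in auto)
  qed
  have meas: "f \<theta> \<in> borel_measurable H" for \<theta>
    unfolding f_def M_def B_def E_def
    by (intro borel_measurable_times borel_measurable_add borel_measurable_diff borel_measurable_const
          conj_entry_measurable [OF H] diag_exp_measurable [OF H] i j
          measurable_compose [OF _ borel_measurable_continuous_onI [of exp]] continuous_intros)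
  have hol: "(\<lambda>\<theta>. f \<theta> U) holomorphic_on ball 0 1" for U
    unfolding f_def by (intro holomorphic_intros)
  interpret prob_space H using H by (simp add: haar_prob_measure_def)
  have der0: "deriv (\<lambda>\<theta>. f \<theta> U) 0 = (M i i U - M j j U) * E U + y * (M j i U * B i j U * E U) + y * (M j i U * B j i U * E U)" for U
    unfolding f_def by (rule DERIV_imp_deriv) (auto intro!: derivative_eq_intros simp: algebra_simps)
  have D: "((\<lambda>\<theta>. \<integral>U. f \<theta> U \<partial>H) has_field_derivative (\<integral>U. deriv (\<lambda>\<theta>. f \<theta> U) 0 \<partial>H)) (at 0)"
    by (rule integral_holomorphic(1) [OF hol meas dom]) auto
  have "(\<integral>U. deriv (\<lambda>\<theta>. f \<theta> U) 0 \<partial>H) = 0"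
  proof -
    have "((\<lambda>t. \<integral>U. f (of_real t) U \<partial>H) has_vector_derivative (\<integral>U. deriv (\<lambda>\<theta>. f \<theta> U) 0 \<partial>H)) (at (0::real))"
      using has_vector_derivative_real_field [of "\<lambda>\<theta>. \<integral>U. f \<theta> U \<partial>H" _ 0 UNIV] D by simp
    then have "((\<lambda>t::real. \<integral>U. M j i U * E U \<partial>H) has_vector_derivative (\<integral>U. deriv (\<lambda>\<theta>. f \<theta> U) 0 \<partial>H)) (at 0)"
      unfolding rot .
    from vector_derivative_unique_at [OF this has_vector_derivative_const] show ?thesis .
  qed
  moreover have "(\<integral>U. deriv (\<lambda>\<theta>. f \<theta> U) 0 \<partial>H) =
      (\<integral>U. (M i i U * E U - M j j U * E U) + y * (M j i U * B i j U * E U) + y * (M j i U * B j i U * E U) \<partial>H)"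
    unfolding der0 by (simp add: algebra_simps)
  moreover have "\<dots> = (\<integral>U. M i i U * E U \<partial>H) - (\<integral>U. M j j U * E U \<partial>H) +
        y * (\<integral>U. M j i U * B i j U * E U \<partial>H) + y * (\<integral>U. M j i U * B j i U * E U \<partial>H)"
    unfolding M_def B_def E_def
    using haar_integrable_conj_entries [OF H] haar_integrable_conj_entry [OF H] i j by simp
  moreover have "(\<integral>U. M j i U * B j i U * E U \<partial>H) = 0"
    unfolding M_def B_def E_def by (rule integral_same_offdiag_zero [OF H j i ij [symmetric]])
  ultimately have "(\<integral>U. M i i U * E U \<partial>H) - (\<integral>U. M j j U * E U \<partial>H) = - y * (\<integral>U. M j i U * B i j U * E U \<partial>H)"
    by (simp add: algebra_simps add_eq_0_iff)
  then show ?thesis by (simp add: dunkl_hc_def M_def B_def E_def y_def mult_ac)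
qed

lemma dunkl_hc_holomorphic:
  assumes H: "haar_prob_measure N H" and i: "i < N" and m: "m < N"
  shows "(\<lambda>z. dunkl_hc H N l k i (x(m := z))) holomorphic_on UNIV"
    and "deriv (\<lambda>z. dunkl_hc H N l k i (x(m := z))) (x m) =
         (\<integral>U. conj_entry N l 1 m m U * conj_entry N l k i i U * diag_exp N l x U \<partial>H)"
proof -
  interpret prob_space H using H by (simp add: haar_prob_measure_def)
  define f where "f = (\<lambda>z U. conj_entry N l k i i U * diag_exp N l (x(m := z)) U)"
  have split: "(\<Sum>q<N. (x(m := z)) q * conj_entry N l 1 q q U) =
      z * conj_entry N l 1 m m U + (\<Sum>q\<in>{..<N} - {m}. x q * conj_entry N l 1 q q U)" for z U
  proof -
    have "(\<Sum>q\<in>{..<N} - {m}. (x(m := z)) q * conj_entry N l 1 q q U) = (\<Sum>q\<in>{..<N} - {m}. x q * conj_entry N l 1 q q U)"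
      by (intro sum.cong) auto
    then show ?thesis using m by (subst sum.remove [of _ m]) auto
  qed
  have D: "((\<lambda>z. f z U) has_field_derivative conj_entry N l 1 m m U * f z U) (at z)" for z U
    unfolding f_def diag_exp_def split by (auto intro!: derivative_eq_intros)
  have hol: "(\<lambda>z. f z U) holomorphic_on S" for U S
    using D by (auto simp: holomorphic_on_def field_differentiable_def intro: has_field_derivative_at_within)
  have meas: "f z \<in> borel_measurable H" for z
    unfolding f_def by (intro borel_measurable_times conj_entry_measurable [OF H] i diag_exp_measurable [OF H])
  have dom: "norm (f z U) \<le> (\<Sum>p<N. \<bar>l p\<bar> ^ k) * exp (real N * (R + (\<Sum>q<N. norm (x q))) * (\<Sum>p<N. \<bar>l p\<bar>))"
    if "z \<in> ball 0 R" "U \<in> space H" for z U and R :: real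
  proof -
    have U: "U \<in> unitary_group N" using that by (simp add: haar_space [OF H])
    have "norm ((x(m := z)) q) \<le> R + (\<Sum>q<N. norm (x q))" if "q < N" for q
    proof -
      have "0 \<le> (\<Sum>q<N. norm (x q))" by (rule sum_nonneg) simp
      moreover have "norm (x q) \<le> (\<Sum>q<N. norm (x q))" by (rule member_le_sum) (use that in auto)
      moreover have "norm z < R" using \<open>z \<in> ball 0 R\<close> by simp
      moreover have "0 \<le> norm z" by simp
      ultimately show ?thesis unfolding fun_upd_def by (smt (verit))
    qed
    from norm_diag_exp [where x = "x(m := z)", OF U this] norm_conj_entry [OF U i i, of l k]
    show ?thesis unfolding f_def norm_mult by (intro mult_mono) (auto intro: sum_nonneg)
  qed
  have key: "((\<lambda>z. \<integral>U. f z U \<partial>H) has_field_derivative (\<integral>U. conj_entry N l 1 m m U * f z U \<partial>H)) (at z)" for z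
  proof -
    have "((\<lambda>z. \<integral>U. f z U \<partial>H) has_field_derivative (\<integral>U. deriv (\<lambda>z. f z U) z \<partial>H)) (at z)"
      by (rule integral_holomorphic(1) [OF hol meas dom, of "norm z + 1"]) auto
    then show ?thesis by (simp add: DERIV_imp_deriv [OF D])
  qed
  have eq: "dunkl_hc H N l k i (x(m := z)) = (\<integral>U. f z U \<partial>H)" for z
    by (simp add: dunkl_hc_def f_def)
  show "(\<lambda>z. dunkl_hc H N l k i (x(m := z))) holomorphic_on UNIV"
    unfolding eq using key by (auto simp: holomorphic_on_def field_differentiable_def)
  show "deriv (\<lambda>z. dunkl_hc H N l k i (x(m := z))) (x m) =
         (\<integral>U. conj_entry N l 1 m m U * conj_entry N l k i i U * diag_exp N l x U \<partial>H)"
    unfolding eq DERIV_imp_deriv [OF key] by (simp add: f_def mult_ac)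
qed

text \<open>In \<open>(B\<^sup>k\<^sup>+\<^sup>1) i i = (\<Sum>j. B i j * (B\<^sup>k) j i)\<close> the term \<open>j = i\<close> is the derivative of the exponential, and
the loop equation evaluates the others.\<close>

lemma dunkl_hc_recursion:
  assumes H: "haar_prob_measure N H" and i: "i < N" and ne: "\<And>j. j < N \<Longrightarrow> j \<noteq> i \<Longrightarrow> x j \<noteq> x i"
  shows "dunkl_hc H N l (Suc k) i x = deriv (\<lambda>z. dunkl_hc H N l k i (x(i := z))) (x i) +
     (\<Sum>j\<in>{..<N} - {i}. (dunkl_hc H N l k i x - dunkl_hc H N l k j x) / (x i - x j))"
proof -
  define I where "I = (\<lambda>j. \<integral>U. conj_entry N l 1 i j U * conj_entry N l k j i U * diag_exp N l x U \<partial>H)"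
  have "dunkl_hc H N l (Suc k) i x =
    (\<integral>U. (\<Sum>j<N. conj_entry N l 1 i j U * conj_entry N l k j i U * diag_exp N l x U) \<partial>H)"
    unfolding dunkl_hc_def
    by (intro Bochner_Integration.integral_cong refl)
       (simp add: haar_space [OF H] conj_entry_Suc [OF _ i i] sum_distrib_right)
  also have "\<dots> = (\<Sum>j<N. I j)"
    unfolding I_def using i by (intro Bochner_Integration.integral_sum haar_integrable_conj_entries [OF H]) auto
  also have "\<dots> = I i + (\<Sum>j\<in>{..<N} - {i}. I j)"
    using i by (subst sum.remove [of _ i]) auto
  also have "I i = deriv (\<lambda>z. dunkl_hc H N l k i (x(i := z))) (x i)"
    unfolding I_def dunkl_hc_holomorphic(2) [OF H i i] ..
  also have "(\<Sum>j\<in>{..<N} - {i}. I j) =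
     (\<Sum>j\<in>{..<N} - {i}. (dunkl_hc H N l k i x - dunkl_hc H N l k j x) / (x i - x j))"
  proof (rule sum.cong [OF refl])
    fix j assume j: "j \<in> {..<N} - {i}"
    with ne [of j] have "x i - x j \<noteq> 0" by auto
    with offdiag_product_integral [OF H i, of j x l k] j
    show "I j = (dunkl_hc H N l k i x - dunkl_hc H N l k j x) / (x i - x j)"
      by (auto simp: I_def field_simps)
  qed
  finally show ?thesis .
qed

text \<open>At \<open>x = 0\<close> the diagonal entries of \<open>B\<^sup>k\<close> have equal integrals, and their sum is the trace.\<close>

lemma sum_powers_eq_dunkl_hc:
  assumes H: "haar_prob_measure N H" and N: "N \<ge> 1"
  shows "(\<Sum>p<N. of_real (l p) ^ k) = of_nat N * dunkl_hc H N l k 0 (\<lambda>_. 0)"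
proof -
  interpret prob_space H using H by (simp add: haar_prob_measure_def)
  have "dunkl_hc H N l k i (\<lambda>_. 0) = dunkl_hc H N l k 0 (\<lambda>_. 0)" if "i < N" for i
  proof -
    have "(\<lambda>_. 0 :: complex)(0 := 0, i := 0) = (\<lambda>_. 0)" by auto
    then show ?thesis using dunkl_hc_swap [OF H, of 0 i l k "\<lambda>_. 0"] N that by simp
  qed
  then have "(\<Sum>i<N. dunkl_hc H N l k i (\<lambda>_. 0)) = (\<Sum>i<N. dunkl_hc H N l k 0 (\<lambda>_. 0))"
    by (intro sum.cong refl) blast
  then have "of_nat N * dunkl_hc H N l k 0 (\<lambda>_. 0) = (\<Sum>i<N. dunkl_hc H N l k i (\<lambda>_. 0))"
    by (simp only: sum_constant card_lessThan)
  also have "\<dots> = (\<integral>U. (\<Sum>i<N. conj_entry N l k i i U * diag_exp N l (\<lambda>_. 0) U) \<partial>H)"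
    unfolding dunkl_hc_def
    by (intro Bochner_Integration.integral_sum [symmetric] haar_integrable_conj_entry [OF H]) auto
  also have "\<dots> = (\<integral>U. (\<Sum>p<N. of_real (l p) ^ k) \<partial>H)"
    by (intro Bochner_Integration.integral_cong refl)
       (simp add: haar_space [OF H] diag_exp_def sum_conj_entry_diag)
  also have "\<dots> = (\<Sum>p<N. of_real (l p) ^ k)" by (simp add: prob_space)
  finally show ?thesis by simp
qed

section \<open>Averaging over the random spectrum\<close>

text \<open>The bound has to be uniform over the polydisc so that derivatives in \<open>x\<close> can be taken under the
expectation. Measurability in \<open>\<omega>\<close> is part of the notion because \<open>lam\<close> is an arbitrary function: it is
inherited along the recursion from the Harish-Chandra integral.\<close>

definition dominated ::
  "'a measure \<Rightarrow> complex mat measure \<Rightarrow> nat \<Rightarrow> ('a \<Rightarrow> nat \<Rightarrow> real) \<Rightarrow> nat \<Rightarrow> nat \<Rightarrow> real \<Rightarrow> bool" where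
  "dominated M H N lam k r \<delta> \<longleftrightarrow> (\<exists>W. integrable M W \<and>
     (\<forall>i<r. \<forall>x\<in>polydisc r \<delta>. (\<lambda>\<omega>. dunkl_hc H N (lam \<omega>) k i x) \<in> borel_measurable M \<and>
        (\<forall>\<omega>\<in>space M. norm (dunkl_hc H N (lam \<omega>) k i x) \<le> W \<omega>)))"

definition mean_dunkl ::
  "'a measure \<Rightarrow> complex mat measure \<Rightarrow> nat \<Rightarrow> ('a \<Rightarrow> nat \<Rightarrow> real) \<Rightarrow> nat \<Rightarrow> nat \<Rightarrow> (nat \<Rightarrow> complex) \<Rightarrow> complex" where
  "mean_dunkl M H N lam k i x = (\<integral>\<omega>. dunkl_hc H N (lam \<omega>) k i x \<partial>M)"

text \<open>Only real parts matter for the absolute value of the integrand, and \<open>exp\<close> of a linear form on a cube is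
at most the sum of its values at the corners.\<close>

lemma norm_HC_le_sum_corners:
  assumes H: "haar_prob_measure N H" and rN: "r \<le> N" and x: "x \<in> polydisc r \<eta>"
  shows "norm (HC H N x l) \<le>
    (\<Sum>s\<in>{..<r} \<rightarrow>\<^sub>E {\<eta>, -\<eta>}. norm (HC H N (\<lambda>q. if q < r then of_real (s q) else 0) l))"
proof -
  let ?C = "{..<r} \<rightarrow>\<^sub>E {\<eta>, -\<eta>}"
  interpret prob_space H using H by (simp add: haar_prob_measure_def)
  define b where "b = (\<lambda>q U. Re (conj_entry N l 1 q q U))"
  have b: "conj_entry N l 1 q q U = of_real (b q U)" for q U
    using conj_entry_real [of N l 1 q U] by (simp add: b_def)
  define c where "c = (\<lambda>s q. if q < r then complex_of_real (s q) else 0)"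
  have expo: "(\<Sum>q<N. y q * conj_entry N l 1 q q U) = (\<Sum>q<r. y q * of_real (b q U))" if "\<And>q. q \<ge> r \<Longrightarrow> y q = 0" for y U
  proof -
    have "(\<Sum>q<r. y q * of_real (b q U)) = (\<Sum>q<N. y q * of_real (b q U))"
      by (rule sum.mono_neutral_left) (use rN that in auto)
    then show ?thesis by (simp only: b)
  qed
  have corner: "diag_exp N l (c s) U = of_real (exp (\<Sum>q<r. s q * b q U))" for s U
  proof -
    have "(\<Sum>q<N. c s q * conj_entry N l 1 q q U) = (\<Sum>q<r. c s q * of_real (b q U))"
      by (rule expo) (simp add: c_def)
    also have "\<dots> = of_real (\<Sum>q<r. s q * b q U)" by (simp add: c_def)
    finally show ?thesis by (simp only: diag_exp_def exp_of_real)
  qed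
  have int: "integrable H (diag_exp N l y)" for y
  proof (rule haar_integrable_bounded [OF H diag_exp_measurable [OF H]])
    fix U assume U: "U \<in> unitary_group N"
    show "norm (diag_exp N l y U) \<le> exp (real N * (\<Sum>q<N. norm (y q)) * (\<Sum>p<N. \<bar>l p\<bar>))"
      by (rule norm_diag_exp [OF U]) (auto intro: member_le_sum)
  qed
  have pw: "norm (diag_exp N l x U) \<le> (\<Sum>s\<in>?C. norm (diag_exp N l (c s) U))" for U
  proof -
    have "norm (diag_exp N l x U) = exp (\<Sum>q<r. Re (x q) * b q U)"
      unfolding diag_exp_def using x by (subst expo) (auto simp: polydisc_def)
    also have "\<dots> = (\<Prod>q<r. exp (Re (x q) * b q U))" by (simp add: exp_sum)
    also have "\<dots> \<le> (\<Prod>q<r. \<Sum>v\<in>{\<eta>, -\<eta>}. exp (v * b q U))"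
    proof (intro prod_mono conjI)
      fix q assume q: "q \<in> {..<r}"
      have xq: "\<bar>Re (x q)\<bar> \<le> \<eta>" "0 < \<eta>"
        using x q abs_Re_le_cmod [of "x q"] norm_ge_zero [of "x q"] by (auto simp: polydisc_def intro: order.strict_trans1 less_imp_le order.trans)
      have "Re (x q) * b q U \<le> \<bar>Re (x q)\<bar> * \<bar>b q U\<bar>"
        by (metis abs_ge_self abs_mult)
      also have "\<dots> \<le> \<eta> * \<bar>b q U\<bar>" by (rule mult_right_mono [OF xq(1)]) simp
      finally have "exp (Re (x q) * b q U) \<le> exp (\<eta> * \<bar>b q U\<bar>)" by simp
      also have "\<dots> \<le> exp (\<eta> * b q U) + exp (- \<eta> * b q U)"
        by (cases "b q U \<ge> 0") auto
      finally show "exp (Re (x q) * b q U) \<le> (\<Sum>v\<in>{\<eta>, -\<eta>}. exp (v * b q U))"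
        using xq(2) by simp
    qed auto
    also have "\<dots> = (\<Sum>s\<in>?C. \<Prod>q<r. exp (s q * b q U))"
      by (rule prod_sum_PiE) auto
    also have "\<dots> = (\<Sum>s\<in>?C. norm (diag_exp N l (c s) U))"
    proof -
      have "norm (diag_exp N l (c s) U) = exp (\<Sum>q<r. s q * b q U)" for s
        by (simp only: corner norm_of_real abs_exp_cancel)
      then show ?thesis by (simp only: exp_sum [OF finite_lessThan])
    qed
    finally show ?thesis .
  qed
  have "norm (HC H N x l) \<le> (\<integral>U. norm (diag_exp N l x U) \<partial>H)"
    unfolding HC_eq_integral [OF H] by (rule integral_norm_bound)
  also have "\<dots> \<le> (\<integral>U. (\<Sum>s\<in>?C. norm (diag_exp N l (c s) U)) \<partial>H)"
    by (intro integral_mono pw integrable_norm int Bochner_Integration.integrable_sum)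
  also have "\<dots> = (\<Sum>s\<in>?C. \<integral>U. norm (diag_exp N l (c s) U) \<partial>H)"
    by (intro Bochner_Integration.integral_sum integrable_norm int)
  also have "\<dots> = (\<Sum>s\<in>?C. norm (HC H N (c s) l))"
  proof (intro sum.cong refl)
    fix s
    have "HC H N (c s) l = of_real (\<integral>U. exp (\<Sum>q<r. s q * b q U) \<partial>H)"
      unfolding HC_eq_integral [OF H] corner by (rule integral_complex_of_real)
    moreover have "(\<integral>U. exp (\<Sum>q<r. s q * b q U) \<partial>H) \<ge> 0"
      by (rule Bochner_Integration.integral_nonneg) simp
    ultimately show "(\<integral>U. norm (diag_exp N l (c s) U) \<partial>H) = norm (HC H N (c s) l)"
      by (simp add: corner)
  qed
  finally show ?thesis by (simp add: c_def)
qed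

lemma dominated_0:
  assumes H: "haar_prob_measure N H" and rN: "r \<le> N" and N: "0 < N" and d: "0 < \<delta>"
    and int: "\<And>x. x \<in> polydisc r \<delta> \<Longrightarrow> integrable M (\<lambda>\<omega>. HC H N x (lam \<omega>))"
  shows "dominated M H N lam 0 r (\<delta> / 2)"
proof -
  define W where "W = (\<lambda>\<omega>. \<Sum>s\<in>{..<r} \<rightarrow>\<^sub>E {\<delta> / 2, -(\<delta> / 2)}.
     norm (HC H N (\<lambda>q. if q < r then of_real (s q) else 0) (lam \<omega>)))"
  have "integrable M W"
    unfolding W_def
  proof (intro Bochner_Integration.integrable_sum integrable_norm int)
    fix s assume s: "s \<in> {..<r} \<rightarrow>\<^sub>E {\<delta> / 2, -(\<delta> / 2)}"
    have "\<bar>s q\<bar> < \<delta>" if "q < r" for q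
    proof -
      have "s q \<in> {\<delta> / 2, -(\<delta> / 2)}" using s that by (auto simp: PiE_iff)
      then show ?thesis using d by auto
    qed
    then show "(\<lambda>q. if q < r then complex_of_real (s q) else 0) \<in> polydisc r \<delta>"
      by (auto simp: polydisc_def)
  qed
  moreover have "(\<lambda>\<omega>. dunkl_hc H N (lam \<omega>) 0 i x) \<in> borel_measurable M"
    "norm (dunkl_hc H N (lam \<omega>) 0 i x) \<le> W \<omega>" if i: "i < r" and x: "x \<in> polydisc r (\<delta> / 2)" for i x \<omega>
  proof -
    have iN: "i < N" using i rN by simp
    have "x \<in> polydisc r \<delta>" using x d by (rule_tac polydisc_mono) auto
    from int [OF this] show "(\<lambda>\<omega>. dunkl_hc H N (lam \<omega>) 0 i x) \<in> borel_measurable M"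
      unfolding HC_eq_dunkl_hc [OF H iN] by (rule borel_measurable_integrable)
    show "norm (dunkl_hc H N (lam \<omega>) 0 i x) \<le> W \<omega>"
      unfolding HC_eq_dunkl_hc [OF H iN, symmetric] W_def by (rule norm_HC_le_sum_corners [OF H rN x])
  qed
  ultimately show ?thesis unfolding dominated_def by blast
qed

lemma dunkl_hc_outer_index:
  assumes H: "haar_prob_measure N H" and rN: "r < N" and x: "x \<in> polydisc r \<delta>" and j: "j < N" and jr: "r \<le> j"
  shows "dunkl_hc H N l k j x = dunkl_hc H N l k r x"
proof -
  have "x(r := x j, j := x r) = x" using x jr by (auto simp: polydisc_def)
  then show ?thesis using dunkl_hc_swap [OF H rN j, of l k x] by simp
qed

lemma dominated_integrable:
  assumes dom: "dominated M H N lam k r \<delta>" and i: "i < r" and x: "x \<in> polydisc r \<delta>"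
  shows "integrable M (\<lambda>\<omega>. dunkl_hc H N (lam \<omega>) k i x)"
proof -
  obtain W where W: "integrable M W" "(\<lambda>\<omega>. dunkl_hc H N (lam \<omega>) k i x) \<in> borel_measurable M"
     "\<And>\<omega>. \<omega> \<in> space M \<Longrightarrow> norm (dunkl_hc H N (lam \<omega>) k i x) \<le> W \<omega>"
    using dom i x unfolding dominated_def by blast
  show ?thesis
  proof (rule Bochner_Integration.integrable_bound [OF W(1,2)], rule AE_I2)
    fix \<omega> assume "\<omega> \<in> space M"
    from W(3) [OF this] show "norm (dunkl_hc H N (lam \<omega>) k i x) \<le> norm (W \<omega>)" by simp
  qed
qed

lemma dominated_integrable_all:
  assumes H: "haar_prob_measure N H" and dom: "dominated M H N lam k (r + 1) \<delta>" and rN: "r < N"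
    and x: "x \<in> polydisc r \<delta>" and d: "0 < \<delta>" and j: "j < N"
  shows "integrable M (\<lambda>\<omega>. dunkl_hc H N (lam \<omega>) k j x)"
proof -
  have x': "x \<in> polydisc (r + 1) \<delta>" using x d by (rule_tac polydisc_mono) auto
  show ?thesis
  proof (cases "j \<le> r")
    case True
    then show ?thesis by (intro dominated_integrable [OF dom _ x']) auto
  next
    case False
    then show ?thesis
      using dominated_integrable [OF dom _ x', of r] dunkl_hc_outer_index [OF H rN x j] by simp
  qed
qed

lemma mean_dunkl_derivative:
  assumes H: "haar_prob_measure N H" and dom: "dominated M H N lam k r \<delta>" and rN: "r \<le> N"
    and x: "x \<in> polydisc r \<delta>" and i: "i < r" and m: "m < r" and z: "norm z < \<delta>"
  shows "((\<lambda>z. mean_dunkl M H N lam k i (x(m := z))) has_field_derivative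
           (\<integral>\<omega>. deriv (\<lambda>z. dunkl_hc H N (lam \<omega>) k i (x(m := z))) z \<partial>M)) (at z)"
    and "integrable M (\<lambda>\<omega>. deriv (\<lambda>z. dunkl_hc H N (lam \<omega>) k i (x(m := z))) z)"
proof -
  obtain W where W: "integrable M W" "\<And>x. x \<in> polydisc r \<delta> \<Longrightarrow> (\<lambda>\<omega>. dunkl_hc H N (lam \<omega>) k i x) \<in> borel_measurable M"
     "\<And>\<omega> x. \<omega> \<in> space M \<Longrightarrow> x \<in> polydisc r \<delta> \<Longrightarrow> norm (dunkl_hc H N (lam \<omega>) k i x) \<le> W \<omega>"
    using dom i unfolding dominated_def by blast
  have hol: "(\<lambda>z. dunkl_hc H N (lam \<omega>) k i (x(m := z))) holomorphic_on ball 0 \<delta>" for \<omega>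
    using dunkl_hc_holomorphic(1) [OF H, of i m "lam \<omega>" k x] i m rN by (auto intro: holomorphic_on_subset)
  have z': "z \<in> ball 0 \<delta>" using z by simp
  have up: "x(m := w) \<in> polydisc r \<delta>" if "w \<in> ball 0 \<delta>" for w
    using that by (intro polydisc_upd x m) simp
  note key = integral_holomorphic [OF hol W(2) [OF up] W(3) [OF _ up] W(1) z']
  show "((\<lambda>z. mean_dunkl M H N lam k i (x(m := z))) has_field_derivative
           (\<integral>\<omega>. deriv (\<lambda>z. dunkl_hc H N (lam \<omega>) k i (x(m := z))) z \<partial>M)) (at z)"
    unfolding mean_dunkl_def by (rule key(1)) auto
  show "integrable M (\<lambda>\<omega>. deriv (\<lambda>z. dunkl_hc H N (lam \<omega>) k i (x(m := z))) z)"
    by (rule key(2)) auto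
qed

lemma mean_dunkl_holomorphic:
  assumes H: "haar_prob_measure N H" and dom: "dominated M H N lam k r \<delta>" and rN: "r \<le> N"
    and x: "x \<in> polydisc r \<delta>" and i: "i < r" and m: "m < r"
  shows "(\<lambda>z. mean_dunkl M H N lam k i (x(m := z))) holomorphic_on ball 0 \<delta>"
  unfolding holomorphic_on_def field_differentiable_def
proof
  fix z :: complex assume "z \<in> ball 0 \<delta>"
  then have "norm z < \<delta>" by simp
  from mean_dunkl_derivative(1) [OF assms this]
  show "\<exists>f'. ((\<lambda>z. mean_dunkl M H N lam k i (x(m := z))) has_field_derivative f') (at z within ball 0 \<delta>)"
    using has_field_derivative_at_within by blast
qed

lemma mean_dunkl_swap:
  assumes H: "haar_prob_measure N H" and i: "i < N" and j: "j < N"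
  shows "mean_dunkl M H N lam k j x = mean_dunkl M H N lam k i (x(i := x j, j := x i))"
  unfolding mean_dunkl_def by (subst dunkl_hc_swap [OF H i j]) simp

lemma dominated_Suc_generic:
  assumes H: "haar_prob_measure N H" and dom: "dominated M H N lam k (r + 1) \<delta>" and rN: "r < N"
    and d: "0 < \<delta>" and x: "x \<in> polydisc r \<delta>" and i: "i < r"
    and ne: "\<And>j. j < N \<Longrightarrow> j \<noteq> i \<Longrightarrow> x j \<noteq> x i"
  shows "integrable M (\<lambda>\<omega>. dunkl_hc H N (lam \<omega>) (Suc k) i x)"
    and "mean_dunkl M H N lam (Suc k) i x = deriv (\<lambda>z. mean_dunkl M H N lam k i (x(i := z))) (x i) +
       (\<Sum>j\<in>{..<N} - {i}. (mean_dunkl M H N lam k i x - mean_dunkl M H N lam k j x) / (x i - x j))" (is ?rec)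
proof -
  let ?D = "\<lambda>\<omega>. deriv (\<lambda>z. dunkl_hc H N (lam \<omega>) k i (x(i := z))) (x i)"
  let ?Q = "\<lambda>j \<omega>. (dunkl_hc H N (lam \<omega>) k i x - dunkl_hc H N (lam \<omega>) k j x) / (x i - x j)"
  have iN: "i < N" using i rN by simp
  have x': "x \<in> polydisc (r + 1) \<delta>" using x d by (rule_tac polydisc_mono) auto
  have xi: "norm (x i) < \<delta>" using polydisc_norm [OF x d] .
  note rec = dunkl_hc_recursion [OF H iN, of x, OF ne]
  have D: "integrable M ?D"
    by (rule mean_dunkl_derivative(2) [OF H dom _ x' _ _ xi]) (use rN i in auto)
  have der: "deriv (\<lambda>z. mean_dunkl M H N lam k i (x(i := z))) (x i) =
     (\<integral>\<omega>. ?D \<omega> \<partial>M)"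
    by (rule DERIV_imp_deriv, rule mean_dunkl_derivative(1) [OF H dom _ x' _ _ xi]) (use rN i in auto)
  have I: "integrable M (\<lambda>\<omega>. dunkl_hc H N (lam \<omega>) k j x)" if "j < N" for j
    by (rule dominated_integrable_all [OF H dom rN x d that])
  have Q: "integrable M (?Q j)" if "j < N" for j
    by (intro integrable_divide_zero Bochner_Integration.integrable_diff I iN that)
  have S: "integrable M (\<lambda>\<omega>. \<Sum>j\<in>{..<N} - {i}. ?Q j \<omega>)"
    by (intro Bochner_Integration.integrable_sum Q) auto
  show "integrable M (\<lambda>\<omega>. dunkl_hc H N (lam \<omega>) (Suc k) i x)"
    by (subst rec) (use D S in auto)
  have "mean_dunkl M H N lam (Suc k) i x = (\<integral>\<omega>. ?D \<omega> \<partial>M) +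
     (\<integral>\<omega>. (\<Sum>j\<in>{..<N} - {i}. ?Q j \<omega>) \<partial>M)"
    unfolding mean_dunkl_def by (subst rec) (use D S in \<open>auto intro: Bochner_Integration.integral_add\<close>)
  also have "(\<integral>\<omega>. (\<Sum>j\<in>{..<N} - {i}. ?Q j \<omega>) \<partial>M) =
     (\<Sum>j\<in>{..<N} - {i}. \<integral>\<omega>. ?Q j \<omega> \<partial>M)"
    by (intro Bochner_Integration.integral_sum Q) auto
  also have "\<dots> = (\<Sum>j\<in>{..<N} - {i}. (mean_dunkl M H N lam k i x - mean_dunkl M H N lam k j x) / (x i - x j))"
    unfolding mean_dunkl_def
    by (intro sum.cong refl) (simp add: Bochner_Integration.integral_diff [OF I [OF iN] I])
  finally show ?rec unfolding der .
qed

text \<open>The dominating function is multiplied by the constant of the step bound. Measurability is clear at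
generic points, where the recursion holds, and passes to the others by moving the coordinate \<open>x i\<close>.\<close>

lemma dominated_Suc:
  assumes H: "haar_prob_measure N H" and dom: "dominated M H N lam k (r + 1) \<delta>" and rN: "r < N"
    and d: "0 < \<delta>"
  shows "dominated M H N lam (Suc k) r (\<delta> / 2)"
proof -
  obtain W where W: "integrable M W"
     "\<And>\<omega> i x. i < r + 1 \<Longrightarrow> x \<in> polydisc (r + 1) \<delta> \<Longrightarrow> \<omega> \<in> space M \<Longrightarrow> norm (dunkl_hc H N (lam \<omega>) k i x) \<le> W \<omega>"
    using dom unfolding dominated_def by blast
  have hol: "(\<lambda>z. dunkl_hc H N l k' i (x(m := z))) holomorphic_on S" if "i < N" "m < N" for l k' i m x S
    using dunkl_hc_holomorphic(1) [OF H that] by (rule holomorphic_on_subset) auto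
  have bound: "norm (dunkl_hc H N (lam \<omega>) (Suc k) i x) \<le> 8 * real N * W \<omega> / \<delta>"
    if i: "i < r" and x: "x \<in> polydisc r (\<delta> / 2)" and \<omega>: "\<omega> \<in> space M" for i x \<omega>
  proof (rule dunkl_step_bound [where \<phi> = "dunkl_hc H N (lam \<omega>) k" and \<psi> = "dunkl_hc H N (lam \<omega>) (Suc k)" and r = r])
    show "dunkl_hc H N (lam \<omega>) k j x = dunkl_hc H N (lam \<omega>) k i (x(i := x j, j := x i))" if "i < N" "j < N" for x i j
      by (rule dunkl_hc_swap [OF H that])
    show "norm (dunkl_hc H N (lam \<omega>) k i x) \<le> W \<omega>" if "x \<in> polydisc (r + 1) \<delta>" "i \<le> r" for x i
      using that \<omega> by (intro W(2)) auto
    show "dunkl_hc H N (lam \<omega>) (Suc k) i x = deriv (\<lambda>z. dunkl_hc H N (lam \<omega>) k i (x(i := z))) (x i) +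
        (\<Sum>j\<in>{..<N} - {i}. (dunkl_hc H N (lam \<omega>) k i x - dunkl_hc H N (lam \<omega>) k j x) / (x i - x j))"
      if "x \<in> polydisc r (\<delta> / 2)" "\<And>j. j < N \<Longrightarrow> j \<noteq> i \<Longrightarrow> x j \<noteq> x i" for x
      using i rN that by (intro dunkl_hc_recursion [OF H]) auto
  qed (use i x rN d in \<open>auto intro!: hol holomorphic_on_imp_continuous_on\<close>)
  have meas: "(\<lambda>\<omega>. dunkl_hc H N (lam \<omega>) (Suc k) i x) \<in> borel_measurable M"
    if i: "i < r" and x: "x \<in> polydisc r (\<delta> / 2)" for i x
  proof -
    have iN: "i < N" using i rN by simp
    obtain \<rho> where \<rho>: "\<rho> > 0" "\<And>w. w \<in> x ` {..<N} \<Longrightarrow> w \<noteq> x i \<Longrightarrow> \<rho> \<le> dist (x i) w"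
      using finite_set_avoid [of "x ` {..<N}" "x i"] by auto
    \<comment> \<open>points close to \<open>x i\<close> but different from it avoid all other coordinates\<close>
    define \<tau> where "\<tau> = min (\<rho> / 2) (\<delta> / 2)"
    have \<tau>: "\<tau> > 0" using \<rho> d by (simp add: \<tau>_def)
    define z where "z = (\<lambda>n. x i + of_real (\<tau> / real (Suc n)))"
    have small: "norm (z n - x i) \<le> \<tau>" "z n \<noteq> x i" for n
    proof -
      have "\<tau> / real (Suc n) \<le> \<tau> / 1" using \<tau> by (intro divide_left_mono) auto
      then show "norm (z n - x i) \<le> \<tau>" using \<tau> by (simp add: z_def del: of_nat_Suc of_real_divide)
      show "z n \<noteq> x i" using \<tau> by (simp add: z_def del: of_nat_Suc of_real_divide)
    qed
    have lim: "z \<longlonglongrightarrow> x i"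
      using tendsto_add [OF tendsto_const [of "x i"] tendsto_of_real [OF LIMSEQ_Suc [OF lim_const_over_n [of \<tau>]]]]
      by (simp add: z_def [abs_def] del: of_nat_Suc of_real_divide)
    have "isCont (\<lambda>z. dunkl_hc H N (lam \<omega>) (Suc k) i (x(i := z))) (x i)" for \<omega>
      using holomorphic_on_imp_continuous_on [OF hol [OF iN iN, where S = UNIV]]
      by (simp add: continuous_on_eq_continuous_at)
    from isCont_tendsto_compose [OF this lim]
    have conv: "(\<lambda>n. dunkl_hc H N (lam \<omega>) (Suc k) i (x(i := z n))) \<longlonglongrightarrow> dunkl_hc H N (lam \<omega>) (Suc k) i x" for \<omega>
      by simp
    have "(\<lambda>\<omega>. dunkl_hc H N (lam \<omega>) (Suc k) i (x(i := z n))) \<in> borel_measurable M" for n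
    proof (rule borel_measurable_integrable, rule dominated_Suc_generic(1) [OF H dom rN d _ i])
      have "norm (z n) \<le> norm (x i) + norm (z n - x i)"
        using norm_triangle_ineq [of "x i" "z n - x i"] by simp
      also have "\<dots> < \<delta> / 2 + \<delta> / 2"
        using polydisc_norm [OF x, of i] small(1) [of n] d by (intro add_less_le_mono) (auto simp: \<tau>_def)
      finally have "norm (z n) < \<delta>" by simp
      then show "x(i := z n) \<in> polydisc r \<delta>"
        using x i d polydisc_mono [OF x, of r \<delta>] by (intro polydisc_upd) auto
      show "(x(i := z n)) j \<noteq> (x(i := z n)) i" if "j < N" "j \<noteq> i" for j
      proof (cases "x j = x i")
        case True
        then show ?thesis using small(2) [of n] that by auto
      next
        case False
        then have "\<rho> \<le> dist (x i) (x j)" using \<rho>(2) that by auto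
        moreover have "dist (x i) (z n) < \<rho>"
          using small(1) [of n] \<rho>(1) by (simp add: dist_norm norm_minus_commute \<tau>_def)
        ultimately show ?thesis using that by auto
      qed
    qed
    then show ?thesis by (rule borel_measurable_LIMSEQ_metric) (rule conv)
  qed
  have "integrable M (\<lambda>\<omega>. 8 * real N * W \<omega> / \<delta>)" using W(1) by simp
  with bound meas show ?thesis unfolding dominated_def by blast
qed

lemma dominated_of_integrable:
  assumes H: "haar_prob_measure N H" and d: "0 < \<delta>" and rN: "r + k \<le> N" and N: "0 < N"
    and int: "\<And>x. x \<in> polydisc (r + k) \<delta> \<Longrightarrow> integrable M (\<lambda>\<omega>. HC H N x (lam \<omega>))"
  shows "dominated M H N lam k r (\<delta> / 2 ^ Suc k)"
  using rN int
proof (induction k arbitrary: r)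
  case 0
  then show ?case using dominated_0 [OF H _ N d, of r M lam] by simp
next
  case (Suc k)
  have "dominated M H N lam k (r + 1) (\<delta> / 2 ^ Suc k)"
    by (rule Suc.IH) (use Suc.prems in auto)
  from dominated_Suc [OF H this] Suc.prems d show ?case by simp
qed

lemma dominated_mono:
  assumes "dominated M H N lam k r \<delta>" "\<delta>' \<le> \<delta>" "0 < \<delta>"
  shows "dominated M H N lam k r \<delta>'"
proof -
  have "x \<in> polydisc r \<delta>" if "x \<in> polydisc r \<delta>'" for x
    using polydisc_mono [OF that, of r \<delta>] assms by simp
  then show ?thesis using assms(1) unfolding dominated_def by blast
qed

section \<open>Spectra of Hermitian matrices\<close>

lemma mat_trace_mult_comm:
  fixes A B :: "complex mat"
  assumes A: "A \<in> carrier_mat n n" and B: "B \<in> carrier_mat n n"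
  shows "mat_trace (A * B) = mat_trace (B * A)"
proof -
  have "mat_trace (A * B) = (\<Sum>i<n. \<Sum>j<n. A $$ (i, j) * B $$ (j, i))"
    using A B by (auto simp: mat_trace_def scalar_prod_def lessThan_atLeast0 intro!: sum.cong)
  also have "\<dots> = (\<Sum>j<n. \<Sum>i<n. A $$ (i, j) * B $$ (j, i))" by (rule sum.swap)
  also have "\<dots> = mat_trace (B * A)"
    using A B by (auto simp: mat_trace_def scalar_prod_def lessThan_atLeast0 mult.commute intro!: sum.cong)
  finally show ?thesis .
qed

text \<open>Used with the Schur form to compute the trace of a power.\<close>

lemma upper_triangular_pow:
  fixes B :: "complex mat"
  assumes B: "B \<in> carrier_mat n n" and ut: "upper_triangular B"
  shows "upper_triangular (B ^\<^sub>m k) \<and> (\<forall>i<n. (B ^\<^sub>m k) $$ (i, i) = (B $$ (i, i)) ^ k)"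
proof (induction k)
  case 0
  then show ?case using B by auto
next
  case (Suc k)
  have C: "B ^\<^sub>m k \<in> carrier_mat n n" using B by simp
  have ix: "(B ^\<^sub>m Suc k) $$ (i, j) = (\<Sum>s<n. (B ^\<^sub>m k) $$ (i, s) * B $$ (s, j))" if "i < n" "j < n" for i j
    using that B C by (simp add: scalar_prod_def lessThan_atLeast0)
  have low: "(B ^\<^sub>m k) $$ (i, s) = 0" if "s < i" "i < n" for i s
    using Suc.IH C that by (intro upper_triangularD) auto
  have lowB: "B $$ (i, s) = 0" if "s < i" "i < n" for i s
    using ut B that by (intro upper_triangularD) auto
  have "upper_triangular (B ^\<^sub>m Suc k)"
  proof (rule upper_triangularI)
    fix i j assume ij: "j < i" "i < dim_row (B ^\<^sub>m Suc k)"
    then have "i < n" "j < n" using B C by auto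
    moreover have "(B ^\<^sub>m k) $$ (i, s) * B $$ (s, j) = 0" if "s < n" for s
      using low [of s i] lowB [of j s] ij \<open>i < n\<close> that by (cases "s < i") auto
    ultimately show "(B ^\<^sub>m Suc k) $$ (i, j) = 0"
      unfolding ix [OF \<open>i < n\<close> \<open>j < n\<close>] by (intro sum.neutral) blast
  qed
  moreover have "(B ^\<^sub>m Suc k) $$ (i, i) = (B $$ (i, i)) ^ Suc k" if i: "i < n" for i
  proof -
    have "(\<Sum>s<n. (B ^\<^sub>m k) $$ (i, s) * B $$ (s, i)) = (\<Sum>s<n. if s = i then (B ^\<^sub>m k) $$ (i, i) * B $$ (i, i) else 0)"
    proof (intro sum.cong refl)
      fix s assume "s \<in> {..<n}"
      then show "(B ^\<^sub>m k) $$ (i, s) * B $$ (s, i) = (if s = i then (B ^\<^sub>m k) $$ (i, i) * B $$ (i, i) else 0)"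
        using low [of s i] lowB [of i s] i by (cases s i rule: linorder_cases) auto
    qed
    then show ?thesis unfolding ix [OF i i] using i Suc.IH by (simp add: mult.commute)
  qed
  ultimately show ?case by auto
qed

text \<open>For an eigenvector \<open>v\<close> the number \<open>v\<^sup>* A v\<close> is real and equals the eigenvalue times \<open>v\<^sup>* v\<close>.\<close>

lemma hermitian_eigenvalue_real:
  assumes A: "hermitian_mat n A" and e: "eigenvalue A e"
  shows "e \<in> \<real>"
proof -
  have Ac: "A \<in> carrier_mat n n" and adj: "mat_adjoint A = A" using A by (auto simp: hermitian_mat_def)
  obtain v where v: "v \<in> carrier_vec n" "v \<noteq> 0\<^sub>v n" "A *\<^sub>v v = e \<cdot>\<^sub>v v"
    using e Ac by (auto simp: eigenvalue_def eigenvector_def)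
  have sym: "cnj (A $$ (j, i)) = A $$ (i, j)" if "i < n" "j < n" for i j
    using mat_adjoint_index [of i A j] adj Ac that by simp
  define S where "S = (\<Sum>i<n. \<Sum>j<n. cnj (vec_index v i) * A $$ (i, j) * vec_index v j)"
  define Q where "Q = (\<Sum>i<n. (norm (vec_index v i))\<^sup>2)"
  have row: "(\<Sum>j<n. A $$ (i, j) * vec_index v j) = e * vec_index v i" if "i < n" for i
    using arg_cong [OF v(3), of "\<lambda>w. vec_index w i"] that Ac v(1)
    by (simp add: scalar_prod_def lessThan_atLeast0)
  have "S = (\<Sum>i<n. cnj (vec_index v i) * (\<Sum>j<n. A $$ (i, j) * vec_index v j))"
    by (simp add: S_def sum_distrib_left mult_ac)
  also have "\<dots> = (\<Sum>i<n. e * (vec_index v i * cnj (vec_index v i)))"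
    by (intro sum.cong refl) (simp add: row)
  also have "\<dots> = e * of_real Q"
    by (simp only: Q_def of_real_sum complex_norm_square sum_distrib_left)
  finally have SQ: "S = e * of_real Q" .
  have "cnj S = (\<Sum>i<n. \<Sum>j<n. cnj (vec_index v j) * A $$ (j, i) * vec_index v i)"
    unfolding S_def cnj_sum
    by (intro sum.cong refl) (simp add: sym mult_ac)
  also have "\<dots> = S" unfolding S_def by (rule sum.swap)
  finally have "S \<in> \<real>" by (simp add: Reals_cnj_iff)
  obtain i where i: "i < n" "vec_index v i \<noteq> 0"
    using v(1,2) by (metis eq_vecI carrier_vecD index_zero_vec)
  have "(norm (vec_index v i))\<^sup>2 \<le> Q"
    unfolding Q_def by (rule member_le_sum) (use i in auto)
  moreover have "(norm (vec_index v i))\<^sup>2 > 0" using i by simp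
  ultimately have "Q \<noteq> 0" by linarith
  then have "e = S / of_real Q" using SQ by simp
  with \<open>S \<in> \<real>\<close> show ?thesis by (metis Reals_divide Reals_of_real)
qed

lemma proots_linear_factors:
  "proots (\<Prod>a\<leftarrow>as. [:- a, 1:]) = mset (as :: complex list)"
proof (induction as)
  case (Cons a as)
  have "(\<Prod>a\<leftarrow>as. [:- a, 1:]) \<noteq> 0" by (auto simp: prod_list_zero_iff)
  then have "proots ([:- a, 1:] * (\<Prod>a\<leftarrow>as. [:- a, 1:])) = proots [:- a, 1:] + mset as"
    using proots_mult [of "[:- a, 1:]" "\<Prod>a\<leftarrow>as. [:- a, 1:]"] Cons.IH by (simp only: pCons_eq_0_iff) simp
  also have "\<dots> = mset (a # as)" by simp
  finally show ?case by (simp only: list.map prod_list.Cons)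
qed simp

text \<open>The definite description defining the list of eigenvalues is meaningful: existence holds because the
roots are real, uniqueness because a sorted list is determined by its multiset.\<close>

lemma hermitian_char_poly:
  assumes A: "hermitian_mat n A"
  shows "sorted (eigenvalue_list A) \<and>
         char_poly A = (\<Prod>l\<leftarrow>eigenvalue_list A. [:- complex_of_real l, 1:])"
proof -
  have Ac: "A \<in> carrier_mat n n" using A by (auto simp: hermitian_mat_def)
  obtain as where as: "char_poly A = (\<Prod>a\<leftarrow>as. [:- a, 1:])"
    using char_poly_factorized [OF Ac] by auto
  have "a \<in> \<real>" if "a \<in> set as" for a
  proof -
    have "poly (char_poly A) a = 0"
      unfolding as using that by (simp add: poly_prod_list o_def prod_list_zero_iff) 
    then show ?thesis
      using eigenvalue_root_char_poly [OF Ac] hermitian_eigenvalue_real [OF A] by blast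
  qed
  then have re: "map (\<lambda>a. complex_of_real (Re a)) as = as"
    by (intro map_idI) (auto elim: Reals_cases)
  define ls where "ls = sort (map Re as)"
  have cp: "char_poly A = (\<Prod>l\<leftarrow>ls. [:- complex_of_real l, 1:])"
  proof -
    have "(\<Prod>l\<leftarrow>ls. [:- complex_of_real l, 1:]) = prod_mset (image_mset (\<lambda>l. [:- complex_of_real l, 1:]) (mset ls))"
      by (simp add: prod_mset_prod_list flip: mset_map)
    also have "mset ls = mset (map Re as)" by (simp add: ls_def)
    also have "prod_mset (image_mset (\<lambda>l. [:- complex_of_real l, 1:]) (mset (map Re as))) =
               (\<Prod>a\<leftarrow>map (\<lambda>a. complex_of_real (Re a)) as. [:- a, 1:])"
      by (simp add: o_def prod_mset_prod_list flip: mset_map)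
    finally show ?thesis by (simp only: re as)
  qed
  have "eigenvalue_list A = ls"
    unfolding eigenvalue_list_def
  proof (rule the_equality)
    show "sorted ls \<and> char_poly A = (\<Prod>l\<leftarrow>ls. [:- complex_of_real l, 1:])"
      using cp by (simp add: ls_def)
  next
    fix ls' assume ls': "sorted ls' \<and> char_poly A = (\<Prod>l\<leftarrow>ls'. [:- complex_of_real l, 1:])"
    have "proots (\<Prod>a\<leftarrow>map complex_of_real ls'. [:- a, 1:]) = proots (\<Prod>a\<leftarrow>map complex_of_real ls. [:- a, 1:])"
      using ls' cp by (simp add: o_def)
    then have "image_mset complex_of_real (mset ls') = image_mset complex_of_real (mset ls)"
      unfolding proots_linear_factors by simp
    then have "mset ls' = mset ls"
      by (rule injD [OF multiset.inj_map, rotated]) (auto intro: injI)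
    then have "sort ls = ls'" using ls' by (intro properties_for_sort) auto
    moreover have "sort ls = ls" by (intro sorted_sort_id) (simp add: ls_def)
    ultimately show "ls' = ls" by simp
  qed
  then show ?thesis using cp by (simp add: ls_def)
qed

lemma hermitian_trace_pow:
  assumes A: "hermitian_mat n A"
  shows "mat_trace (A ^\<^sub>m k) = (\<Sum>p<n. of_real (eigenvalue_list A ! p) ^ k)"
proof -
  have Ac: "A \<in> carrier_mat n n" using A by (auto simp: hermitian_mat_def)
  define es where "es = map complex_of_real (eigenvalue_list A)"
  have cp: "char_poly A = (\<Prod>e\<leftarrow>es. [:- e, 1:])"
    using hermitian_char_poly [OF A] by (simp add: es_def o_def)
  obtain B P Q where BPQ: "schur_decomposition A es = (B, P, Q)"
    by (cases "schur_decomposition A es") auto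
  from schur_decomposition [OF Ac cp BPQ]
  have sim: "similar_mat_wit A B P Q" and ut: "upper_triangular B" and diag: "diag_mat B = es" by auto
  have carr: "B \<in> carrier_mat n n" "P \<in> carrier_mat n n" "Q \<in> carrier_mat n n" and QP: "Q * P = 1\<^sub>m n"
    using similar_mat_witD2 [OF Ac sim] by auto
  have Bk: "B ^\<^sub>m k \<in> carrier_mat n n" using carr by simp
  have "A ^\<^sub>m k = P * B ^\<^sub>m k * Q"
    by (rule similar_mat_wit_pow_id [OF sim])
  then have "mat_trace (A ^\<^sub>m k) = mat_trace (Q * (P * B ^\<^sub>m k))"
    using mat_trace_mult_comm [of "P * B ^\<^sub>m k" n Q] carr Bk by auto
  also have "Q * (P * B ^\<^sub>m k) = B ^\<^sub>m k"
    using assoc_mult_mat [OF carr(3) carr(2) Bk] left_mult_one_mat [OF Bk] QP by simp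
  also have "mat_trace (B ^\<^sub>m k) = (\<Sum>p<n. (B $$ (p, p)) ^ k)"
    using upper_triangular_pow [OF carr(1) ut, of k] Bk carr(1) by (auto simp: mat_trace_def)
  also have "\<dots> = (\<Sum>p<n. of_real (eigenvalue_list A ! p) ^ k)"
  proof (intro sum.cong refl)
    fix p assume "p \<in> {..<n}"
    then have p: "p < n" by simp
    have "es ! p = B $$ (p, p)" using p carr(1) unfolding diag [symmetric] by (simp add: diag_mat_def)
    moreover have "length es = n" using carr(1) unfolding diag [symmetric] by (simp add: diag_mat_def)
    ultimately show "(B $$ (p, p)) ^ k = of_real (eigenvalue_list A ! p) ^ k"
      using p by (simp add: es_def)
  qed
  finally show ?thesis .
qed

section \<open>A coefficient formula for the shift recursion\<close>

text \<open>With \<open>T g = u * g + fps_shift 1 g\<close> and \<open>w = 1 + X * u\<close> one has \<open>X * T f = w * f - f\<^sub>0\<close>, so the constant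
disappears after differentiation. This makes the formula for arbitrary \<open>f\<close> inductive: the step from \<open>T f\<close>
to \<open>f\<close> is the product rule for \<open>f * w\<^sup>k\<^sup>+\<^sup>2\<close>, since passing from \<open>[x\<^sup>k]\<close> of a derivative to \<open>[x\<^sup>k\<^sup>+\<^sup>1]\<close>
produces the factor \<open>k + 1\<close>.\<close>

lemma fps_shift_iteration:
  fixes u f :: "'a :: field_char_0 fps"
  shows "fps_nth (((\<lambda>g. u * g + fps_shift 1 g) ^^ k) f) 0 =
         fps_nth (fps_deriv (fps_X * f) * (1 + fps_X * u) ^ (k + 1)) k / of_nat (k + 1)"
proof (induction k arbitrary: f)
  case 0
  then show ?case by (simp add: fps_mult_nth)
next
  case (Suc k)
  define T where "T = (\<lambda>g. u * g + fps_shift 1 g)"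
  define w where "w = 1 + fps_X * u"
  define n where "n = Suc k"
  have "fps_X * fps_shift 1 f = f - fps_const (fps_nth f 0)"
    by (rule fps_ext) (simp add: fps_X_mult_nth)
  then have XT: "fps_X * T f = w * f - fps_const (fps_nth f 0)"
    by (simp add: T_def w_def algebra_simps)
  \<comment> \<open>\<open>(w f)' w\<^sup>n\<close> in terms of \<open>(f w\<^sup>n\<^sup>+\<^sup>1)'\<close>, eliminating \<open>w'\<close>\<close>
  have eq1: "of_nat (n + 1) * (fps_deriv (w * f) * w ^ n) =
        fps_deriv (f * w ^ (n + 1)) + of_nat n * (fps_deriv f * w ^ (n + 1))"
  proof -
    have "fps_deriv (w ^ Suc m) = of_nat (Suc m) * fps_deriv w * w ^ m" for m
      by (induction m) (simp_all add: algebra_simps)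
    then show ?thesis by (simp add: algebra_simps)
  qed
  have nth_of_nat: "fps_nth (of_nat m * g) i = of_nat m * fps_nth g i" for m i and g :: "'a fps"
    by (simp add: fps_of_nat [symmetric])
  have "of_nat (n + 1) * fps_nth (fps_deriv (w * f) * w ^ n) k =
        of_nat n * fps_nth (f * w ^ (n + 1)) n + of_nat n * fps_nth (fps_deriv f * w ^ (n + 1)) k"
    using arg_cong [OF eq1, of "\<lambda>g. fps_nth g k"]
    unfolding nth_of_nat fps_add_nth fps_deriv_nth by (simp add: n_def)
  also have "\<dots> = of_nat n * fps_nth (fps_deriv (fps_X * f) * w ^ (n + 1)) n"
    by (simp add: n_def fps_X_mult_nth algebra_simps mult.assoc)
  finally have eq2: "of_nat (n + 1) * fps_nth (fps_deriv (w * f) * w ^ n) k =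
        of_nat n * fps_nth (fps_deriv (fps_X * f) * w ^ (n + 1)) n" .
  have "fps_nth ((T ^^ Suc k) f) 0 = fps_nth ((T ^^ k) (T f)) 0"
    by (simp add: funpow_swap1)
  also have "\<dots> = fps_nth (fps_deriv (fps_X * T f) * w ^ n) k / of_nat n"
    using Suc.IH [of "T f"] unfolding T_def w_def n_def by simp
  also have "\<dots> = fps_nth (fps_deriv (w * f) * w ^ n) k / of_nat n"
    unfolding XT by simp
  also have "\<dots> = fps_nth (fps_deriv (fps_X * f) * w ^ (n + 1)) n / of_nat (n + 1)"
  proof -
    have "(of_nat n :: 'a) \<noteq> 0" "(of_nat (n + 1) :: 'a) \<noteq> 0"
      by (simp_all add: n_def del: of_nat_Suc of_nat_add)
    with eq2 show ?thesis by (simp add: field_simps del: of_nat_Suc of_nat_add)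
  qed
  finally show ?case unfolding T_def w_def n_def by simp
qed

lemma fps_shift_iteration_one:
  fixes u :: "'a :: field_char_0 fps"
  shows "fps_nth (((\<lambda>g. u * g + fps_shift 1 g) ^^ k) 1) 0 =
         (\<Sum>m\<le>k. of_nat (k choose m) / of_nat (m + 1) * fps_nth (u ^ (k - m)) m)"
proof -
  have "fps_nth ((1 + fps_X * u) ^ (k + 1)) k =
        (\<Sum>q\<le>k+1. of_nat (k + 1 choose q) * fps_nth (fps_X ^ q * u ^ q) k)"
    by (subst add.commute, subst binomial_ring)
       (simp add: fps_sum_nth power_mult_distrib mult.assoc fps_of_nat [symmetric] del: of_nat_Suc of_nat_add binomial_Suc_Suc)
  also have "\<dots> = (\<Sum>q\<le>k. of_nat (k + 1 choose q) * fps_nth (u ^ q) (k - q))"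
    by (simp add: fps_X_power_mult_nth)
  also have "\<dots> = (\<Sum>m\<le>k. of_nat (k + 1 choose (k - m)) * fps_nth (u ^ (k - m)) m)"
    by (rule sum.reindex_bij_witness [of _ "\<lambda>m. k - m" "\<lambda>m. k - m"]) auto
  finally have eq: "fps_nth ((1 + fps_X * u) ^ (k + 1)) k =
      (\<Sum>m\<le>k. of_nat (k + 1 choose (k - m)) * fps_nth (u ^ (k - m)) m)" .
  have bin: "(of_nat (k + 1 choose (k - m)) :: 'a) / of_nat (k + 1) =
             of_nat (k choose m) / of_nat (m + 1)" if "m \<le> k" for m
  proof -
    have "(k + 1 choose (k - m)) = (k + 1 choose (m + 1))"
      using binomial_symmetric [of "m + 1" "k + 1"] that by simp
    moreover have "(m + 1) * (k + 1 choose (m + 1)) = (k + 1) * (k choose m)"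
      using Suc_times_binomial_eq [of k m] by (simp add: mult.commute)
    ultimately have "of_nat (m + 1) * (of_nat (k + 1 choose (k - m)) :: 'a) =
       of_nat (k + 1) * of_nat (k choose m)"
      by (metis of_nat_mult)
    moreover have "(of_nat (m + 1) :: 'a) \<noteq> 0" "(of_nat (k + 1) :: 'a) \<noteq> 0"
      by (simp_all del: of_nat_Suc of_nat_add)
    ultimately show ?thesis by (simp add: field_simps del: of_nat_Suc of_nat_add binomial_Suc_Suc)
  qed
  have "fps_nth (((\<lambda>g. u * g + fps_shift 1 g) ^^ k) 1) 0 =
        fps_nth ((1 + fps_X * u) ^ (k + 1)) k / of_nat (k + 1)"
    unfolding fps_shift_iteration by simp
  also have "\<dots> = (\<Sum>m\<le>k. of_nat (k + 1 choose (k - m)) / of_nat (k + 1) * fps_nth (u ^ (k - m)) m)"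
    unfolding eq by (simp add: sum_divide_distrib)
  also have "\<dots> = (\<Sum>m\<le>k. of_nat (k choose m) / of_nat (m + 1) * fps_nth (u ^ (k - m)) m)"
    by (intro sum.cong refl arg_cong2 [where f = "(*)"] bin) auto
  finally show ?thesis .
qed

lemma finite_tuples_with_sum:
  fixes p :: nat
  assumes "finite I"
  shows "finite {b \<in> I \<rightarrow>\<^sub>E UNIV. sum b I = p}"
proof (rule finite_subset)
  show "{b \<in> I \<rightarrow>\<^sub>E UNIV. sum b I = p} \<subseteq> I \<rightarrow>\<^sub>E {..p}"
    using assms by (auto simp: PiE_iff extensional_def intro: member_le_sum)
qed (use assms in \<open>auto intro: finite_PiE\<close>)

lemma fps_multinomial:
  fixes a :: "'i \<Rightarrow> 'a :: field_char_0 fps"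
  assumes "finite I"
  shows "fps_const (1 / fact p) * sum a I ^ p =
         (\<Sum>b | b \<in> I \<rightarrow>\<^sub>E UNIV \<and> sum b I = p. \<Prod>i\<in>I. fps_const (1 / fact (b i)) * a i ^ b i)"
  using assms
proof (induction I arbitrary: p rule: finite_induct)
  case empty
  show ?case by (cases "p = 0") (auto simp: PiE_empty_domain)
next
  case (insert i I)
  define T where "T = (\<lambda>I p. {b :: 'i \<Rightarrow> nat. b \<in> I \<rightarrow>\<^sub>E UNIV \<and> sum b I = p})"
  have fin: "finite (T I p)" for p
    using finite_tuples_with_sum [OF insert.hyps(1)] by (simp add: T_def)
  have bin: "(1 / fact p :: 'a) * of_nat (p choose q) = 1 / fact q * (1 / fact (p - q))" if "q \<le> p" for q
    using that by (simp add: binomial_fact)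
  have "fps_const (1 / fact p) * sum a (insert i I) ^ p =
     (\<Sum>q\<le>p. fps_const (1 / fact p) * (of_nat (p choose q) * a i ^ q * sum a I ^ (p - q)))"
    using insert.hyps by (simp add: binomial_ring sum_distrib_left)
  also have "\<dots> = (\<Sum>q\<le>p. fps_const (1 / fact q) * a i ^ q * (fps_const (1 / fact (p - q)) * sum a I ^ (p - q)))"
  proof (intro sum.cong refl)
    fix q assume "q \<in> {..p}"
    then have *: "fps_const (1 / fact p :: 'a) * of_nat (p choose q) =
       fps_const (1 / fact q) * fps_const (1 / fact (p - q))"
      using bin [of q] by (simp add: fps_of_nat [symmetric] fps_const_mult [symmetric] del: fps_const_mult)
    have "fps_const (1 / fact p) * (of_nat (p choose q) * a i ^ q * sum a I ^ (p - q)) =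
       (fps_const (1 / fact p) * of_nat (p choose q)) * (a i ^ q * sum a I ^ (p - q))"
      by (simp only: mult.assoc)
    also have "\<dots> = fps_const (1 / fact q) * a i ^ q * (fps_const (1 / fact (p - q)) * sum a I ^ (p - q))"
      unfolding * by (simp only: mult_ac)
    finally show "fps_const (1 / fact p) * (of_nat (p choose q) * a i ^ q * sum a I ^ (p - q)) =
       fps_const (1 / fact q) * a i ^ q * (fps_const (1 / fact (p - q)) * sum a I ^ (p - q))" .
  qed
  also have "\<dots> = (\<Sum>q\<le>p. \<Sum>b\<in>T I (p - q). fps_const (1 / fact q) * a i ^ q *
                  (\<Prod>l\<in>I. fps_const (1 / fact (b l)) * a l ^ b l))"
    unfolding insert.IH by (simp add: sum_distrib_left T_def)
  also have "\<dots> = (\<Sum>(q, b) \<in> Sigma {..p} (\<lambda>q. T I (p - q)). fps_const (1 / fact q) * a i ^ q *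
                  (\<Prod>l\<in>I. fps_const (1 / fact (b l)) * a l ^ b l))"
    by (rule sum.Sigma) (use fin in auto)
  also have "\<dots> = (\<Sum>b\<in>T (insert i I) p. \<Prod>l\<in>insert i I. fps_const (1 / fact (b l)) * a l ^ b l)"
  proof (rule sum.reindex_bij_witness [of _ "\<lambda>b. (b i, b(i := undefined))" "\<lambda>(q, b). b(i := q)"], goal_cases)
    case (1 z)
    then show ?case using insert.hyps by (auto simp: T_def fun_eq_iff PiE_iff extensional_def)
  next
    case (2 z)
    then obtain q b where z: "z = (q, b)" "q \<le> p" "b \<in> T I (p - q)" by auto
    have "sum (b(i := q)) I = sum b I"
      using insert.hyps by (intro sum.cong) auto
    then show ?case using z insert.hyps by (auto simp: T_def PiE_iff extensional_def)
  next
    case (3 b)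
    then show ?case by auto
  next
    case (4 b)
    have "sum (b(i := undefined)) I = sum b I"
      using insert.hyps by (intro sum.cong) auto
    then show ?case using 4 insert.hyps by (auto simp: T_def PiE_iff extensional_def)
  next
    case (5 z)
    then obtain q b where z: "z = (q, b)" by (cases z)
    have "(\<Prod>l\<in>I. fps_const (1 / fact ((b(i := q)) l)) * a l ^ (b(i := q)) l) =
          (\<Prod>l\<in>I. fps_const (1 / fact (b l)) * a l ^ b l)"
      using insert.hyps by (intro prod.cong) auto
    then show ?case using insert.hyps by (simp add: z)
  qed
  finally show ?case by (simp add: T_def)
qed

section \<open>Expansion of the coefficient formula into correction moments\<close>

text \<open>Tuples \<open>b\<close> of weight \<open>j\<close> together with \<open>m\<close> correspond to tuples indexed by \<open>{..n}\<close>: the entry at \<open>0\<close> takes the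
remaining exponent \<open>k - m - (\<Sum>i. b i)\<close> of \<open>\<Psi>' 0\<close>, and the entries above \<open>j\<close> vanish because of the weight.
The tuples with indices up to \<open>n\<close> are those of the multinomial theorem for \<open>u\<^sup>k\<^sup>-\<^sup>m\<close>.\<close>

lemma correction_moment_eq_coeff_sum:
  assumes Psi: "\<And>i. i \<le> n \<Longrightarrow> \<Psi> i analytic_on {0}" and jn: "j \<le> n"
  shows "correction_moment \<Psi> j k =
    (\<Sum>m\<le>k. \<Sum>b | b \<in> {..n} \<rightarrow>\<^sub>E UNIV \<and> sum b {..n} = k - m \<and> (\<Sum>i\<le>n. i * b i) = j.
       fact k / fact (m + 1) * (\<Prod>i\<le>n. 1 / fact (b i)) *
       fps_nth (\<Prod>i\<le>n. fps_expansion (deriv (\<Psi> i)) 0 ^ b i) m)"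
proof -
  define c where "c = (\<lambda>i. fps_expansion (deriv (\<Psi> i)) 0)"
  have c: "deriv (\<Psi> i) has_fps_expansion c i" if "i \<le> n" for i
    unfolding c_def using Psi [OF that]
    by (intro analytic_at_imp_has_fps_expansion_0 analytic_deriv)
  define S where "S = (\<lambda>b :: nat \<Rightarrow> nat. \<Sum>i=1..j. b i)"
  have S: "sum b {1..j} = S b" for b by (simp add: S_def)
  define T where "T = (\<lambda>m. {b :: nat \<Rightarrow> nat. b \<in> {..n} \<rightarrow>\<^sub>E UNIV \<and> sum b {..n} = k - m \<and> (\<Sum>i\<le>n. i * b i) = j})"
  define a where "a = (\<lambda>m b. fact k / fact (m + 1) * (\<Prod>i\<le>n. 1 / fact (b i)) * fps_nth (\<Prod>i\<le>n. c i ^ b i) m :: complex)"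
  define ext where "ext = (\<lambda>m b i. if i = 0 then k - m - S b else if i \<in> {1..j} then b i
                                   else if i \<le> n then 0 else undefined :: nat)"
  have finT: "finite (T m)" for m
    by (rule finite_subset [OF _ finite_tuples_with_sum [of "{..n}" "k - m"]]) (auto simp: T_def)
  have fin: "finite {m. m + S b \<le> k}" for b
    by (rule finite_subset [of _ "{..k}"]) auto
  have atMost_split: "{..n} = insert 0 ({1..j} \<union> {j<..n})"
    using jn by auto
  have big_zero: "b i = 0" if "b \<in> T m" "j < i" "i \<le> n" for m b i
  proof -
    have "i * b i \<le> (\<Sum>i\<le>n. i * b i)"
      by (rule member_le_sum) (use that in auto)
    also have "\<dots> = j" using that by (simp add: T_def)
    finally show ?thesis using that by (cases "b i") auto
  qed
  have head_sum: "b 0 + S b = k - m" if b: "b \<in> T m" for m b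
  proof -
    have "(\<Sum>i\<in>{1..j} \<union> {j<..n}. b i) = (\<Sum>i=1..j. b i)"
      by (subst sum.union_disjoint) (use big_zero [OF b] in auto)
    then have "sum b {..n} = b 0 + S b"
      unfolding atMost_split S_def by (subst sum.insert) auto
    then show ?thesis using b by (simp add: T_def)
  qed
  have term_eq: "fact k / (fact m * fact (m + 1) * fact (k - m - S b) * (\<Prod>i=1..j. fact (b i))) *
        (deriv ^^ m) (\<lambda>x. deriv (\<Psi> 0) x ^ (k - m - S b) * (\<Prod>i=1..j. deriv (\<Psi> i) x ^ b i)) 0 =
        a m (ext m b)" for m b
  proof -
    define D where "D = c 0 ^ (k - m - S b) * (\<Prod>i=1..j. c i ^ b i)"
    have "(\<lambda>x. deriv (\<Psi> 0) x ^ (k - m - S b) * (\<Prod>i=1..j. deriv (\<Psi> i) x ^ b i)) has_fps_expansion D"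
      unfolding D_def using jn by (intro fps_expansion_intros c) auto
    from fps_nth_fps_expansion [OF this, of m]
    have d: "(deriv ^^ m) (\<lambda>x. deriv (\<Psi> 0) x ^ (k - m - S b) * (\<Prod>i=1..j. deriv (\<Psi> i) x ^ b i)) 0 =
             fact m * fps_nth D m"
      by (simp add: field_simps)
    have split: "(\<Prod>i\<le>n. f (ext m b i) i) = f (k - m - S b) 0 * (\<Prod>i=1..j. f (b i) i)"
      if "\<And>i. f 0 i = 1" for f :: "nat \<Rightarrow> nat \<Rightarrow> 'c :: comm_monoid_mult"
    proof -
      have "(\<Prod>i\<in>{j<..n}. f (ext m b i) i) = 1"
        by (rule prod.neutral) (auto simp: ext_def that)
      moreover have "(\<Prod>i=1..j. f (ext m b i) i) = (\<Prod>i=1..j. f (b i) i)"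
        by (rule prod.cong) (auto simp: ext_def)
      ultimately have "(\<Prod>i\<in>{1..j} \<union> {j<..n}. f (ext m b i) i) = (\<Prod>i=1..j. f (b i) i)"
        by (subst prod.union_disjoint) auto
      then show ?thesis
        unfolding atMost_split by (subst prod.insert) (auto simp: ext_def)
    qed
    have A: "(\<Prod>i\<le>n. c i ^ ext m b i) = D"
      unfolding D_def by (subst split [of "\<lambda>e i. c i ^ e"]) auto
    have B: "(\<Prod>i\<le>n. 1 / fact (ext m b i) :: complex) =
       1 / (fact (k - m - S b) * (\<Prod>i=1..j. fact (b i)))"
      by (subst split [of "\<lambda>e i. 1 / fact e"]) (auto simp: prod_dividef)
    show ?thesis
      unfolding d a_def A B by simp
  qed
  have "correction_moment \<Psi> j k = (\<Sum>b\<in>weighted_tuples j. \<Sum>m | m + S b \<le> k. a m (ext m b))"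
    unfolding correction_moment_def S term_eq ..
  also have "\<dots> = (\<Sum>(b, m) \<in> Sigma (weighted_tuples j) (\<lambda>b. {m. m + S b \<le> k}). a m (ext m b))"
    by (rule sum.Sigma) (use fin finite_weighted_tuples in auto)
  also have "\<dots> = (\<Sum>(m, b) \<in> Sigma {..k} T. a m b)"
  proof (rule sum.reindex_bij_witness [of _ "\<lambda>(m, b). (restrict b {1..j}, m)" "\<lambda>(b, m). (m, ext m b)"], goal_cases)
    case (1 z)
    then obtain b m where z: "z = (b, m)" "b \<in> weighted_tuples j" by auto
    have "restrict (ext m b) {1..j} = b"
      using z(2) by (auto simp: fun_eq_iff weighted_tuples_def ext_def PiE_iff extensional_def restrict_def)
    then show ?case using z by simp
  next
    case (2 z)
    then obtain b m where z: "z = (b, m)" "b \<in> weighted_tuples j" "m + S b \<le> k" by auto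
    have split: "(\<Sum>i\<le>n. f (ext m b i) i) = f (k - m - S b) 0 + (\<Sum>i=1..j. f (b i) i)"
      if "\<And>i. f 0 i = 0" for f :: "nat \<Rightarrow> nat \<Rightarrow> nat"
    proof -
      have "(\<Sum>i\<in>{j<..n}. f (ext m b i) i) = 0"
        by (rule sum.neutral) (auto simp: ext_def that)
      moreover have "(\<Sum>i=1..j. f (ext m b i) i) = (\<Sum>i=1..j. f (b i) i)"
        by (rule sum.cong) (auto simp: ext_def)
      ultimately have "(\<Sum>i\<in>{1..j} \<union> {j<..n}. f (ext m b i) i) = (\<Sum>i=1..j. f (b i) i)"
        by (subst sum.union_disjoint) auto
      then show ?thesis
        unfolding atMost_split by (subst sum.insert) (auto simp: ext_def)
    qed
    have "sum (ext m b) {..n} = k - m"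
      using split [of "\<lambda>e i. e"] z by (simp add: S_def)
    moreover have "(\<Sum>i\<le>n. i * ext m b i) = j"
      using split [of "\<lambda>e i. i * e"] z by (simp add: weighted_tuples_def)
    moreover have "ext m b \<in> {..n} \<rightarrow>\<^sub>E UNIV"
      using jn by (auto simp: ext_def PiE_iff extensional_def)
    ultimately show ?case using z by (simp add: T_def)
  next
    case (3 z)
    then obtain b m where z: "z = (m, b)" "m \<le> k" "b \<in> T m" by auto
    note zero = big_zero [OF z(3)] and b0 = head_sum [OF z(3)]
    have S: "S (restrict b {1..j}) = S b" by (simp add: S_def)
    have "ext m (restrict b {1..j}) = b"
    proof
      fix i
      have und: "b i = undefined" if "\<not> i \<le> n"
        using z(3) that by (auto simp: T_def PiE_iff extensional_def)
      consider "i = 0" | "i \<in> {1..j}" | "j < i" "i \<le> n" | "j < i" "\<not> i \<le> n"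
        by (cases "i = 0"; cases "i \<le> j"; cases "i \<le> n") auto
      then show "ext m (restrict b {1..j}) i = b i"
      proof cases
        case 1
        have "ext m (restrict b {1..j}) 0 = k - m - S b" unfolding ext_def S by simp
        then show ?thesis using b0 1 by simp
      next
        case 2
        then show ?thesis by (simp add: ext_def)
      next
        case 3
        then show ?thesis using zero by (simp add: ext_def)
      next
        case 4
        then show ?thesis using und by (simp add: ext_def)
      qed
    qed
    then show ?case using z by simp
  next
    case (4 z)
    then obtain b m where z: "z = (m, b)" "m \<le> k" "b \<in> T m" by auto
    note zero = big_zero [OF z(3)] and b0 = head_sum [OF z(3)]
    have "(\<Sum>i\<in>{1..j} \<union> {j<..n}. i * b i) = (\<Sum>i=1..j. i * b i)"
      by (subst sum.union_disjoint) (use zero in auto)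
    then have "(\<Sum>i\<le>n. i * b i) = (\<Sum>i=1..j. i * b i)"
      unfolding atMost_split by (subst sum.insert) auto
    then have "restrict b {1..j} \<in> weighted_tuples j"
      using z(3) by (simp add: weighted_tuples_def T_def)
    moreover have "S (restrict b {1..j}) = S b" by (simp add: S_def)
    ultimately show ?case using z b0 by simp
  next
    case (5 z)
    then show ?case by auto
  qed
  also have "\<dots> = (\<Sum>m\<le>k. \<Sum>b\<in>T m. a m b)"
    by (rule sum.Sigma [symmetric]) (use finT in auto)
  finally show ?thesis by (simp add: T_def a_def c_def)
qed

text \<open>The left-hand polynomial in \<open>t\<close> has coefficients \<open>correction_moment \<Psi> j k\<close> for \<open>j \<le> n\<close>; its remaining
terms have degree above \<open>n\<close>.\<close>

lemma moment_polynomial_truncation: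
  assumes Psi: "\<And>i. i \<le> n \<Longrightarrow> \<Psi> i analytic_on {0}"
  defines "c \<equiv> \<lambda>i. fps_expansion (deriv (\<Psi> i)) 0"
  shows "\<exists>C. \<forall>t::real. 0 \<le> t \<longrightarrow> t \<le> 1 \<longrightarrow>
    norm ((\<Sum>m\<le>k. of_nat (k choose m) / of_nat (m + 1) *
             fps_nth ((\<Sum>i\<le>n. fps_const (of_real t ^ i) * c i) ^ (k - m)) m) -
          (\<Sum>j\<le>n. of_real t ^ j * correction_moment \<Psi> j k)) \<le> C * t ^ (n + 1)"
proof -
  define T where "T = (\<lambda>m. {b :: nat \<Rightarrow> nat. b \<in> {..n} \<rightarrow>\<^sub>E UNIV \<and> sum b {..n} = k - m})"
  define w where "w = (\<lambda>b :: nat \<Rightarrow> nat. \<Sum>i\<le>n. i * b i)"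
  define a where "a = (\<lambda>m b. fact k / fact (m + 1) * (\<Prod>i\<le>n. 1 / fact (b i)) * fps_nth (\<Prod>i\<le>n. c i ^ b i) m :: complex)"
  have finT: "finite (T m)" for m
    unfolding T_def by (rule finite_tuples_with_sum) auto
  have expand: "(\<Sum>m\<le>k. of_nat (k choose m) / of_nat (m + 1) *
             fps_nth ((\<Sum>i\<le>n. fps_const (t ^ i) * c i) ^ (k - m)) m) =
        (\<Sum>m\<le>k. \<Sum>b\<in>T m. t ^ w b * a m b)" for t :: complex
  proof (intro sum.cong refl)
    fix m assume "m \<in> {..k}"
    then have m: "m \<le> k" by simp
    define p where "p = k - m"
    have "fps_const (1 / fact p) * (\<Sum>i\<le>n. fps_const (t ^ i) * c i) ^ p =
       (\<Sum>b\<in>T m. \<Prod>i\<le>n. fps_const (1 / fact (b i)) * (fps_const (t ^ i) * c i) ^ b i)"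
      unfolding T_def p_def by (rule fps_multinomial) simp
    also have "\<dots> = (\<Sum>b\<in>T m. fps_const (t ^ w b * (\<Prod>i\<le>n. 1 / fact (b i))) * (\<Prod>i\<le>n. c i ^ b i))"
    proof (rule sum.cong)
      fix b assume "b \<in> T m"
      have "(\<Prod>i\<le>n. fps_const (1 / fact (b i)) * (fps_const (t ^ i) * c i) ^ b i) =
            (\<Prod>i\<le>n. fps_const (t ^ (i * b i) * (1 / fact (b i)))) * (\<Prod>i\<le>n. c i ^ b i)"
        unfolding prod.distrib [symmetric]
        by (rule prod.cong) (auto simp: power_mult_distrib power_mult fps_const_power mult_ac
              simp flip: fps_const_mult)
      also have "(\<Prod>i\<le>n. fps_const (t ^ (i * b i) * (1 / fact (b i)))) =
            fps_const (\<Prod>i\<le>n. t ^ (i * b i) * (1 / fact (b i)))"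
        by (induction n) (simp_all add: fps_const_mult)
      also have "(\<Prod>i\<le>n. t ^ (i * b i) * (1 / fact (b i))) = t ^ w b * (\<Prod>i\<le>n. 1 / fact (b i))"
        unfolding prod.distrib w_def by (simp add: power_sum)
      finally show "(\<Prod>i\<le>n. fps_const (1 / fact (b i)) * (fps_const (t ^ i) * c i) ^ b i) =
        fps_const (t ^ w b * (\<Prod>i\<le>n. 1 / fact (b i))) * (\<Prod>i\<le>n. c i ^ b i)" .
    qed auto
    finally have "fps_nth (fps_const (1 / fact p) * (\<Sum>i\<le>n. fps_const (t ^ i) * c i) ^ p) m =
       (\<Sum>b\<in>T m. t ^ w b * (\<Prod>i\<le>n. 1 / fact (b i)) * fps_nth (\<Prod>i\<le>n. c i ^ b i) m)"
      by (simp add: fps_sum_nth)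
    then have nth: "fps_nth ((\<Sum>i\<le>n. fps_const (t ^ i) * c i) ^ p) m =
       fact p * (\<Sum>b\<in>T m. t ^ w b * (\<Prod>i\<le>n. 1 / fact (b i)) * fps_nth (\<Prod>i\<le>n. c i ^ b i) m)"
      by (simp add: field_simps)
    have fct: "of_nat (k choose m) / of_nat (m + 1) * fact p = (fact k / fact (m + 1) :: complex)"
      using m by (simp add: binomial_fact p_def)
    have "of_nat (k choose m) / of_nat (m + 1) * fps_nth ((\<Sum>i\<le>n. fps_const (t ^ i) * c i) ^ (k - m)) m =
      (of_nat (k choose m) / of_nat (m + 1) * fact p) *
      (\<Sum>b\<in>T m. t ^ w b * (\<Prod>i\<le>n. 1 / fact (b i)) * fps_nth (\<Prod>i\<le>n. c i ^ b i) m)"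
      unfolding p_def [symmetric] nth by (simp only: mult.assoc)
    also have "\<dots> = (\<Sum>b\<in>T m. t ^ w b * a m b)"
      unfolding fct a_def sum_distrib_left by (intro sum.cong refl) (simp only: mult_ac)
    finally show "of_nat (k choose m) / of_nat (m + 1) *
        fps_nth ((\<Sum>i\<le>n. fps_const (t ^ i) * c i) ^ (k - m)) m = (\<Sum>b\<in>T m. t ^ w b * a m b)" .
  qed
  have moments: "(\<Sum>j\<le>n. t ^ j * correction_moment \<Psi> j k) =
        (\<Sum>m\<le>k. \<Sum>b\<in>{b \<in> T m. w b \<le> n}. t ^ w b * a m b)" for t :: complex
  proof -
    have "(\<Sum>j\<le>n. t ^ j * correction_moment \<Psi> j k) =
        (\<Sum>j\<le>n. \<Sum>m\<le>k. \<Sum>b\<in>{b \<in> T m. w b = j}. t ^ w b * a m b)"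
    proof (intro sum.cong refl)
      fix j assume "j \<in> {..n}"
      then have "j \<le> n" by simp
      show "t ^ j * correction_moment \<Psi> j k = (\<Sum>m\<le>k. \<Sum>b\<in>{b \<in> T m. w b = j}. t ^ w b * a m b)"
        unfolding correction_moment_eq_coeff_sum [where \<Psi> = \<Psi>, OF Psi \<open>j \<le> n\<close>, simplified]
        by (simp add: sum_distrib_left T_def w_def a_def c_def conj_assoc)
    qed
    also have "\<dots> = (\<Sum>m\<le>k. \<Sum>j\<le>n. \<Sum>b\<in>{b \<in> T m. w b = j}. t ^ w b * a m b)"
      by (rule sum.swap)
    also have "\<dots> = (\<Sum>m\<le>k. \<Sum>b\<in>{b \<in> T m. w b \<le> n}. t ^ w b * a m b)"
    proof (intro sum.cong refl)
      fix m
      have "(\<Sum>j\<le>n. \<Sum>b\<in>{b \<in> {b \<in> T m. w b \<le> n}. w b = j}. t ^ w b * a m b) =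
            (\<Sum>b\<in>{b \<in> T m. w b \<le> n}. t ^ w b * a m b)"
        by (rule sum.group) (use finT in auto)
      moreover have "(\<Sum>j\<le>n. \<Sum>b\<in>{b \<in> {b \<in> T m. w b \<le> n}. w b = j}. t ^ w b * a m b) =
            (\<Sum>j\<le>n. \<Sum>b\<in>{b \<in> T m. w b = j}. t ^ w b * a m b)"
        by (intro sum.cong) auto
      ultimately show "(\<Sum>j\<le>n. \<Sum>b\<in>{b \<in> T m. w b = j}. t ^ w b * a m b) =
            (\<Sum>b\<in>{b \<in> T m. w b \<le> n}. t ^ w b * a m b)" by simp
    qed
    finally show ?thesis .
  qed
  define C where "C = (\<Sum>m\<le>k. \<Sum>b\<in>{b \<in> T m. w b > n}. norm (a m b))"
  show ?thesis
  proof (intro exI allI impI)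
    fix t :: real assume t: "0 \<le> t" "t \<le> 1"
    have "(\<Sum>m\<le>k. \<Sum>b\<in>T m. of_real t ^ w b * a m b) -
          (\<Sum>m\<le>k. \<Sum>b\<in>{b \<in> T m. w b \<le> n}. of_real t ^ w b * a m b) =
          (\<Sum>m\<le>k. \<Sum>b\<in>{b \<in> T m. w b > n}. of_real t ^ w b * a m b)"
      unfolding sum_subtractf [symmetric]
    proof (intro sum.cong refl)
      fix m
      have "{b \<in> T m. w b > n} = T m - {b \<in> T m. w b \<le> n}" by auto
      then show "(\<Sum>b\<in>T m. of_real t ^ w b * a m b) - (\<Sum>b\<in>{b \<in> T m. w b \<le> n}. of_real t ^ w b * a m b) =
                 (\<Sum>b\<in>{b \<in> T m. w b > n}. of_real t ^ w b * a m b)"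
        using finT by (simp add: sum_diff)
    qed
    also have "norm \<dots> \<le> (\<Sum>m\<le>k. \<Sum>b\<in>{b \<in> T m. w b > n}. t ^ (n + 1) * norm (a m b))"
    proof (intro order.trans [OF norm_sum] sum_mono)
      fix m b assume "b \<in> {b \<in> T m. w b > n}"
      then have "t ^ w b \<le> t ^ (n + 1)"
        using t by (intro power_decreasing) auto
      then show "norm (of_real t ^ w b * a m b) \<le> t ^ (n + 1) * norm (a m b)"
        using t by (simp add: norm_mult norm_power mult_right_mono)
    qed
    also have "\<dots> = C * t ^ (n + 1)"
      by (simp add: C_def sum_distrib_left mult.commute)
    finally show "norm ((\<Sum>m\<le>k. of_nat (k choose m) / of_nat (m + 1) *
             fps_nth ((\<Sum>i\<le>n. fps_const (of_real t ^ i) * c i) ^ (k - m)) m) -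
          (\<Sum>j\<le>n. of_real t ^ j * correction_moment \<Psi> j k)) \<le> C * t ^ (n + 1)"
      unfolding expand moments .
  qed
qed

section \<open>The one-variable limit of the recursion\<close>

definition back_quotient :: "(complex \<Rightarrow> complex) \<Rightarrow> complex \<Rightarrow> complex" where
  "back_quotient f x = (if x = 0 then deriv f 0 else (f x - f 0) / x)"

text \<open>The function \<open>f k\<close> of the introduction.\<close>

primrec lim_fun :: "(complex \<Rightarrow> complex) \<Rightarrow> nat \<Rightarrow> complex \<Rightarrow> complex" where
  "lim_fun u 0 = (\<lambda>x. 1)"
| "lim_fun u (Suc k) = (\<lambda>x. u x * lim_fun u k x + back_quotient (lim_fun u k) x)"

lemma back_quotient_holomorphic:
  assumes "f holomorphic_on ball 0 \<delta>" "0 < \<delta>"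
  shows "back_quotient f holomorphic_on ball 0 \<delta>"
proof -
  have "(\<lambda>z. if z = 0 then deriv f 0 else (f z - f 0) / (z - 0)) holomorphic_on ball 0 \<delta>"
    by (rule pole_lemma_open) (use assms in auto)
  also have "(\<lambda>z. if z = 0 then deriv f 0 else (f z - f 0) / (z - 0)) = back_quotient f"
    by (simp add: fun_eq_iff back_quotient_def)
  finally show ?thesis .
qed

lemma norm_back_quotient:
  assumes hol: "f holomorphic_on ball 0 \<delta>" and bnd: "\<And>z. z \<in> ball 0 \<delta> \<Longrightarrow> norm (f z) \<le> K"
    and d: "0 < \<delta>" and z: "z \<in> ball 0 (\<delta> / 2)"
  shows "norm (back_quotient f z) \<le> 4 * K / \<delta>"
proof (cases "z = 0")
  case True
  then show ?thesis
    using cauchy_deriv_bound [OF hol bnd d, of 0] d by (simp add: back_quotient_def)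
next
  case False
  have "norm (f z - f 0) \<le> 4 * K / \<delta> * norm (z - 0)"
    by (rule cauchy_lipschitz [OF hol bnd d z]) (use d in auto)
  then show ?thesis
    using False by (simp add: back_quotient_def norm_divide divide_le_eq)
qed

text \<open>The radius and the bound must not depend on \<open>u\<close>, because \<open>u\<close> varies with \<open>N\<close>.\<close>

lemma lim_fun_holomorphic_bounded:
  fixes F :: "(complex \<Rightarrow> complex) set"
  assumes d: "0 < \<delta>" and F: "\<And>u. u \<in> F \<Longrightarrow> u holomorphic_on ball 0 \<delta>"
    and bnd: "\<And>u z. u \<in> F \<Longrightarrow> z \<in> ball 0 \<delta> \<Longrightarrow> norm (u z) \<le> K" and K: "0 \<le> K"
  shows "\<exists>\<delta>' K'. 0 < \<delta>' \<and> \<delta>' \<le> \<delta> \<and> 0 \<le> K' \<and>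
     (\<forall>u\<in>F. lim_fun u k holomorphic_on ball 0 \<delta>' \<and> (\<forall>z\<in>ball 0 \<delta>'. norm (lim_fun u k z) \<le> K'))"
proof (induction k)
  case 0
  show ?case by (intro exI [of _ \<delta>] exI [of _ 1]) (use d in auto)
next
  case (Suc k)
  then obtain \<delta>' K' where IH: "0 < \<delta>'" "\<delta>' \<le> \<delta>" "0 \<le> K'"
    and hol: "\<And>u. u \<in> F \<Longrightarrow> lim_fun u k holomorphic_on ball 0 \<delta>'"
    and b: "\<And>u z. u \<in> F \<Longrightarrow> z \<in> ball 0 \<delta>' \<Longrightarrow> norm (lim_fun u k z) \<le> K'" by blast
  have "lim_fun u (Suc k) holomorphic_on ball 0 (\<delta>' / 2)" if u: "u \<in> F" for u
    unfolding lim_fun.simps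
  proof (intro holomorphic_intros)
    show "u holomorphic_on ball 0 (\<delta>' / 2)"
      by (rule holomorphic_on_subset [OF F [OF u]]) (use IH in auto)
    show "lim_fun u k holomorphic_on ball 0 (\<delta>' / 2)"
      by (rule holomorphic_on_subset [OF hol [OF u]]) (use IH in auto)
    show "back_quotient (lim_fun u k) holomorphic_on ball 0 (\<delta>' / 2)"
      by (rule holomorphic_on_subset [OF back_quotient_holomorphic [OF hol [OF u] IH(1)]]) (use IH in auto)
  qed
  moreover have "norm (lim_fun u (Suc k) z) \<le> K * K' + 4 * K' / \<delta>'" if u: "u \<in> F" and z: "z \<in> ball 0 (\<delta>' / 2)" for u z
  proof -
    have z': "z \<in> ball 0 \<delta>'" "z \<in> ball 0 \<delta>" using z IH by auto
    have "norm (u z * lim_fun u k z) \<le> K * K'"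
      unfolding norm_mult using bnd [OF u z'(2)] b [OF u z'(1)] K by (intro mult_mono) auto
    moreover have "norm (back_quotient (lim_fun u k) z) \<le> 4 * K' / \<delta>'"
      by (rule norm_back_quotient [OF hol [OF u] b [OF u] IH(1) z])
    ultimately show ?thesis unfolding lim_fun.simps by (rule norm_triangle_mono)
  qed
  ultimately show ?case
    using IH K by (intro exI [of _ "\<delta>' / 2"] exI [of _ "K * K' + 4 * K' / \<delta>'"]) auto
qed

text \<open>On expansions at \<open>0\<close> the quotient \<open>back_quotient\<close> is the shift of power series.\<close>

lemma lim_fun_at_0:
  assumes u: "u has_fps_expansion U"
  shows "lim_fun u k 0 = (\<Sum>m\<le>k. of_nat (k choose m) / of_nat (m + 1) * fps_nth (U ^ (k - m)) m)"
proof -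
  have "lim_fun u k has_fps_expansion ((\<lambda>g. U * g + fps_shift 1 g) ^^ k) 1"
  proof (induction k)
    case (Suc k)
    define G where "G = ((\<lambda>g. U * g + fps_shift 1 g) ^^ k) 1"
    have G: "lim_fun u k has_fps_expansion G" using Suc by (simp add: G_def)
    obtain A where A: "open A" "0 \<in> A" "lim_fun u k holomorphic_on A"
      by (rule has_fps_expansion_imp_holomorphic [OF G])
    then obtain \<rho> where \<rho>: "\<rho> > 0" "ball 0 \<rho> \<subseteq> A" by (auto simp: open_contains_ball)
    have "back_quotient (lim_fun u k) holomorphic_on ball 0 \<rho>"
      using A(3) \<rho> by (intro back_quotient_holomorphic) (auto intro: holomorphic_on_subset)
    then obtain B where B: "back_quotient (lim_fun u k) has_fps_expansion B"
      using \<rho>(1) has_fps_expansion_fps_expansion [of "ball 0 \<rho>"] by auto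
    have "(\<lambda>x. x * back_quotient (lim_fun u k) x + lim_fun u k 0) has_fps_expansion
            fps_X * B + fps_const (lim_fun u k 0)"
      by (intro fps_expansion_intros B)
    moreover have "(\<lambda>x. x * back_quotient (lim_fun u k) x + lim_fun u k 0) = lim_fun u k"
      by (simp add: fun_eq_iff back_quotient_def)
    ultimately have "lim_fun u k has_fps_expansion fps_X * B + fps_const (lim_fun u k 0)"
      by (simp only:)
    from fps_expansion_unique_complex [OF G this]
    have eq: "G = fps_X * B + fps_const (lim_fun u k 0)" .
    have "fps_shift 1 G = B" by (rule fps_ext) (subst eq, simp)
    with B have "back_quotient (lim_fun u k) has_fps_expansion fps_shift 1 G" by simp
    then have "lim_fun u (Suc k) has_fps_expansion U * G + fps_shift 1 G"
      unfolding lim_fun.simps by (intro fps_expansion_intros u G)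
    then show ?case by (simp add: G_def)
  qed simp
  from has_fps_expansion_imp_0_eq_fps_nth_0 [OF this] show ?thesis
    unfolding fps_shift_iteration_one .
qed

text \<open>One step of the normalised recursion, for \<open>h\<close> close to \<open>f\<close> and a logarithmic derivative \<open>v\<close> close to \<open>u\<close>.
Writing \<open>\<rho> = h - f\<close>, the divided differences split: those of \<open>\<rho>\<close> are small by the Lipschitz estimate,
while those of \<open>f\<close> are equal to \<open>back_quotient f\<close> for the \<open>N - r\<close> vanishing coordinates and bounded for the
others, so their average differs from \<open>back_quotient f\<close> by \<open>O(1 / N)\<close>.\<close>

lemma dunkl_step_approximation:
  fixes h h' :: "nat \<Rightarrow> (nat \<Rightarrow> complex) \<Rightarrow> complex" and f u :: "complex \<Rightarrow> complex"
  assumes sym: "\<And>x i j. i < N \<Longrightarrow> j < N \<Longrightarrow> h j x = h i (x(i := x j, j := x i))"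
    and hol: "\<And>x i l. x \<in> polydisc (r + 1) \<delta> \<Longrightarrow> i \<le> r \<Longrightarrow> l \<le> r \<Longrightarrow>
                 (\<lambda>z. h i (x(l := z))) holomorphic_on ball 0 \<delta>"
    and f: "f holomorphic_on ball 0 \<delta>" "\<And>z. z \<in> ball 0 \<delta> \<Longrightarrow> norm (f z) \<le> K"
    and err: "\<And>x i. x \<in> polydisc (r + 1) \<delta> \<Longrightarrow> i \<le> r \<Longrightarrow> norm (h i x - f (x i)) \<le> \<eta>"
    and u: "\<And>z. z \<in> ball 0 \<delta> \<Longrightarrow> norm (u z) \<le> K"
    and v: "\<And>x. x \<in> polydisc r (\<delta> / 2) \<Longrightarrow> norm (v x - u (x i)) \<le> \<eta>'"
    and rN: "r < N" and d: "0 < \<delta>" and x: "x \<in> polydisc r (\<delta> / 2)" and i: "i < r"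
    and rec: "\<And>x. x \<in> polydisc r (\<delta> / 2) \<Longrightarrow> (\<And>j. j < N \<Longrightarrow> j \<noteq> i \<Longrightarrow> x j \<noteq> x i) \<Longrightarrow>
       h' i x = v x * h i x + deriv (\<lambda>z. h i (x(i := z))) (x i) / of_nat N +
                 (\<Sum>j\<in>{..<N} - {i}. (h i x - h j x) / (x i - x j)) / of_nat N"
    and cont: "continuous_on (ball 0 (\<delta> / 2)) (\<lambda>z. h' i (x(i := z)) - (u z * f z + back_quotient f z))"
  shows "norm (h' i x - (u (x i) * f (x i) + back_quotient f (x i))) \<le>
    K * \<eta> + \<eta>' * (K + \<eta>) + 8 * \<eta> / \<delta> + (4 * (K + \<eta>) / \<delta> + 8 * real r * K / \<delta>) / real N"
    (is "_ \<le> ?B")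
proof -
  have z0: "(\<lambda>_. 0) \<in> polydisc s \<rho>" if "\<rho> > 0" for s \<rho> using that by (simp add: polydisc_def)
  have K0: "0 \<le> K" using f(2) [of 0] d by (intro order.trans [OF norm_ge_zero]) auto
  have \<eta>0: "0 \<le> \<eta>" using err [OF z0, of 0] d by (intro order.trans [OF norm_ge_zero]) auto
  have \<eta>'0: "0 \<le> \<eta>'" using v [OF z0] d by (intro order.trans [OF norm_ge_zero]) auto
  have N: "real N > 0" using rN by simp
  have "norm (h' i (x(i := x i)) - (u (x i) * f (x i) + back_quotient f (x i))) \<le> ?B"
  proof (rule norm_le_off_finite [OF cont, of "x ` {..<N}"])
    show "x i \<in> ball 0 (\<delta> / 2)" using polydisc_norm [OF x, of i] d by simp
  next
    fix z assume z: "z \<in> ball 0 (\<delta> / 2) - x ` {..<N}"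
    define y where "y = x(i := z)"
    have y: "y \<in> polydisc r (\<delta> / 2)" using x z i unfolding y_def by (intro polydisc_upd) auto
    have y': "y \<in> polydisc (r + 1) \<delta>" using y d by (rule_tac polydisc_mono) auto
    have yi: "y i = z" by (simp add: y_def)
    have ne: "y j \<noteq> y i" if "j < N" "j \<noteq> i" for j
      using z that by (auto simp: y_def)
    have yz: "y j = 0" if "r \<le> j" for j using y that by (simp add: polydisc_def)
    have yb: "y j \<in> ball 0 (\<delta> / 2)" "y j \<in> ball 0 \<delta>" for j
      using polydisc_norm [OF y, of j] d by auto
    have z_ne: "z \<noteq> 0" using ne [of r] rN i yz [of r] yi by auto
    define \<rho> where "\<rho> = (\<lambda>j y. h j y - f (y j))"
    have ratio: "norm (a / (y i - y j)) \<le> B" if "norm a \<le> B * norm (y i - y j)" "j < N" "j \<noteq> i" for a B j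
    proof -
      have "norm (y i - y j) > 0" using ne [of j] that by auto
      then show ?thesis using that by (simp add: norm_divide divide_le_eq)
    qed
    have \<rho>lip: "norm ((\<rho> i y - \<rho> j y) / (y i - y j)) \<le> 8 * \<eta> / \<delta>" if j: "j < N" "j \<noteq> i" for j
    proof (rule ratio [OF _ j], rule symmetric_family_lipschitz [where r = r and N = N])
      show "\<rho> j x = \<rho> i (x(i := x j, j := x i))" if "i < N" "j < N" for x i j
        using sym [OF that, of x] by (auto simp: \<rho>_def)
      show "(\<lambda>z. \<rho> i (x(l := z))) holomorphic_on ball 0 \<delta>"
        if "x \<in> polydisc (r + 1) \<delta>" "i \<le> r" "l \<le> r" for x i l
      proof -
        have "(\<lambda>z. f ((x(l := z)) i)) holomorphic_on ball 0 \<delta>"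
        proof (cases "l = i")
          case True
          then show ?thesis using f(1) by simp
        next
          case False
          then show ?thesis by (simp add: holomorphic_on_const)
        qed
        then show ?thesis unfolding \<rho>_def by (intro holomorphic_on_diff hol that)
      qed
      show "norm (\<rho> i x) \<le> \<eta>" if "x \<in> polydisc (r + 1) \<delta>" "i \<le> r" for x i
        unfolding \<rho>_def by (rule err [OF that])
    qed (use rN d y i j in auto)
    have flip: "norm ((f (y i) - f (y j)) / (y i - y j)) \<le> 4 * K / \<delta>" if j: "j < N" "j \<noteq> i" for j
      by (rule ratio [OF _ j], rule cauchy_lipschitz [OF f d]) (use yb in auto)
    define S where "S = back_quotient f z"
    have Sb: "norm S \<le> 4 * K / \<delta>"
      unfolding S_def using norm_back_quotient [OF f d] yb(1) [of i] yi by simp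
    have S: "(f (y i) - f (y j)) / (y i - y j) = S" if "r \<le> j" for j
      using z_ne by (simp add: S_def back_quotient_def yz [OF that] yi)
    have hb: "norm (h i y) \<le> K + \<eta>"
      using norm_triangle_ineq [of "h i y - f (y i)" "f (y i)"] err [OF y', of i] f(2) [OF yb(2), of i] i by simp
    have der: "norm (deriv (\<lambda>z. h i (y(i := z))) (y i)) \<le> 4 * (K + \<eta>) / \<delta>"
    proof (rule cauchy_deriv_bound [OF _ _ d yb(1)])
      show "(\<lambda>z. h i (y(i := z))) holomorphic_on ball 0 \<delta>" using i by (intro hol y') auto
      fix w :: complex assume w: "w \<in> ball 0 \<delta>"
      have "y(i := w) \<in> polydisc (r + 1) \<delta>" using w i by (intro polydisc_upd y') auto
      from err [OF this, of i] show "norm (h i (y(i := w))) \<le> K + \<eta>"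
        using norm_triangle_ineq [of "h i (y(i := w)) - f w" "f w"] f(2) [OF w] i by simp
    qed
    \<comment> \<open>\<open>X\<close> collects the nonzero coordinates, the remaining \<open>N - r\<close> terms are all equal to \<open>S\<close>\<close>
    define X where "X = (\<Sum>j\<in>{..<r} - {i}. (f (y i) - f (y j)) / (y i - y j))"
    have split: "{..<N} - {i} = ({..<r} - {i}) \<union> {r..<N}" using rN i by auto
    have fsum: "(\<Sum>j\<in>{..<N} - {i}. (f (y i) - f (y j)) / (y i - y j)) = X + of_nat (N - r) * S"
      unfolding split X_def by (subst sum.union_disjoint) (auto simp: S)
    define R where "R = (\<Sum>j\<in>{..<N} - {i}. (\<rho> i y - \<rho> j y) / (y i - y j))"
    have "(\<Sum>j\<in>{..<N} - {i}. (h i y - h j y) / (y i - y j)) = X + of_nat (N - r) * S + R"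
      unfolding fsum [symmetric] R_def sum.distrib [symmetric]
      by (intro sum.cong refl) (simp add: \<rho>_def diff_divide_distrib)
    then have sumN: "(\<Sum>j\<in>{..<N} - {i}. (h i y - h j y) / (y i - y j)) / of_nat N - S =
       X / of_nat N - of_nat r * S / of_nat N + R / of_nat N"
      using N rN by (simp add: of_nat_diff field_simps)
    define D where "D = deriv (\<lambda>z. h i (y(i := z))) (y i)"
    have "h' i y - (u z * f z + S) = u z * (h i y - f z) + (v y - u z) * h i y + D / of_nat N +
      (X / of_nat N - of_nat r * S / of_nat N + R / of_nat N)"
      unfolding sumN [symmetric] D_def using rec [OF y ne] by (simp add: algebra_simps)
    also have "norm \<dots> \<le> norm (u z * (h i y - f z)) + norm ((v y - u z) * h i y) + norm (D / of_nat N) +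
      (norm (X / of_nat N) + norm (of_nat r * S / of_nat N) + norm (R / of_nat N))"
      by (intro order.trans [OF norm_triangle_ineq] add_mono norm_triangle_ineq4 order_refl)
    also have "\<dots> \<le> K * \<eta> + \<eta>' * (K + \<eta>) + (4 * (K + \<eta>) / \<delta>) / real N +
      ((real r * (4 * K / \<delta>)) / real N + (real r * (4 * K / \<delta>)) / real N + 8 * \<eta> / \<delta>)"
    proof (intro add_mono)
      show "norm (u z * (h i y - f z)) \<le> K * \<eta>"
        unfolding norm_mult using u [OF yb(2), of i] err [OF y', of i] K0 i yi by (intro mult_mono) auto
      show "norm ((v y - u z) * h i y) \<le> \<eta>' * (K + \<eta>)"
        unfolding norm_mult using v [OF y] hb \<eta>'0 yi by (intro mult_mono) auto
      show "norm (D / of_nat N) \<le> (4 * (K + \<eta>) / \<delta>) / real N"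
        unfolding norm_divide norm_of_nat D_def by (rule divide_right_mono [OF der]) simp
      have "norm X \<le> (\<Sum>j\<in>{..<r} - {i}. 4 * K / \<delta>)"
        unfolding X_def using rN by (intro order.trans [OF norm_sum] sum_mono flip) auto
      also have "\<dots> \<le> real r * (4 * K / \<delta>)"
        using i K0 d by (simp add: of_nat_diff field_simps)
      finally show "norm (X / of_nat N) \<le> (real r * (4 * K / \<delta>)) / real N"
        unfolding norm_divide norm_of_nat by (rule divide_right_mono) simp
      show "norm (of_nat r * S / of_nat N) \<le> (real r * (4 * K / \<delta>)) / real N"
        unfolding norm_divide norm_mult norm_of_nat by (intro divide_right_mono mult_left_mono Sb) auto
      have "norm R \<le> (\<Sum>j\<in>{..<N} - {i}. 8 * \<eta> / \<delta>)"
        unfolding R_def by (intro order.trans [OF norm_sum] sum_mono \<rho>lip) auto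
      also have "\<dots> \<le> real N * (8 * \<eta> / \<delta>)"
        using i rN \<eta>0 d by (simp add: of_nat_diff field_simps)
      finally show "norm (R / of_nat N) \<le> 8 * \<eta> / \<delta>"
        using N by (simp add: norm_divide divide_le_eq mult.commute)
    qed
    also have "\<dots> = ?B" by (simp add: add_divide_distrib)
    finally show "norm (h' i (x(i := z)) - (u z * f z + back_quotient f z)) \<le> ?B"
      by (simp add: y_def S_def)
  qed auto
  then show ?thesis by simp
qed

section \<open>Propagating the expansion of the logarithm\<close>

text \<open>The random matrices are represented by their spectra \<open>lam N \<omega>\<close>, on which the Harish-Chandra integral and
the traces of powers depend.\<close>

locale hc_expansion =
  fixes n :: nat and \<epsilon> :: real and H :: "nat \<Rightarrow> complex mat measure" and P :: "nat \<Rightarrow> 'a measure"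
    and lam :: "nat \<Rightarrow> 'a \<Rightarrow> nat \<Rightarrow> real" and \<Psi> :: "nat \<Rightarrow> complex \<Rightarrow> complex"
  assumes eps: "0 < \<epsilon>" "real n * \<epsilon> < 1"
    and haar: "\<And>N. N \<ge> 1 \<Longrightarrow> haar_prob_measure N (H N)"
    and Psi: "\<And>j. j \<le> n \<Longrightarrow> \<Psi> j analytic_on {0}"
    and conv: "\<And>r. r \<ge> 1 \<Longrightarrow>
      \<exists>\<delta>>0. \<exists>L :: nat \<Rightarrow> (nat \<Rightarrow> complex) \<Rightarrow> complex.
        (\<forall>\<^sub>F N in sequentially.
           (\<forall>x\<in>polydisc r \<delta>. integrable (P N) (\<lambda>\<omega>. HC (H N) N x (lam N \<omega>))) \<and>
           log_branch_on (polydisc r \<delta>) (\<lambda>x. \<integral>\<omega>. HC (H N) N x (lam N \<omega>) \<partial>P N) (L N)) \<and>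
        uniform_limit (polydisc r \<delta>)
          (\<lambda>N x. of_real (real N powr (real n * \<epsilon>)) *
             (1 / of_nat N * L N x -
              (\<Sum>j<n. \<Sum>i<r. 1 / of_real (real N powr (real j * \<epsilon>)) * \<Psi> j (x i))))
          (\<lambda>x. \<Sum>i<r. \<Psi> n (x i)) sequentially"
begin

text \<open>The expansion parameter: all errors are measured in powers of it.\<close>

definition scale :: "nat \<Rightarrow> real" where "scale N = real N powr (- \<epsilon>)"

text \<open>The derivative of the expansion of \<open>log E [HC] / N\<close> in one coordinate.\<close>

definition slope :: "nat \<Rightarrow> complex \<Rightarrow> complex" where
  "slope N z = (\<Sum>j\<le>n. of_real (scale N) ^ j * deriv (\<Psi> j) z)"

definition mean_at :: "nat \<Rightarrow> nat \<Rightarrow> nat \<Rightarrow> (nat \<Rightarrow> complex) \<Rightarrow> complex" where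
  "mean_at N = mean_dunkl (P N) (H N) N (lam N)"

text \<open>This is the quantity with a limit: at \<open>x = 0\<close> it is \<open>E [Tr A\<^sup>k] / N\<^sup>k\<^sup>+\<^sup>1\<close>, and near \<open>0\<close> it depends
asymptotically on \<open>x i\<close> alone.\<close>

definition normalized_mean :: "nat \<Rightarrow> nat \<Rightarrow> nat \<Rightarrow> (nat \<Rightarrow> complex) \<Rightarrow> complex" where
  "normalized_mean N k i x = mean_at N k i x / (of_nat N ^ k * mean_at N 0 i x)"

lemma scale_pos: "N \<ge> 1 \<Longrightarrow> 0 < scale N" by (simp add: scale_def)

lemma scale_le_1: "N \<ge> 1 \<Longrightarrow> scale N \<le> 1"
  unfolding scale_def using eps powr_mono [of "- \<epsilon>" 0 "real N"] by simp

lemma scale_power: "N \<ge> 1 \<Longrightarrow> scale N ^ j = 1 / real N powr (real j * \<epsilon>)"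
  by (simp add: scale_def powr_power powr_minus_divide mult.commute flip: powr_minus_divide)

lemma powr_eq_scale:
  assumes "N \<ge> 1"
  shows "of_real (real N powr (real j * \<epsilon>)) = 1 / (of_real (scale N) ^ j :: complex)"
proof -
  have "real N powr (real j * \<epsilon>) = 1 / scale N ^ j" by (simp add: scale_power [OF assms])
  then show ?thesis by simp
qed

lemma mean_at_0: "N \<ge> 1 \<Longrightarrow> i < N \<Longrightarrow> mean_at N 0 i x = (\<integral>\<omega>. HC (H N) N x (lam N \<omega>) \<partial>P N)"
  unfolding mean_at_def mean_dunkl_def using HC_eq_dunkl_hc [OF haar] by simp

lemma mean_at_swap: "N \<ge> 1 \<Longrightarrow> i < N \<Longrightarrow> j < N \<Longrightarrow> mean_at N k j x = mean_at N k i (x(i := x j, j := x i))"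
  unfolding mean_at_def by (rule mean_dunkl_swap [OF haar])

lemma normalized_mean_swap: "N \<ge> 1 \<Longrightarrow> i < N \<Longrightarrow> j < N \<Longrightarrow> normalized_mean N k j x = normalized_mean N k i (x(i := x j, j := x i))"
  unfolding normalized_mean_def using mean_at_swap by metis

text \<open>The hypothesis in the form used below: the leading coefficient \<open>\<Psi> n\<close> is absorbed into the expansion, and
uniform convergence becomes an error \<open>o(t\<^sup>n)\<close>.\<close>

lemma log_expansion:
  assumes r: "r \<ge> 1"
  obtains \<delta> L where "0 < \<delta>"
    "\<forall>\<^sub>F N in sequentially. \<forall>x\<in>polydisc r \<delta>. integrable (P N) (\<lambda>\<omega>. HC (H N) N x (lam N \<omega>))"
    "\<forall>\<^sub>F N in sequentially. continuous_on (polydisc r \<delta>) (L N) \<and> L N (\<lambda>_. 0) = 0 \<and>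
        (\<forall>i<r. \<forall>x\<in>polydisc r \<delta>. exp (L N x) = mean_at N 0 i x)"
    "\<And>e. 0 < e \<Longrightarrow> \<forall>\<^sub>F N in sequentially. \<forall>x\<in>polydisc r \<delta>.
        norm (L N x / of_nat N - (\<Sum>i<r. \<Sum>j\<le>n. of_real (scale N) ^ j * \<Psi> j (x i))) \<le> e * scale N ^ n"
proof -
  from conv [OF r] obtain \<delta> L where \<delta>: "0 < \<delta>" and
    ev: "\<forall>\<^sub>F N in sequentially.
           (\<forall>x\<in>polydisc r \<delta>. integrable (P N) (\<lambda>\<omega>. HC (H N) N x (lam N \<omega>))) \<and>
           log_branch_on (polydisc r \<delta>) (\<lambda>x. \<integral>\<omega>. HC (H N) N x (lam N \<omega>) \<partial>P N) (L N)" and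
    lim: "uniform_limit (polydisc r \<delta>)
          (\<lambda>N x. of_real (real N powr (real n * \<epsilon>)) *
             (1 / of_nat N * L N x -
              (\<Sum>j<n. \<Sum>i<r. 1 / of_real (real N powr (real j * \<epsilon>)) * \<Psi> j (x i))))
          (\<lambda>x. \<Sum>i<r. \<Psi> n (x i)) sequentially" by blast
  let ?S = "\<lambda>N x. \<Sum>i<r. \<Sum>j\<le>n. of_real (scale N) ^ j * \<Psi> j (x i)"
  let ?T = "\<lambda>x. \<Sum>i<r. \<Psi> n (x i)"
  show ?thesis
  proof (rule that [OF \<delta>, of L], goal_cases)
    case 1
    from ev show ?case by eventually_elim blast
  next
    case 2
    from ev eventually_ge_at_top [of r] show ?case
    proof eventually_elim
      case (elim N)
      then show ?case using r by (auto simp: log_branch_on_def mean_at_0)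
    qed
  next
    case (3 e)
    from uniform_limitD [OF lim 3] eventually_ge_at_top [of 1] show ?case
    proof eventually_elim
      case (elim N)
      note tp = powr_eq_scale [OF elim(2)]
      define T where "T = (of_real (scale N) ^ n :: complex)"
      have T: "T \<noteq> 0" "norm T = scale N ^ n" using scale_pos [OF elim(2)] by (auto simp: T_def norm_power)
      show ?case
      proof
        fix x assume x: "x \<in> polydisc r \<delta>"
        define S where "S = (\<Sum>j<n. \<Sum>i<r. of_real (scale N) ^ j * \<Psi> j (x i))"
        have "?S N x = (\<Sum>j\<le>n. \<Sum>i<r. of_real (scale N) ^ j * \<Psi> j (x i))"
          by (rule sum.swap)
        also have "\<dots> = S + T * ?T x"
          unfolding S_def T_def by (simp add: lessThan_Suc_atMost [symmetric] sum_distrib_left)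
        finally have sw: "?S N x = S + T * ?T x" .
        have "norm (1 / T * (1 / of_nat N * L N x - S) - ?T x) < e"
          using elim(1) x unfolding tp T_def S_def by (simp add: dist_norm)
        then have "norm T * norm (1 / T * (1 / of_nat N * L N x - S) - ?T x) \<le> norm T * e"
          by (intro mult_left_mono) auto
        also have "norm T * norm (1 / T * (1 / of_nat N * L N x - S) - ?T x) =
           norm (L N x / of_nat N - (S + T * ?T x))"
        proof -
          have "T * (1 / T * Y - Z) = Y - T * Z" for Y Z
            using T(1) by (simp add: right_diff_distrib)
          then show ?thesis unfolding norm_mult [symmetric] by (simp add: algebra_simps)
        qed
        finally show "norm (L N x / of_nat N - ?S N x) \<le> e * scale N ^ n"
          unfolding sw T(2) by (simp add: mult.commute)
      qed
    qed
  qed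
qed

text \<open>Each step of the recursion uses up one variable, hence the \<open>r + k\<close> variables for the \<open>k\<close>-th function in \<open>r\<close>
variables.\<close>

lemma eventually_dominated:
  assumes "r \<ge> 1"
  obtains \<delta> where "0 < \<delta>" "\<forall>\<^sub>F N in sequentially. dominated (P N) (H N) N (lam N) k r \<delta>"
proof -
  from assms have "r + k \<ge> 1" by simp
  then obtain \<delta> where \<delta>: "0 < \<delta>" and
    ev: "\<forall>\<^sub>F N in sequentially. \<forall>x\<in>polydisc (r + k) \<delta>. integrable (P N) (\<lambda>\<omega>. HC (H N) N x (lam N \<omega>))"
    by (rule log_expansion)
  have "\<forall>\<^sub>F N in sequentially. dominated (P N) (H N) N (lam N) k r (\<delta> / 2 ^ Suc k)"
    using ev eventually_ge_at_top [of "r + k"]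
  proof eventually_elim
    case (elim N)
    then show ?case using assms \<delta> by (intro dominated_of_integrable haar) auto
  qed
  with \<delta> show ?thesis by (intro that [of "\<delta> / 2 ^ Suc k"]) auto
qed

lemma Psi_holomorphic:
  obtains \<delta> where "0 < \<delta>" "\<And>j. j \<le> n \<Longrightarrow> \<Psi> j holomorphic_on ball 0 \<delta>"
proof -
  have "\<exists>\<delta>>0. \<Psi> j holomorphic_on ball 0 \<delta>" if "j \<le> n" for j
    using Psi [OF that] by (auto simp: analytic_on_def)
  then obtain d where d: "\<And>j. j \<le> n \<Longrightarrow> d j > 0" "\<And>j. j \<le> n \<Longrightarrow> \<Psi> j holomorphic_on ball 0 (d j)"
    by metis
  define \<delta> where "\<delta> = Min (d ` {..n})"
  have "0 < \<delta>" using d(1) by (auto simp: \<delta>_def)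
  moreover have "\<Psi> j holomorphic_on ball 0 \<delta>" if "j \<le> n" for j
    by (rule holomorphic_on_subset [OF d(2) [OF that]]) (use that in \<open>auto simp: \<delta>_def intro: order.strict_trans2\<close>)
  ultimately show ?thesis by (rule that)
qed

lemma slope_bounded:
  obtains \<delta> K where "0 < \<delta>" "0 \<le> K" "\<And>N. N \<ge> 1 \<Longrightarrow> slope N holomorphic_on ball 0 \<delta>"
    "\<And>N z. N \<ge> 1 \<Longrightarrow> z \<in> ball 0 \<delta> \<Longrightarrow> norm (slope N z) \<le> K"
proof -
  obtain \<delta> where \<delta>: "0 < \<delta>" "\<And>j. j \<le> n \<Longrightarrow> \<Psi> j holomorphic_on ball 0 \<delta>"
    by (rule Psi_holomorphic) blast
  have hol: "deriv (\<Psi> j) holomorphic_on ball 0 \<delta>" if "j \<le> n" for j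
    by (rule holomorphic_deriv [OF \<delta>(2) [OF that]]) simp
  have "\<exists>B. \<forall>z\<in>ball 0 (\<delta> / 2). norm (deriv (\<Psi> j) z) \<le> B" if "j \<le> n" for j
  proof -
    have "continuous_on (cball 0 (\<delta> / 2)) (deriv (\<Psi> j))"
      by (rule continuous_on_subset [OF holomorphic_on_imp_continuous_on [OF hol [OF that]]]) (use \<delta> in auto)
    then have "bounded (deriv (\<Psi> j) ` cball 0 (\<delta> / 2))"
      by (intro compact_imp_bounded compact_continuous_image) auto
    then obtain B where "\<forall>w\<in>deriv (\<Psi> j) ` cball 0 (\<delta> / 2). norm w \<le> B"
      unfolding bounded_iff by blast
    then show ?thesis by (intro exI [of _ B]) auto
  qed
  then obtain B where B: "\<And>j z. j \<le> n \<Longrightarrow> z \<in> ball 0 (\<delta> / 2) \<Longrightarrow> norm (deriv (\<Psi> j) z) \<le> B j" by metis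
  have B0: "0 \<le> B j" if "j \<le> n" for j
    using B [OF that, of 0] \<delta> by (intro order.trans [OF norm_ge_zero]) auto
  show ?thesis
  proof (rule that [of "\<delta> / 2" "\<Sum>j\<le>n. B j"])
    show "0 < \<delta> / 2" "0 \<le> (\<Sum>j\<le>n. B j)" using \<delta> B0 by (auto intro: sum_nonneg)
    show "slope N holomorphic_on ball 0 (\<delta> / 2)" for N
      unfolding slope_def
      by (intro holomorphic_intros holomorphic_on_subset [OF hol]) (use \<delta> in auto)
    fix N :: nat and z :: complex assume N: "N \<ge> 1" and z: "z \<in> ball 0 (\<delta> / 2)"
    show "norm (slope N z) \<le> (\<Sum>j\<le>n. B j)"
      unfolding slope_def
    proof (intro order.trans [OF norm_sum] sum_mono)
      fix j assume "j \<in> {..n}"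
      then have "norm (of_real (scale N) ^ j * deriv (\<Psi> j) z) \<le> 1 * B j"
        unfolding norm_mult using scale_pos [OF N] scale_le_1 [OF N] z
        by (intro mult_mono B) (auto simp: norm_power power_le_one)
      then show "norm (of_real (scale N) ^ j * deriv (\<Psi> j) z) \<le> B j" by simp
    qed
  qed
qed

lemma lim_fun_slope_bounded:
  obtains \<delta> K where "0 < \<delta>" "0 \<le> K" "\<And>N. N \<ge> 1 \<Longrightarrow> lim_fun (slope N) k holomorphic_on ball 0 \<delta>"
    "\<And>N z. N \<ge> 1 \<Longrightarrow> z \<in> ball 0 \<delta> \<Longrightarrow> norm (lim_fun (slope N) k z) \<le> K"
proof -
  obtain \<delta> K where u: "0 < \<delta>" "0 \<le> K" "\<And>N. N \<ge> 1 \<Longrightarrow> slope N holomorphic_on ball 0 \<delta>"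
    "\<And>N z. N \<ge> 1 \<Longrightarrow> z \<in> ball 0 \<delta> \<Longrightarrow> norm (slope N z) \<le> K" by (rule slope_bounded) blast
  have "\<exists>\<delta>' K'. 0 < \<delta>' \<and> \<delta>' \<le> \<delta> \<and> 0 \<le> K' \<and>
     (\<forall>v\<in>slope ` {1..}. lim_fun v k holomorphic_on ball 0 \<delta>' \<and> (\<forall>z\<in>ball 0 \<delta>'. norm (lim_fun v k z) \<le> K'))"
    by (rule lim_fun_holomorphic_bounded [of \<delta> "slope ` {1..}" K]) (use u in auto)
  then show ?thesis using that by (metis atLeast_iff imageI)
qed

text \<open>This is where \<open>n * \<epsilon> < 1\<close> enters.\<close>

lemma inverse_N_negligible:
  assumes "0 < e"
  shows "\<forall>\<^sub>F N in sequentially. C / real N \<le> e * scale N ^ n"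
proof -
  have "(\<lambda>N. real N powr (real n * \<epsilon> - 1)) \<longlonglongrightarrow> 0"
    using eps by (intro tendsto_neg_powr filterlim_real_sequentially) auto
  then have "(\<lambda>N. C * real N powr (real n * \<epsilon> - 1)) \<longlonglongrightarrow> C * 0" by (intro tendsto_intros)
  then have "\<forall>\<^sub>F N in sequentially. C * real N powr (real n * \<epsilon> - 1) < e"
    using assms by (intro order_tendstoD) auto
  then show ?thesis
    using eventually_ge_at_top [of 1]
  proof eventually_elim
    case (elim N)
    have "C / real N = C * real N powr (real n * \<epsilon> - 1) * scale N ^ n"
      using elim(2) by (simp add: scale_power powr_diff)
    also have "\<dots> \<le> e * scale N ^ n"
      using elim scale_pos [of N] by (intro mult_right_mono) auto
    finally show ?case .
  qed
qed

text \<open>Induction on \<open>k\<close> for all \<open>r\<close> simultaneously, since the step for \<open>r\<close> variables uses \<open>r + 1\<close> of them. Dividing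
the recursion by \<open>N\<^sup>k\<^sup>+\<^sup>1 * E [HC]\<close> turns the derivative \<open>\<partial>\<^sub>i\<close> into \<open>\<partial>\<^sub>i / N\<close> plus multiplication by the
logarithmic derivative of \<open>E [HC]\<close> over \<open>N\<close>; the latter is close to \<open>slope\<close> by Cauchy's estimate applied to
the error in the hypothesis.\<close>

lemma normalized_mean_approximation:
  assumes "r \<ge> 1"
  shows "\<exists>\<delta>>0. \<forall>e>0. \<forall>\<^sub>F N in sequentially. \<forall>i<r. \<forall>x\<in>polydisc r \<delta>.
           norm (normalized_mean N k i x - lim_fun (slope N) k (x i)) \<le> e * scale N ^ n"
  using assms
proof (induction k arbitrary: r)
  case 0
  obtain \<delta> L where \<delta>: "0 < \<delta>" and
    L: "\<forall>\<^sub>F N in sequentially. continuous_on (polydisc r \<delta>) (L N) \<and> L N (\<lambda>_. 0) = 0 \<and>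
        (\<forall>i<r. \<forall>x\<in>polydisc r \<delta>. exp (L N x) = mean_at N 0 i x)" by (rule log_expansion [OF 0])
  show ?case
  proof (intro exI conjI allI impI)
    show "0 < \<delta>" by (rule \<delta>)
    fix e :: real assume "0 < e"
    show "\<forall>\<^sub>F N in sequentially. \<forall>i<r. \<forall>x\<in>polydisc r \<delta>.
           norm (normalized_mean N 0 i x - lim_fun (slope N) 0 (x i)) \<le> e * scale N ^ n"
      using L eventually_ge_at_top [of 1]
    proof eventually_elim
      case (elim N)
      have "normalized_mean N 0 i x = 1" if "i < r" "x \<in> polydisc r \<delta>" for i x
      proof -
        have "mean_at N 0 i x = exp (L N x)" using elim(1) that by simp
        then show ?thesis by (simp add: normalized_mean_def)
      qed
      then show ?case using scale_pos [OF elim(2)] \<open>0 < e\<close> by simp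
    qed
  qed
next
  case (Suc k)
  then have r: "1 \<le> r" "1 \<le> r + 1" by auto
  from Suc.IH [OF r(2)] obtain \<delta>1 where \<delta>1: "0 < \<delta>1" and
    IH: "\<And>e. 0 < e \<Longrightarrow> \<forall>\<^sub>F N in sequentially. \<forall>i<r+1. \<forall>x\<in>polydisc (r + 1) \<delta>1.
           norm (normalized_mean N k i x - lim_fun (slope N) k (x i)) \<le> e * scale N ^ n" by blast
  obtain \<delta>2 L where \<delta>2: "0 < \<delta>2" and
    L: "\<forall>\<^sub>F N in sequentially. continuous_on (polydisc (r + 1) \<delta>2) (L N) \<and> L N (\<lambda>_. 0) = 0 \<and>
        (\<forall>i<r + 1. \<forall>x\<in>polydisc (r + 1) \<delta>2. exp (L N x) = mean_at N 0 i x)" and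
    Lexp: "\<And>e. 0 < e \<Longrightarrow> \<forall>\<^sub>F N in sequentially. \<forall>x\<in>polydisc (r + 1) \<delta>2.
        norm (L N x / of_nat N - (\<Sum>i<r + 1. \<Sum>j\<le>n. of_real (scale N) ^ j * \<Psi> j (x i))) \<le> e * scale N ^ n"
    by (rule log_expansion [OF r(2)]) blast
  obtain \<delta>3 K3 where f: "0 < \<delta>3" "0 \<le> K3" "\<And>N. N \<ge> 1 \<Longrightarrow> lim_fun (slope N) k holomorphic_on ball 0 \<delta>3"
    "\<And>N z. N \<ge> 1 \<Longrightarrow> z \<in> ball 0 \<delta>3 \<Longrightarrow> norm (lim_fun (slope N) k z) \<le> K3"
    by (rule lim_fun_slope_bounded) blast
  obtain \<delta>4 K4 where f': "0 < \<delta>4" "\<And>N. N \<ge> 1 \<Longrightarrow> lim_fun (slope N) (Suc k) holomorphic_on ball 0 \<delta>4"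
    by (rule lim_fun_slope_bounded) blast
  obtain \<delta>5 K5 where ub: "0 < \<delta>5" "0 \<le> K5" "\<And>N z. N \<ge> 1 \<Longrightarrow> z \<in> ball 0 \<delta>5 \<Longrightarrow> norm (slope N z) \<le> K5"
    by (rule slope_bounded) blast
  obtain \<delta>6 where dom0: "0 < \<delta>6" "\<forall>\<^sub>F N in sequentially. dominated (P N) (H N) N (lam N) 0 (r + 1) \<delta>6"
    by (rule eventually_dominated [OF r(2)])
  obtain \<delta>7 where domk: "0 < \<delta>7" "\<forall>\<^sub>F N in sequentially. dominated (P N) (H N) N (lam N) k (r + 1) \<delta>7"
    by (rule eventually_dominated [OF r(2)])
  obtain \<delta>8 where domS: "0 < \<delta>8" "\<forall>\<^sub>F N in sequentially. dominated (P N) (H N) N (lam N) (Suc k) r \<delta>8"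
    by (rule eventually_dominated [OF r(1)])
  obtain \<delta>9 where Ps: "0 < \<delta>9" "\<And>j. j \<le> n \<Longrightarrow> \<Psi> j holomorphic_on ball 0 \<delta>9" by (rule Psi_holomorphic) blast
  define S where "S = {\<delta>1, \<delta>2, \<delta>3, \<delta>4, \<delta>5, \<delta>6, \<delta>7, \<delta>8, \<delta>9}"
  define D where "D = Min S"
  have "finite S" "S \<noteq> {}" by (simp_all add: S_def)
  moreover have "\<forall>d\<in>S. 0 < d"
    using \<delta>1 \<delta>2 f(1) f'(1) ub(1) dom0(1) domk(1) domS(1) Ps(1) by (simp add: S_def)
  ultimately have D: "0 < D" and D_le: "\<And>d. d \<in> S \<Longrightarrow> D \<le> d"
    by (simp_all add: D_def Min_gr_iff)
  have Dle: "D \<le> \<delta>1" "D \<le> \<delta>2" "D \<le> \<delta>3" "D \<le> \<delta>4" "D \<le> \<delta>5" "D \<le> \<delta>6" "D \<le> \<delta>7" "D \<le> \<delta>8" "D \<le> \<delta>9"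
    by (rule D_le, simp add: S_def)+
  define K where "K = max K3 K5"
  \<comment> \<open>the error of the step is at most \<open>C1 * e1 * t\<^sup>n + C2 / N\<close>\<close>
  define C1 where "C1 = K + 4 / D * (K + 1) + 8 / D"
  define C2 where "C2 = 4 * (K + 1) / D + 8 * real r * K / D"
  have K: "0 \<le> K" using f(2) by (simp add: K_def)
  have C1: "0 < C1" using K D by (simp add: C1_def add_nonneg_pos)
  have balls: "ball 0 D \<subseteq> ball (0::complex) \<delta>3" "ball 0 D \<subseteq> ball (0::complex) \<delta>4" "ball 0 D \<subseteq> ball (0::complex) \<delta>9"
    using Dle by auto
  have fD: "lim_fun (slope N) k holomorphic_on ball 0 D" "lim_fun (slope N) (Suc k) holomorphic_on ball 0 D"
    "\<And>z. z \<in> ball 0 D \<Longrightarrow> norm (lim_fun (slope N) k z) \<le> K" "\<And>z. z \<in> ball 0 D \<Longrightarrow> norm (slope N z) \<le> K" if "N \<ge> 1" for N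
  proof -
    show "lim_fun (slope N) k holomorphic_on ball 0 D"
      by (rule holomorphic_on_subset [OF f(3) [OF that] balls(1)])
    show "lim_fun (slope N) (Suc k) holomorphic_on ball 0 D"
      by (rule holomorphic_on_subset [OF f'(2) [OF that] balls(2)])
    show "norm (lim_fun (slope N) k z) \<le> K" if "z \<in> ball 0 D" for z
    proof -
      have "norm (lim_fun (slope N) k z) \<le> K3" using that Dle(3) by (intro f(4) \<open>N \<ge> 1\<close>) simp
      then show ?thesis by (simp add: K_def)
    qed
    show "norm (slope N z) \<le> K" if "z \<in> ball 0 D" for z
    proof -
      have "norm (slope N z) \<le> K5" using that Dle(5) by (intro ub(3) \<open>N \<ge> 1\<close>) simp
      then show ?thesis by (simp add: K_def)
    qed
  qed
  have PsD: "\<Psi> j holomorphic_on ball 0 D" if "j \<le> n" for j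
    using holomorphic_on_subset [OF Ps(2) [OF that] balls(3)] .
  show ?case
  proof (intro exI [of _ "D / 2"] conjI allI impI)
    show "0 < D / 2" using D by simp
    fix e :: real assume e: "0 < e"
    define e1 where "e1 = min 1 (e / (2 * C1))"
    have e1: "0 < e1" "e1 \<le> 1" "e1 * C1 \<le> e / 2"
      using e C1 by (auto simp: e1_def min_def field_simps)
    have "0 < e / 2" using e by simp
    from IH [OF e1(1)] Lexp [OF e1(1)] L dom0(2) domk(2) domS(2)
      inverse_N_negligible [OF this, of C2] eventually_ge_at_top [of "r + 1"]
    show "\<forall>\<^sub>F N in sequentially. \<forall>i<r. \<forall>x\<in>polydisc r (D / 2).
           norm (normalized_mean N (Suc k) i x - lim_fun (slope N) (Suc k) (x i)) \<le> e * scale N ^ n"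
    proof eventually_elim
      case (elim N)
      have N: "N \<ge> 1" and rN: "r < N" "r + 1 \<le> N" "r \<le> N" using elim(8) by auto
      note HN = haar [OF N]
      have tn: "0 < scale N ^ n" "scale N ^ n \<le> 1" using scale_pos [OF N] scale_le_1 [OF N] by (auto simp: power_le_one)
      have toD: "x \<in> polydisc s \<rho>" if "x \<in> polydisc s D" "D \<le> \<rho>" for x s \<rho>
        using polydisc_mono [OF that(1), of s \<rho>] that D by simp
      have d0: "dominated (P N) (H N) N (lam N) 0 (r + 1) D"
        and dk: "dominated (P N) (H N) N (lam N) k (r + 1) D"
        and dS: "dominated (P N) (H N) N (lam N) (Suc k) r D"
        using dominated_mono elim(4-6) Dle dom0(1) domk(1) domS(1) by blast+
      have FL: "mean_at N 0 i x = exp (L N x)" if "x \<in> polydisc (r + 1) D" "i < r + 1" for x i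
        using elim(3) toD [OF that(1) Dle(2)] that(2) by simp
      have G0hol: "(\<lambda>z. mean_at N 0 i (x(l := z))) holomorphic_on ball 0 D"
        if "x \<in> polydisc (r + 1) D" "i < r + 1" "l < r + 1" for x i l
        unfolding mean_at_def by (rule mean_dunkl_holomorphic [OF HN d0 rN(2) that])
      have Gkhol: "(\<lambda>z. mean_at N k i (x(l := z))) holomorphic_on ball 0 D"
        if "x \<in> polydisc (r + 1) D" "i < r + 1" "l < r + 1" for x i l
        unfolding mean_at_def by (rule mean_dunkl_holomorphic [OF HN dk rN(2) that])
      have G0nz: "mean_at N 0 i (x(l := z)) \<noteq> 0"
        if "x \<in> polydisc (r + 1) D" "i < r + 1" "l < r + 1" "z \<in> ball 0 D" for x i l z
        using FL [OF polydisc_upd [OF that(1,3), of z] that(2)] that(4) by simp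
      have Nz: "(of_nat N :: complex) ^ k \<noteq> 0" using N by simp
      have hhol: "(\<lambda>z. normalized_mean N k i (x(l := z))) holomorphic_on ball 0 D"
        if "x \<in> polydisc (r + 1) D" "i \<le> r" "l \<le> r" for x i l
        unfolding normalized_mean_def using that Nz
        by (intro holomorphic_intros Gkhol G0hol) (auto simp: G0nz)
      have Lhol: "(\<lambda>z. L N (x(i := z))) holomorphic_on ball 0 D"
        if x: "x \<in> polydisc (r + 1) D" and i: "i < r + 1" for x i
      proof (rule holomorphic_exp_lift)
        have "continuous_on (ball 0 D) (\<lambda>z. x(i := z))"
        proof (rule continuous_on_coordinatewise_then_product)
          show "continuous_on (ball 0 D) (\<lambda>z. (x(i := z)) q)" for q
            by (cases "q = i") (auto intro!: continuous_intros)
        qed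
        moreover have "(\<lambda>z. x(i := z)) ` ball 0 D \<subseteq> polydisc (r + 1) \<delta>2"
          using toD [OF polydisc_upd [OF x i] Dle(2)] by auto
        ultimately show "continuous_on (ball 0 D) (\<lambda>z. L N (x(i := z)))"
          by (rule continuous_on_compose2 [OF conjunct1 [OF elim(3)]])
        have "exp (L N (x(i := z))) = mean_at N 0 i (x(i := z))" if "z \<in> ball 0 D" for z
          using FL [OF polydisc_upd [OF x i] i, of z] that by simp
        then show "(\<lambda>z. exp (L N (x(i := z)))) holomorphic_on ball 0 D"
          by (intro holomorphic_transform [OF G0hol [OF x i i]]) simp
      qed
      show ?case
      proof (intro allI impI ballI)
        fix i x assume i: "i < r" and x: "x \<in> polydisc r (D / 2)"
        have up: "y \<in> polydisc r D" "y \<in> polydisc (r + 1) D" if "y \<in> polydisc r (D / 2)" for y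
          using that D by (auto intro: polydisc_mono)
        define v where "v = (\<lambda>y. deriv (\<lambda>z. L N (y(i := z))) (y i) / of_nat N)"
        have yi: "y i \<in> ball 0 D" "y i \<in> ball 0 (D / 2)" if "y \<in> polydisc r (D / 2)" for y
          using polydisc_norm [OF that, of i] D by auto
        have v: "norm (v y - slope N (y i)) \<le> 4 * (e1 * scale N ^ n) / D" if y: "y \<in> polydisc r (D / 2)" for y
        proof -
          define \<Phi> where "\<Phi> = (\<lambda>z. \<Sum>j\<le>n. of_real (scale N) ^ j * \<Psi> j z)"
          \<comment> \<open>the other coordinates contribute a constant, which the derivative removes\<close>
          define c where "c = (\<Sum>l\<in>{..<r+1} - {i}. \<Phi> (y l))"
          define \<sigma> where "\<sigma> = (\<lambda>z. L N (y(i := z)) / of_nat N - (\<Phi> z + c))"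
          have iy: "i < r + 1" using i by simp
          have \<Phi>hol: "\<Phi> holomorphic_on ball 0 D"
            unfolding \<Phi>_def by (intro holomorphic_intros PsD) auto
          have \<sigma>hol: "\<sigma> holomorphic_on ball 0 D"
            unfolding \<sigma>_def using N by (intro holomorphic_intros Lhol \<Phi>hol up(2) y iy) auto
          have \<sigma>b: "norm (\<sigma> z) \<le> e1 * scale N ^ n" if z: "z \<in> ball 0 D" for z
          proof -
            have "y(i := z) \<in> polydisc (r + 1) D" using z by (intro polydisc_upd up(2) y iy) simp
            from elim(2) [rule_format, OF toD [OF this Dle(2)]]
            have "norm (L N (y(i := z)) / of_nat N - (\<Sum>l<r + 1. \<Phi> ((y(i := z)) l))) \<le> e1 * scale N ^ n"
              unfolding \<Phi>_def .
            moreover have "(\<Sum>l<r + 1. \<Phi> ((y(i := z)) l)) = \<Phi> z + c"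
            proof -
              have "(\<Sum>l\<in>{..<r+1} - {i}. \<Phi> ((y(i := z)) l)) = c"
                unfolding c_def by (intro sum.cong) auto
              then show ?thesis using iy by (subst sum.remove [of _ i]) auto
            qed
            ultimately show ?thesis by (simp only: \<sigma>_def)
          qed
          have "((\<lambda>z. L N (y(i := z))) has_field_derivative deriv (\<lambda>z. L N (y(i := z))) (y i)) (at (y i))"
            by (rule holomorphic_derivI [OF Lhol [OF up(2) [OF y] iy]]) (use yi [OF y] in auto)
          moreover have "(\<Phi> has_field_derivative slope N (y i)) (at (y i))"
            unfolding \<Phi>_def slope_def
            using yi [OF y] by (intro DERIV_sum DERIV_cmult holomorphic_derivI [OF PsD]) auto
          ultimately have "(\<sigma> has_field_derivative v y - (slope N (y i) + 0)) (at (y i))"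
            unfolding \<sigma>_def v_def by (intro DERIV_diff DERIV_add DERIV_cdivide DERIV_const)
          then have "deriv \<sigma> (y i) = v y - slope N (y i)" by (simp add: DERIV_imp_deriv)
          with cauchy_deriv_bound [OF \<sigma>hol \<sigma>b D yi(2) [OF y]] show ?thesis by simp
        qed
        have rec: "normalized_mean N (Suc k) i y = v y * normalized_mean N k i y + deriv (\<lambda>z. normalized_mean N k i (y(i := z))) (y i) / of_nat N +
             (\<Sum>j\<in>{..<N} - {i}. (normalized_mean N k i y - normalized_mean N k j y) / (y i - y j)) / of_nat N"
          if y: "y \<in> polydisc r (D / 2)" and ne: "\<And>j. j < N \<Longrightarrow> j \<noteq> i \<Longrightarrow> y j \<noteq> y i" for y
        proof -
          have iy: "i < r + 1" "i < N" using i rN by auto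
          have yb: "y i \<in> ball 0 D" by (rule yi [OF y])
          define F where "F = exp (L N y)"
          define c where "c = (of_nat N :: complex) ^ k"
          have c0: "c \<noteq> 0" "F \<noteq> 0" "(of_nat N :: complex) \<noteq> 0" using Nz N by (auto simp: c_def F_def)
          have G0: "mean_at N 0 j y = F" if "j < N" for j
            using mean_at_0 [OF N that, of y] mean_at_0 [OF N iy(2), of y] FL [OF up(2) [OF y] iy(1)] by (simp add: F_def)
          have hj: "normalized_mean N k j y = mean_at N k j y / (c * F)" if "j < N" for j
            by (simp add: normalized_mean_def G0 [OF that] c_def)
          define m' where "m' = deriv (\<lambda>z. mean_at N k i (y(i := z))) (y i)"
          define l' where "l' = deriv (\<lambda>z. L N (y(i := z))) (y i)"
          have dG: "((\<lambda>z. mean_at N k i (y(i := z))) has_field_derivative m') (at (y i))"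
            unfolding m'_def by (rule holomorphic_derivI [OF Gkhol [OF up(2) [OF y] iy(1) iy(1)]]) (use yb in auto)
          have dL: "((\<lambda>z. L N (y(i := z))) has_field_derivative l') (at (y i))"
            unfolding l'_def by (rule holomorphic_derivI [OF Lhol [OF up(2) [OF y] iy(1)]]) (use yb in auto)
          have "((\<lambda>z. exp (- L N (y(i := z)))) has_field_derivative exp (- L N (y(i := y i))) * - l') (at (y i))"
            by (rule DERIV_chain2 [OF DERIV_exp DERIV_minus [OF dL]])
          from DERIV_cdivide [OF DERIV_mult [OF dG this], of c]
          have dE: "((\<lambda>z. mean_at N k i (y(i := z)) * exp (- L N (y(i := z))) / c) has_field_derivative
              (m' / F - mean_at N k i y * l' / F) / c) (at (y i))"
            by (simp add: F_def exp_minus field_simps)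
          have ev: "eventually (\<lambda>z. normalized_mean N k i (y(i := z)) = mean_at N k i (y(i := z)) * exp (- L N (y(i := z))) / c) (nhds (y i))"
          proof -
            have "eventually (\<lambda>z. z \<in> ball 0 D) (nhds (y i))"
              using yb by (intro eventually_nhds_in_open) auto
            then show ?thesis
            proof eventually_elim
              case (elim z)
              have "y(i := z) \<in> polydisc (r + 1) D" using elim by (intro polydisc_upd up(2) y iy) simp
              from FL [OF this iy(1)] show ?case
                by (simp add: normalized_mean_def c_def exp_minus field_simps)
            qed
          qed
          have "((\<lambda>z. normalized_mean N k i (y(i := z))) has_field_derivative (m' / F - mean_at N k i y * l' / F) / c) (at (y i))"
            by (subst DERIV_cong_ev [OF refl ev refl]) (rule dE)
          then have dh: "deriv (\<lambda>z. normalized_mean N k i (y(i := z))) (y i) = (m' / F - mean_at N k i y * l' / F) / c"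
            by (rule DERIV_imp_deriv)
          define S where "S = (\<Sum>j\<in>{..<N} - {i}. (mean_at N k i y - mean_at N k j y) / (y i - y j))"
          have "mean_at N (Suc k) i y = m' + S"
            unfolding S_def m'_def mean_at_def
            by (rule dominated_Suc_generic(2) [OF HN dk rN(1) D up(1) [OF y] i ne])
          then have "normalized_mean N (Suc k) i y = (m' + S) / (of_nat N * c * F)"
            by (simp add: normalized_mean_def G0 [OF iy(2)] c_def mult_ac)
          moreover have "(\<Sum>j\<in>{..<N} - {i}. (normalized_mean N k i y - normalized_mean N k j y) / (y i - y j)) = S / (c * F)"
            unfolding S_def sum_divide_distrib
            by (intro sum.cong refl) (simp add: hj iy(2) diff_divide_distrib [symmetric] mult_ac)
          ultimately show ?thesis
            unfolding dh hj [OF iy(2)] v_def l'_def [symmetric] using c0 by (simp add: field_simps)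
        qed
        have cont: "continuous_on (ball 0 (D / 2)) (\<lambda>z. normalized_mean N (Suc k) i (x(i := z)) -
            (slope N z * lim_fun (slope N) k z + back_quotient (lim_fun (slope N) k) z))"
        proof -
          have iy: "i < r + 1" using i by simp
          have "(\<lambda>z. mean_at N (Suc k) i (x(i := z))) holomorphic_on ball 0 D"
            unfolding mean_at_def by (rule mean_dunkl_holomorphic [OF HN dS rN(3) up(1) [OF x] i i])
          then have "(\<lambda>z. normalized_mean N (Suc k) i (x(i := z)) - lim_fun (slope N) (Suc k) z) holomorphic_on ball 0 D"
            unfolding normalized_mean_def using N
            by (intro holomorphic_on_diff holomorphic_on_divide holomorphic_on_mult holomorphic_on_const
                  G0hol [OF up(2) [OF x] iy iy] fD(2) [OF N]) (auto simp: G0nz [OF up(2) [OF x] iy iy])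
          then have "continuous_on (ball 0 D) (\<lambda>z. normalized_mean N (Suc k) i (x(i := z)) - lim_fun (slope N) (Suc k) z)"
            by (rule holomorphic_on_imp_continuous_on)
          then show ?thesis
            unfolding lim_fun.simps by (rule continuous_on_subset) (use D in auto)
        qed
        define \<eta> where "\<eta> = e1 * scale N ^ n"
        have \<eta>: "0 \<le> \<eta>" "\<eta> \<le> 1"
          using e1 tn by (auto simp: \<eta>_def intro: mult_le_one)
        have "norm (normalized_mean N (Suc k) i x - (slope N (x i) * lim_fun (slope N) k (x i) + back_quotient (lim_fun (slope N) k) (x i))) \<le>
          K * \<eta> + (4 * \<eta> / D) * (K + \<eta>) + 8 * \<eta> / D + (4 * (K + \<eta>) / D + 8 * real r * K / D) / real N"
        proof (rule dunkl_step_approximation [where h = "normalized_mean N k" and h' = "normalized_mean N (Suc k)" and v = v and u = "slope N"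
              and r = r and \<delta> = D and N = N])
          show "norm (normalized_mean N k i x - lim_fun (slope N) k (x i)) \<le> \<eta>" if "x \<in> polydisc (r + 1) D" "i \<le> r" for x i
            using elim(1) toD [OF that(1) Dle(1)] that(2) by (simp add: \<eta>_def)
          show "norm (v y - slope N (y i)) \<le> 4 * \<eta> / D" if "y \<in> polydisc r (D / 2)" for y
            using v [OF that] by (simp add: \<eta>_def)
        qed (fact normalized_mean_swap [OF N] hhol fD(1) [OF N] fD(3) [OF N] fD(4) [OF N] rN(1) D x i rec cont | assumption)+
        also have "\<dots> \<le> K * \<eta> + (4 * \<eta> / D) * (K + 1) + 8 * \<eta> / D + (4 * (K + 1) / D + 8 * real r * K / D) / real N"
          using \<eta> D K by (intro add_mono mult_left_mono divide_right_mono order_refl) auto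
        also have "\<dots> = C1 * e1 * scale N ^ n + C2 / real N"
          by (simp add: C1_def C2_def \<eta>_def algebra_simps)
        also have "\<dots> \<le> e / 2 * scale N ^ n + e / 2 * scale N ^ n"
          using elim(7) e1(3) tn by (intro add_mono mult_right_mono) (auto simp: mult.commute)
        also have "\<dots> = e * scale N ^ n" by simp
        finally show "norm (normalized_mean N (Suc k) i x - lim_fun (slope N) (Suc k) (x i)) \<le> e * scale N ^ n" by simp
      qed
    qed
  qed
qed

lemma scale_tendsto_0: "scale \<longlonglongrightarrow> 0"
  unfolding scale_def [abs_def] using eps by (intro tendsto_neg_powr filterlim_real_sequentially) auto

lemma lim_fun_slope_at_0:
  "\<exists>C. \<forall>N\<ge>1. norm (lim_fun (slope N) k 0 - (\<Sum>j\<le>n. of_real (scale N) ^ j * correction_moment \<Psi> j k)) \<le> C * scale N ^ (n + 1)"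
proof -
  define c where "c = (\<lambda>i. fps_expansion (deriv (\<Psi> i)) 0)"
  have "slope N has_fps_expansion (\<Sum>i\<le>n. fps_const (of_real (scale N) ^ i) * c i)" for N
  proof -
    have "deriv (\<Psi> i) has_fps_expansion c i" if "i \<le> n" for i
      unfolding c_def using Psi [OF that] by (intro analytic_at_imp_has_fps_expansion_0 analytic_deriv)
    then have "(\<lambda>z. \<Sum>j\<le>n. of_real (scale N) ^ j * deriv (\<Psi> j) z) has_fps_expansion
        (\<Sum>i\<le>n. fps_const (of_real (scale N) ^ i) * c i)"
      by (intro fps_expansion_intros) auto
    then show ?thesis by (simp add: slope_def [abs_def])
  qed
  from lim_fun_at_0 [OF this]
  have eq: "lim_fun (slope N) k 0 = (\<Sum>m\<le>k. of_nat (k choose m) / of_nat (m + 1) *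
      fps_nth ((\<Sum>i\<le>n. fps_const (of_real (scale N) ^ i) * c i) ^ (k - m)) m)" for N .
  obtain C where C: "\<And>s::real. 0 \<le> s \<Longrightarrow> s \<le> 1 \<Longrightarrow>
    norm ((\<Sum>m\<le>k. of_nat (k choose m) / of_nat (m + 1) *
             fps_nth ((\<Sum>i\<le>n. fps_const (of_real s ^ i) * c i) ^ (k - m)) m) -
          (\<Sum>j\<le>n. of_real s ^ j * correction_moment \<Psi> j k)) \<le> C * s ^ (n + 1)"
    using moment_polynomial_truncation [of n \<Psi> k, OF Psi] unfolding c_def by blast
  show ?thesis
    unfolding eq using C scale_pos scale_le_1 by (intro exI [of _ C]) (auto simp: less_imp_le)
qed

text \<open>Both the approximation error \<open>o(t\<^sup>n)\<close> and the truncation error \<open>O(t\<^sup>n\<^sup>+\<^sup>1)\<close> still tend to \<open>0\<close> after division by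
\<open>t\<^sup>n\<close>.\<close>

lemma normalized_moment_limit:
  "(\<lambda>N. of_real (real N powr (real n * \<epsilon>)) *
       (normalized_mean N k 0 (\<lambda>_. 0) - (\<Sum>j<n. 1 / of_real (real N powr (real j * \<epsilon>)) * correction_moment \<Psi> j k)))
    \<longlonglongrightarrow> correction_moment \<Psi> n k"
proof (rule LIMSEQ_I, goal_cases)
  case (1 e)
  obtain C where C: "\<And>N. N \<ge> 1 \<Longrightarrow>
      norm (lim_fun (slope N) k 0 - (\<Sum>j\<le>n. of_real (scale N) ^ j * correction_moment \<Psi> j k)) \<le> C * scale N ^ (n + 1)"
    using lim_fun_slope_at_0 by blast
  obtain \<delta> where \<delta>: "0 < \<delta>" and approx: "\<And>e. 0 < e \<Longrightarrow> \<forall>\<^sub>F N in sequentially. \<forall>i<1. \<forall>x\<in>polydisc 1 \<delta>.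
           norm (normalized_mean N k i x - lim_fun (slope N) k (x i)) \<le> e * scale N ^ n"
    using normalized_mean_approximation [of 1 k] by auto
  have e4: "0 < e / 4" using 1 by simp
  have "(\<lambda>N. C * scale N) \<longlonglongrightarrow> C * 0" by (intro tendsto_intros scale_tendsto_0)
  then have "\<forall>\<^sub>F N in sequentially. C * scale N < e / 4" using e4 by (intro order_tendstoD) auto
  with approx [OF e4] eventually_ge_at_top [of 1]
  have "\<forall>\<^sub>F N in sequentially. norm (of_real (real N powr (real n * \<epsilon>)) *
       (normalized_mean N k 0 (\<lambda>_. 0) - (\<Sum>j<n. 1 / of_real (real N powr (real j * \<epsilon>)) * correction_moment \<Psi> j k)) -
       correction_moment \<Psi> n k) < e"
  proof eventually_elim
    case (elim N)
    define T where "T = (of_real (scale N) ^ n :: complex)"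
    define x where "x = normalized_mean N k 0 (\<lambda>_. 0)"
    define S where "S = (\<Sum>j<n. of_real (scale N) ^ j * correction_moment \<Psi> j k)"
    note tp = powr_eq_scale [OF elim(2)]
    have T: "T \<noteq> 0" "norm T = scale N ^ n" using scale_pos [OF elim(2)] by (auto simp: T_def norm_power)
    have Sn: "(\<Sum>j\<le>n. of_real (scale N) ^ j * correction_moment \<Psi> j k) = S + T * correction_moment \<Psi> n k"
      by (simp add: S_def T_def lessThan_Suc_atMost [symmetric])
    have "norm (x - lim_fun (slope N) k 0) \<le> e / 4 * scale N ^ n"
    proof -
      have "(\<lambda>_. 0) \<in> polydisc 1 \<delta>" using \<delta> by (simp add: polydisc_def)
      with elim(1) have "norm (normalized_mean N k 0 (\<lambda>_. 0) - lim_fun (slope N) k ((\<lambda>_. 0) (0 :: nat))) \<le> e / 4 * scale N ^ n"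
        by blast
      then show ?thesis by (simp add: x_def)
    qed
    moreover have "norm (lim_fun (slope N) k 0 - (S + T * correction_moment \<Psi> n k)) \<le> e / 4 * scale N ^ n"
    proof -
      have "C * scale N ^ (n + 1) = C * scale N * scale N ^ n" by simp
      also have "\<dots> \<le> e / 4 * scale N ^ n"
        using elim(3) scale_pos [OF elim(2)] by (intro mult_right_mono) auto
      finally show ?thesis using C [OF elim(2)] unfolding Sn by linarith
    qed
    ultimately have "norm (x - (S + T * correction_moment \<Psi> n k)) \<le> e / 4 * scale N ^ n + e / 4 * scale N ^ n"
      by (rule norm_diff_triangle_le)
    moreover have "1 / T * (x - S) - correction_moment \<Psi> n k = (x - (S + T * correction_moment \<Psi> n k)) / T"
      using T(1) by (simp add: field_simps)
    ultimately have "norm (1 / T * (x - S) - correction_moment \<Psi> n k) \<le> e / 2"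
      using T scale_pos [OF elim(2)] by (simp add: norm_divide divide_le_eq)
    then show ?case
      unfolding tp T_def x_def S_def using 1 by simp
  qed
  then show ?case by (simp add: eventually_sequentially)
qed

lemma eventually_normalized_mean_at_0:
  "\<forall>\<^sub>F N in sequentially. normalized_mean N k 0 (\<lambda>_. 0) = mean_at N k 0 (\<lambda>_. 0) / of_nat N ^ k"
proof -
  obtain \<delta> L where \<delta>: "0 < \<delta>" and
    L: "\<forall>\<^sub>F N in sequentially. continuous_on (polydisc 1 \<delta>) (L N) \<and> L N (\<lambda>_. 0) = 0 \<and>
        (\<forall>i<1. \<forall>x\<in>polydisc 1 \<delta>. exp (L N x) = mean_at N 0 i x)" by (rule log_expansion [of 1]) auto
  from L show ?thesis
  proof eventually_elim
    case (elim N)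
    have "(\<lambda>_. 0) \<in> polydisc 1 \<delta>" using \<delta> by (simp add: polydisc_def)
    with elim have "exp (L N (\<lambda>_. 0)) = mean_at N 0 0 (\<lambda>_. 0)" by blast
    then show ?case using elim by (simp add: normalized_mean_def)
  qed
qed

end

section \<open>Corrections to the average empirical distribution\<close>

theorem theorem5:
  fixes n :: nat and \<epsilon> :: real
    and H :: "nat \<Rightarrow> complex mat measure"
    and P :: "nat \<Rightarrow> 'a measure"
    and A :: "nat \<Rightarrow> 'a \<Rightarrow> complex mat"
    and \<Psi> :: "nat \<Rightarrow> complex \<Rightarrow> complex"
  assumes n: "n \<ge> 1"
    and eps: "0 < \<epsilon>" "\<epsilon> < 1 / real n"
    and haar: "\<And>N. N \<ge> 1 \<Longrightarrow> haar_prob_measure N (H N)"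
    and A: "\<And>N. N \<ge> 1 \<Longrightarrow> random_hermitian N (P N) (A N)"
    and Psi: "\<And>j. j \<le> n \<Longrightarrow> \<Psi> j analytic_on {0}"
    and conv: "\<And>r. r \<ge> 1 \<Longrightarrow>
      \<exists>\<delta>>0. \<exists>L :: nat \<Rightarrow> (nat \<Rightarrow> complex) \<Rightarrow> complex.
        (\<forall>\<^sub>F N in sequentially.
           (\<forall>x\<in>polydisc r \<delta>. integrable (P N) (\<lambda>\<omega>. HC_mat (H N) N x (A N \<omega>))) \<and>
           log_branch_on (polydisc r \<delta>)
             (\<lambda>x. \<integral>\<omega>. HC_mat (H N) N x (A N \<omega>) \<partial>P N) (L N)) \<and>
        uniform_limit (polydisc r \<delta>)
          (\<lambda>N x. of_real (real N powr (real n * \<epsilon>)) *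
             (1 / of_nat N * L N x -
              (\<Sum>j<n. \<Sum>i<r. 1 / of_real (real N powr (real j * \<epsilon>)) * \<Psi> j (x i))))
          (\<lambda>x. \<Sum>i<r. \<Psi> n (x i)) sequentially"
  shows "\<forall>k\<ge>1.
    (\<lambda>N. of_real (real N powr (real n * \<epsilon>)) *
       (1 / of_nat N ^ (k + 1) * (\<integral>\<omega>. mat_trace (A N \<omega> ^\<^sub>m k) \<partial>P N) -
        (\<Sum>j<n. 1 / of_real (real N powr (real j * \<epsilon>)) * correction_moment \<Psi> j k)))
    \<longlonglongrightarrow> correction_moment \<Psi> n k"
proof -
  define lam where "lam = (\<lambda>N \<omega> i. eigenvalue_list (A N \<omega>) ! i)"
  have HC_mat: "HC_mat (H N) N x (A N \<omega>) = HC (H N) N x (lam N \<omega>)" for N x \<omega>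
    by (simp add: HC_mat_def lam_def)
  have "real n * \<epsilon> < 1" using n eps by (simp add: field_simps)
  then interpret hc_expansion n \<epsilon> H P lam \<Psi>
    by (rule hc_expansion.intro [OF eps(1) _ haar Psi conv [unfolded HC_mat]])
  show ?thesis
  proof (intro allI impI, rule Lim_transform_eventually [OF normalized_moment_limit], goal_cases)
    case (1 k)
    show ?case
    using eventually_normalized_mean_at_0 [of k] eventually_ge_at_top [of 1]
  proof eventually_elim
    case (elim N)
    have "(\<integral>\<omega>. mat_trace (A N \<omega> ^\<^sub>m k) \<partial>P N) = (\<integral>\<omega>. of_nat N * dunkl_hc (H N) N (lam N \<omega>) k 0 (\<lambda>_. 0) \<partial>P N)"
    proof (rule Bochner_Integration.integral_cong [OF refl])
      fix \<omega> assume "\<omega> \<in> space (P N)"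
      then have "hermitian_mat N (A N \<omega>)" using A [OF elim(2)] by (simp add: random_hermitian_def)
      from hermitian_trace_pow [OF this, of k]
      show "mat_trace (A N \<omega> ^\<^sub>m k) = of_nat N * dunkl_hc (H N) N (lam N \<omega>) k 0 (\<lambda>_. 0)"
        unfolding sum_powers_eq_dunkl_hc [OF haar [OF elim(2)] elim(2), symmetric] lam_def .
    qed
    also have "\<dots> = of_nat N * mean_at N k 0 (\<lambda>_. 0)"
      by (simp add: mean_at_def mean_dunkl_def)
    finally have "1 / of_nat N ^ (k + 1) * (\<integral>\<omega>. mat_trace (A N \<omega> ^\<^sub>m k) \<partial>P N) = normalized_mean N k 0 (\<lambda>_. 0)"
      using elim by simp
    then show ?case by (simp only:)
  qed
  qed
qed

end
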